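(* Let $g=(x,t)\in N_{3,2}$ with $x=|x|e_1\ne0$ and $t=(0,t_2,0)$, $t_2>0$ (that is, $t_1=0$). Then $$p_h(x,t)=\mathbf C\,8\pi^{3/2}\,h^{-3}\,\Upsilon(r)^{3/2}\,[-\Upsilon'(r)]^{-1/2}\,t_2^{-1/2}\,|x|^{-2}\,e^{-\frac{d(g)^2}{4h}}\,(1+o_g(1))\qquad\text{as }h\to0^+,$$ where $r$ is the unique solution of $\mu(r)=4|x|^{-2}t_2$ and $o_g(1)\to0$ as $h\to0^+$ for fixed $g$.
   Context: $N_{3,2}=\mathbb R^3\times\mathbb R^3$ with $(x,t)\cdot(x',t')=(x+x',\,t+t'-\tfrac12x\times x')$ ($\times$ = cross product). Left-invariant fields: $X_1=\partial_{x_1}-\tfrac12x_3\partial_{t_2}+\tfrac12x_2\partial_{t_3}$, $X_2=\partial_{x_2}+\tfrac12x_3\partial_{t_1}-\tfrac12x_1\partial_{t_3}$, $X_3=\partial_{x_3}-\tfrac12x_2\partial_{t_1}+\tfrac12x_1\partial_{t_2}$; $\Delta=X_1^2+X_2^2+X_3^2$. $d(g)$ is the Carnot--Carathéodory distance from the identity to $g$ (infimum of lengths of horizontal curves, $X_1,X_2,X_3$ orthonormal). The heat kernel of $\partial_h-\Delta$ (with respect to Lebesgue measure) is $p_h(x,t)=\mathbf C\,h^{-9/2}\,p(x/\sqrt h,t/h)$ with a positive (normalizing) constant $\mathbf C$ and $$p(x,t)=\int_{\mathbb R^3}\frac{|\lambda|}{\sinh|\lambda|}\exp\Big\{-\tfrac14\Big[|x|^2+\tfrac{|\lambda|\coth|\lambda|-1}{|\lambda|^2}\big(|\lambda|^2|x|^2-(\lambda\cdot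 x)^2\big)-4i\,t\cdot\lambda\Big]\Big\}d\lambda .$$ $\Upsilon(r)=\frac{r^2}{1-r\cot r}$. $\mu(\rho)=\frac{2\rho-\sin(2\rho)}{2\sin^2\rho}$ for $-\pi<\rho<\pi$, which is a diffeomorphism of $(-\pi,\pi)$ onto $\mathbb R$. $e_1=(1,0,0)$. *)

theory Defs
  imports "HOL-Analysis.Analysis"
begin

section \<open>The group $N_{3,2}$ and its Carnot--Caratheodory distance\<close>

type_synonym N32 = "(real ^ 3) \<times> (real ^ 3)"

text \<open>
  The vector fields that are left-invariant for
  $(x,t)\cdot(x',t') = (x+x',\, t+t'-\frac12 x\times x')$,
  in the coordinates $(\partial_x,\partial_t)$.
\<close>

definition X1 :: "N32 \<Rightarrow> N32" where
  "X1 g = (let x = fst g in (vector [1, 0, 0], vector [0, - (x $ 3) / 2, x $ 2 / 2]))"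

definition X2 :: "N32 \<Rightarrow> N32" where
  "X2 g = (let x = fst g in (vector [0, 1, 0], vector [x $ 3 / 2, 0, - (x $ 1) / 2]))"

definition X3 :: "N32 \<Rightarrow> N32" where
  "X3 g = (let x = fst g in (vector [0, 0, 1], vector [- (x $ 2) / 2, x $ 1 / 2, 0]))"

definition abs_cont_on :: "real \<Rightarrow> real \<Rightarrow> (real \<Rightarrow> 'a::real_normed_vector) \<Rightarrow> bool" where
  "abs_cont_on a b f \<longleftrightarrow>
     (\<forall>\<epsilon>>0. \<exists>\<delta>>0. \<forall>(n::nat) l r.
        (\<forall>i<n. a \<le> l i \<and> l i \<le> r i \<and> r i \<le> b) \<longrightarrow>
        disjoint_family_on (\<lambda>i. {l i<..<r i}) {..<n} \<longrightarrow>
        (\<Sum>i<n. r i - l i) < \<delta> \<longrightarrow> (\<Sum>i<n. norm (f (r i) - f (l i))) < \<epsilon>)"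

text \<open>
  A horizontal curve is an absolutely continuous curve whose velocity is almost everywhere a
  combination of the three fields with coefficients \<open>u\<close>.  Integrability of \<open>u\<close> is automatic (it is
  the derivative of the first component of \<open>\<gamma>\<close>); it is listed because the length is an integral
  of \<open>u\<close>, and an undefined integral would be \<open>0\<close>.
\<close>

definition horizontal_curve :: "(real \<Rightarrow> N32) \<Rightarrow> (real \<Rightarrow> real ^ 3) \<Rightarrow> bool" where
  "horizontal_curve \<gamma> u \<longleftrightarrow>
     abs_cont_on 0 1 \<gamma> \<and>
     u absolutely_integrable_on {0..1} \<and>
     (AE s in lebesgue_on {0..1}.
        (\<gamma> has_vector_derivative
           (u s $ 1 *\<^sub>R X1 (\<gamma> s) + u s $ 2 *\<^sub>R X2 (\<gamma> s) + u s $ 3 *\<^sub>R X3 (\<gamma> s)))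
        (at s within {0..1}))"

text \<open>Since the three fields are orthonormal, the speed is the Euclidean norm of \<open>u\<close>.\<close>

definition horizontal_length :: "(real \<Rightarrow> real ^ 3) \<Rightarrow> real" where
  "horizontal_length u = integral {0..1} (\<lambda>s. norm (u s))"

definition cc_dist :: "N32 \<Rightarrow> real" where
  "cc_dist g = Inf {horizontal_length u | u \<gamma>. horizontal_curve \<gamma> u \<and> \<gamma> 0 = 0 \<and> \<gamma> 1 = g}"

section \<open>The heat kernel\<close>

text \<open>
  The integrand is real-analytic after removing the singularity at $\lambda = 0$; here it has some
  other value at that single point, which does not affect the integral.
\<close>

definition heat_profile :: "real ^ 3 \<Rightarrow> real ^ 3 \<Rightarrow> complex" where
  "heat_profile x t =
     (LINT l|lborel.
        of_real (norm l / sinh (norm l)) *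
        exp (- (1 / 4) *
             (of_real ((norm x)\<^sup>2 +
                (norm l * (cosh (norm l) / sinh (norm l)) - 1) / (norm l)\<^sup>2 *
                ((norm l)\<^sup>2 * (norm x)\<^sup>2 - (l \<bullet> x)\<^sup>2))
              - 4 * \<i> * of_real (t \<bullet> l))))"

text \<open>
  The constant \<open>C\<close> is a parameter.  The heat kernel of $\partial_h - (X_1^2+X_2^2+X_3^2)$ is the
  member of this family with total mass one.
\<close>

definition heat_kernel :: "real \<Rightarrow> real \<Rightarrow> real ^ 3 \<Rightarrow> real ^ 3 \<Rightarrow> complex" where
  "heat_kernel C h x t =
     of_real (C * h powr (- 9 / 2)) * heat_profile ((1 / sqrt h) *\<^sub>R x) ((1 / h) *\<^sub>R t)"

section \<open>Auxiliary functions\<close>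

text \<open>Only used for \<open>0 < r < pi\<close>; the value at \<open>0\<close> is not the limit, which is \<open>3\<close>.\<close>

definition Upsilon :: "real \<Rightarrow> real" where
  "Upsilon r = r\<^sup>2 / (1 - r * cot r)"

text \<open>At \<open>0\<close> the convention \<open>0 / 0 = 0\<close> gives the value of the continuous extension.\<close>

definition mu :: "real \<Rightarrow> real" where
  "mu \<rho> = (2 * \<rho> - sin (2 * \<rho>)) / (2 * (sin \<rho>)\<^sup>2)"

end

theory Submission
  imports
    Defs
    "HOL-Complex_Analysis.Complex_Analysis"
    "HOL-Probability.Distributions"
    "HOL-Real_Asymp.Real_Asymp"
begin

no_notation fps_nth (infixl "$" 75)

text \<open>
  Since \<open>t\<close> points in the direction \<open>e\<^sub>2\<close> orthogonal to \<open>x\<close>, projecting a horizontal curve to the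
  plane of the first and third coordinates turns the distance into Dido's problem, solved by a
  circular arc of half opening angle \<open>r\<close>.

  The integrand of the heat kernel is holomorphic in \<open>\<lambda>\<^sub>2\<close> on the strip where the imaginary part is
  less than \<open>pi\<close> in absolute value, and the saddle point of the exponent is \<open>\<lambda> = i r e\<^sub>2\<close>, with critical
  value the squared distance divided by \<open>- 4 h\<close>.  After shifting the domain of integration there, the partial
  fractions \<open>z coth z = 1 + \<Sum> 2 z\<^sup>2 / (z\<^sup>2 + k\<^sup>2 pi\<^sup>2)\<close> show that the real part of the exponent
  has a strict global maximum at the saddle, with a quantitative gap; Laplace's method with
  dominated convergence then leaves a Gaussian integral.
\<close>

section \<open>Absolutely continuous curves\<close>

text \<open>One number \<open>r < pi\<close> governs both halves: it is the half angle of the arc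
  and the imaginary part of the saddle. At \<open>pi\<close> the arc closes to a full circle, and
  there also lies the nearest zero of sinh. Curves are differentiable only almost everywhere, so the
  lower bound for the distance comes from a calibration summed over short chords. Its cotangent is
  singular at elapsed length zero, which is why the clock gets a small head start. After the shift
  |\<lambda>|^2 is complex and |\<lambda>| would need a branch of the square root. Hence everything
  is written in w = |\<lambda>|^2 through an infinite product, whose logarithmic derivative is the
  partial fraction series. The gap of the exponent at the saddle stays bounded far away, so it does
  not give integrability by itself. The factor 1 / \<open>shc\<close> adds decay of order
  |\<lambda>|^-6, and both are merged into one majorant uniform in \<open>h\<close>. The curvatures
  at the saddle in the three coordinate directions involve the derivative of \<open>Upsilon\<close>,
  the derivative of \<open>mu\<close>, and \<open>mu\<close>; their product yields the
  constant.\<close>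

lemma abs_cont_on_sum_lt:
  fixes f :: "real \<Rightarrow> 'a::real_normed_vector"
  assumes "abs_cont_on a b f" "\<epsilon> > 0"
  obtains \<delta> where "\<delta> > 0"
    "\<And>P. P tagged_partial_division_of {a..b} \<Longrightarrow> (\<Sum>(x,K)\<in>P. measure lborel K) < \<delta> \<Longrightarrow>
       (\<Sum>(x,K)\<in>P. norm (f (Sup K) - f (Inf K))) < \<epsilon>"
proof -
  obtain \<delta> where "\<delta> > 0" and \<delta>: "\<And>(n::nat) l r.
        (\<forall>i<n. a \<le> l i \<and> l i \<le> r i \<and> r i \<le> b) \<Longrightarrow>
        disjoint_family_on (\<lambda>i. {l i<..<r i}) {..<n} \<Longrightarrow>
        (\<Sum>i<n. r i - l i) < \<delta> \<Longrightarrow> (\<Sum>i<n. norm (f (r i) - f (l i))) < \<epsilon>"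
    using assms unfolding abs_cont_on_def by blast
  show ?thesis
  proof (rule that[OF \<open>\<delta> > 0\<close>])
    fix P assume P: "P tagged_partial_division_of {a..b}" and lt: "(\<Sum>(x,K)\<in>P. measure lborel K) < \<delta>"
    have "finite P" using tagged_partial_division_ofD(1)[OF P] .
    \<comment> \<open>Enumerating the pieces matches the definition, which speaks of intervals
      indexed by natural numbers.\<close>
    then obtain g where g: "bij_betw g {..<card P} P"
      using ex_bij_betw_nat_finite[of P] by (auto simp: atLeast0LessThan)
    have K: "\<exists>u v. snd q = {u..v} \<and> u \<le> v \<and> a \<le> u \<and> v \<le> b" if "q \<in> P" for q
    proof -
      obtain x k where q: "q = (x,k)" by (cases q)
      have xk: "x \<in> k" "k \<subseteq> {a..b}"
        using tagged_partial_division_ofD(2,3)[OF P, of x k] that q by simp_all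
      obtain u v where uv: "k = {u..v}"
        using tagged_partial_division_ofD(4)[OF P, of x k] \<open>q \<in> P\<close> q by auto
      then have "u \<le> v" using xk(1) by simp
      then have "a \<le> u \<and> v \<le> b" using xk(2) uv by simp
      then show ?thesis using q uv \<open>u \<le> v\<close> by auto
    qed
    define l where "l i = Inf (snd (g i))" for i
    define r where "r i = Sup (snd (g i))" for i
    have gP: "g i \<in> P" if "i < card P" for i using bij_betwE[OF g] that by simp
    have lr: "snd (g i) = {l i..r i} \<and> a \<le> l i \<and> l i \<le> r i \<and> r i \<le> b" if "i < card P" for i
      using K[OF gP[OF that]] unfolding l_def r_def by (metis cInf_atLeastAtMost cSup_atLeastAtMost)
    have "(\<Sum>i<card P. norm (f (r i) - f (l i))) < \<epsilon>"
    proof (rule \<delta>)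
      show "\<forall>i<card P. a \<le> l i \<and> l i \<le> r i \<and> r i \<le> b" using lr by blast
      show "disjoint_family_on (\<lambda>i. {l i<..<r i}) {..<card P}"
        unfolding disjoint_family_on_def
      proof (intro ballI impI)
        fix i j assume ij: "i \<in> {..<card P}" "j \<in> {..<card P}" "i \<noteq> j"
        then have "g i \<noteq> g j" using bij_betw_imp_inj_on[OF g] by (metis inj_onD)
        moreover have "(fst (g i), snd (g i)) \<in> P" "(fst (g j), snd (g j)) \<in> P" using gP ij by auto
        ultimately have "interior (snd (g i)) \<inter> interior (snd (g j)) = {}"
          using tagged_partial_division_ofD(5)[OF P] by (metis prod.collapse)
        then show "{l i<..<r i} \<inter> {l j<..<r j} = {}"
          using lr ij by (simp add: interior_atLeastAtMost_real)
      qed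
      have "(\<Sum>i<card P. r i - l i) = (\<Sum>i<card P. measure lborel (snd (g i)))"
        using lr by (intro sum.cong) auto
      also have "\<dots> = (\<Sum>q\<in>P. measure lborel (snd q))"
        by (rule sum.reindex_bij_betw[OF g])
      finally show "(\<Sum>i<card P. r i - l i) < \<delta>" using lt by (simp add: case_prod_unfold)
    qed
    also have "(\<Sum>i<card P. norm (f (r i) - f (l i))) = (\<Sum>q\<in>P. norm (f (Sup (snd q)) - f (Inf (snd q))))"
      unfolding l_def r_def by (rule sum.reindex_bij_betw[OF g])
    finally show "(\<Sum>(x,K)\<in>P. norm (f (Sup K) - f (Inf K))) < \<epsilon>" by (simp add: case_prod_unfold)
  qed
qed

text \<open>
  The gauge is chosen separately at the tags in the exceptional set: there the subintervals have
  small total length, and absolute continuity makes their contribution small.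
\<close>

lemma fundamental_theorem_of_calculus_abs_cont:
  fixes f :: "real \<Rightarrow> 'a::banach"
  assumes ac: "abs_cont_on a b f" and "a \<le> b" and N: "negligible N"
    and vecd: "\<And>x. x \<in> {a..b} - N \<Longrightarrow> (f has_vector_derivative f' x) (at x within {a..b})"
  shows "(f' has_integral (f b - f a)) {a..b}"
proof -
  \<comment> \<open>With the derivative set to \<open>0\<close> on \<open>N\<close>, the error at a
    tag in \<open>N\<close> is just the increment of \<open>f\<close>.\<close>
  define g where "g x = (if x \<in> N then 0 else f' x)" for x
  have "(g has_integral (f b - f a)) (cbox a b)"
    unfolding has_integral
  proof safe
    fix e0 :: real assume "e0 > 0"
    \<comment> \<open>Half of \<open>e0\<close> is spent on the regular tags;
      \<open>b - a + 1\<close> keeps the quotient defined when \<open>a = b\<close>.\<close>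
    define e where "e = e0 / (2 * (b - a + 1))"
    have "e > 0" using \<open>e0 > 0\<close> \<open>a \<le> b\<close> by (simp add: e_def)
    have "\<forall>x. \<exists>d>0. x \<in> {a..b} - N \<longrightarrow>
         (\<forall>y\<in>{a..b}. norm (y-x) < d \<longrightarrow> norm (f y - f x - (y-x) *\<^sub>R f' x) \<le> e * norm (y-x))"
      using vecd[unfolded has_vector_derivative_def has_derivative_within_alt] \<open>e > 0\<close>
      by blast
    then obtain d where d: "\<And>x. 0 < d x"
      "\<And>x y. \<lbrakk>x \<in> {a..b} - N; y \<in> {a..b}; norm (y-x) < d x\<rbrakk>
                        \<Longrightarrow> norm (f y - f x - (y-x) *\<^sub>R f' x) \<le> e * norm (y-x)"
      by metis
    obtain \<delta> where "\<delta> > 0" and \<delta>: "\<And>P. P tagged_partial_division_of {a..b} \<Longrightarrow>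
        (\<Sum>(x,K)\<in>P. measure lborel K) < \<delta> \<Longrightarrow> (\<Sum>(x,K)\<in>P. norm (f (Sup K) - f (Inf K))) < e0 / 2"
      using abs_cont_on_sum_lt[OF ac, of "e0/2"] \<open>e0 > 0\<close> by auto
    \<comment> \<open>The Riemann sum of this indicator is the total length of the pieces tagged in
      \<open>N\<close>, so its gauge makes that length smaller than \<open>\<delta>\<close>.\<close>
    have indN: "((indicator N :: real \<Rightarrow> real) has_integral 0) (cbox a b)"
      using N unfolding negligible_def by blast
    obtain \<gamma> where gauge: "gauge \<gamma>" and \<gamma>: "\<forall>P. P tagged_division_of (cbox a b) \<and> \<gamma> fine P \<longrightarrow>
        norm ((\<Sum>(x,K)\<in>P. measure lborel K *\<^sub>R (indicator N x :: real)) - 0) < \<delta>"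
      using indN[unfolded has_integral, rule_format, OF \<open>\<delta> > 0\<close>] by (elim exE conjE) (rule that)
    show "\<exists>\<gamma>. gauge \<gamma> \<and> (\<forall>P. P tagged_division_of (cbox a b) \<and> \<gamma> fine P \<longrightarrow>
        norm ((\<Sum>(x,K)\<in>P. measure lborel K *\<^sub>R g x) - (f b - f a)) < e0)"
    proof (intro exI conjI allI impI)
      show "gauge (\<lambda>x. ball x (d x) \<inter> \<gamma> x)"
        by (intro gauge_Int gauge gauge_ball_dependent allI d(1))
      fix P assume "P tagged_division_of (cbox a b) \<and> (\<lambda>x. ball x (d x) \<inter> \<gamma> x) fine P"
      then have ptag: "P tagged_division_of (cbox a b)" and finep: "(\<lambda>x. ball x (d x)) fine P"
        and finep2: "\<gamma> fine P"
        by (auto simp: fine_def)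
      have "finite P" using ptag by blast
      have ba: "b - a = (\<Sum>(x,K)\<in>P. Sup K - Inf K)" "f b - f a = (\<Sum>(x,K)\<in>P. f(Sup K) - f(Inf K))"
        using additive_tagged_division_1[where f= "\<lambda>x. x"] additive_tagged_division_1[where f= f]
            \<open>a \<le> b\<close> ptag by auto
      define B where "B = {q \<in> P. fst q \<in> N}"
      have Bpart: "B tagged_partial_division_of {a..b}"
        using ptag unfolding tagged_division_of_def B_def
        by (auto intro: tagged_partial_division_subset)
      have "(\<Sum>(x,K)\<in>B. measure lborel K) = (\<Sum>(x,K)\<in>P. measure lborel K *\<^sub>R (indicator N x :: real))"
        unfolding B_def using \<open>finite P\<close>
        by (intro sum.mono_neutral_cong_left) (auto simp: indicator_def)
      also have "\<dots> < \<delta>" using \<gamma>[rule_format, of P] ptag finep2 by simp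
      finally have Bsum: "(\<Sum>(x,K)\<in>B. norm (f (Sup K) - f (Inf K))) < e0 / 2"
        by (rule \<delta>[OF Bpart])
      have "norm (\<Sum>(x,K)\<in>P. measure lborel K *\<^sub>R g x - (f (Sup K) - f (Inf K)))
          \<le> (\<Sum>q\<in>P. e * (case q of (x,K) \<Rightarrow> Sup K - Inf K)
                + (if q \<in> B then (case q of (x,K) \<Rightarrow> norm (f (Sup K) - f (Inf K))) else 0))"
      proof (rule sum_norm_le)
        fix q assume "q \<in> P"
        moreover obtain x K where q: "q = (x, K)" by (cases q)
        ultimately have xK: "(x, K) \<in> P" by simp
        then have "x \<in> K" and kab: "K \<subseteq> cbox a b"
          using ptag by blast+
        then obtain u v where k: "K = cbox u v" using ptag xK by auto
        have "u \<le> v" using \<open>x \<in> K\<close> unfolding k by auto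
        have ball: "\<forall>y\<in>K. y \<in> ball x (d x)" using finep xK by blast
        have uv: "u \<in> K" "v \<in> K" by (simp_all add: \<open>u \<le> v\<close> k)
        have "norm (measure lborel K *\<^sub>R g x - (f (Sup K) - f (Inf K))) \<le>
              e * (case (x,K) of (x,K) \<Rightarrow> Sup K - Inf K)
                + (if (x,K) \<in> B then (case (x,K) of (x,K) \<Rightarrow> norm (f (Sup K) - f (Inf K))) else 0)"
        proof (cases "x \<in> N")
          case True
          then show ?thesis using xK \<open>u \<le> v\<close> \<open>e > 0\<close> unfolding k
            by (simp add: g_def B_def norm_minus_commute)
        next
          case False
          then have xab: "x \<in> {a..b} - N" using \<open>x \<in> K\<close> kab by auto
          have "norm ((v - u) *\<^sub>R f' x - (f v - f u)) = norm (f u - f x - (u - x) *\<^sub>R f' x - (f v - f x - (v - x) *\<^sub>R f' x))"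
            by (auto simp: algebra_simps)
          also have "\<dots> \<le> norm (f u - f x - (u - x) *\<^sub>R f' x) + norm (f v - f x - (v - x) *\<^sub>R f' x)"
            by (rule norm_triangle_ineq4)
          also have "\<dots> \<le> e * norm (u - x) + e * norm (v - x)"
            using ball uv kab by (intro add_mono d(2)[OF xab]) (auto simp: dist_real_def)
          also have "\<dots> = e * (v - u)"
            using \<open>x \<in> K\<close> by (auto simp: k algebra_simps)
          finally show ?thesis using False xK \<open>u \<le> v\<close> unfolding k
            by (simp add: g_def B_def)
        qed
        then show "norm (case q of (x,K) \<Rightarrow> measure lborel K *\<^sub>R g x - (f (Sup K) - f (Inf K))) \<le>
              e * (case q of (x,K) \<Rightarrow> Sup K - Inf K)
                + (if q \<in> B then (case q of (x,K) \<Rightarrow> norm (f (Sup K) - f (Inf K))) else 0)"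
          by (simp only: q prod.case)
      qed
      also have "\<dots> = e * (b - a) + (\<Sum>(x,K)\<in>B. norm (f (Sup K) - f (Inf K)))"
      proof -
        have "(\<Sum>q\<in>P. (if q \<in> B then (case q of (x,K) \<Rightarrow> norm (f (Sup K) - f (Inf K))) else 0))
           = (\<Sum>(x,K)\<in>B. norm (f (Sup K) - f (Inf K)))"
          using \<open>finite P\<close> by (subst sum.inter_restrict[symmetric]) (auto simp: B_def intro!: sum.cong)
        then show ?thesis unfolding sum.distrib ba(1) by (simp add: sum_distrib_left)
      qed
      also have "\<dots> < e0"
      proof -
        have "e * (b - a) \<le> e0 / 2"
          using \<open>a \<le> b\<close> \<open>e0 > 0\<close> by (simp add: e_def field_simps)
        then show ?thesis using Bsum by linarith
      qed
      finally show "norm ((\<Sum>(x,K)\<in>P. measure lborel K *\<^sub>R g x) - (f b - f a)) < e0"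
        unfolding ba(2) sum_subtractf[symmetric] case_prod_unfold .
    qed
  qed
  then have "(g has_integral (f b - f a)) {a..b}" unfolding box_real .
  moreover have "f' x = g x" if "x \<in> {a..b} - N" for x using that unfolding g_def by simp
  ultimately show ?thesis by (metis has_integral_spike[OF N])
qed

section \<open>Elementary properties of absolute continuity\<close>

lemma abs_cont_on_subset:
  assumes "abs_cont_on a b f" "a \<le> c" "d \<le> b"
  shows "abs_cont_on c d f"
  unfolding abs_cont_on_def
proof (intro allI impI)
  fix \<epsilon> :: real assume "\<epsilon> > 0"
  then obtain \<delta> where "\<delta> > 0" and \<delta>: "\<And>(n::nat) l r.
        (\<forall>i<n. a \<le> l i \<and> l i \<le> r i \<and> r i \<le> b) \<Longrightarrow>
        disjoint_family_on (\<lambda>i. {l i<..<r i}) {..<n} \<Longrightarrow>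
        (\<Sum>i<n. r i - l i) < \<delta> \<Longrightarrow> (\<Sum>i<n. norm (f (r i) - f (l i))) < \<epsilon>"
    using assms(1) unfolding abs_cont_on_def by blast
  show "\<exists>\<delta>>0. \<forall>(n::nat) l r.
        (\<forall>i<n. c \<le> l i \<and> l i \<le> r i \<and> r i \<le> d) \<longrightarrow>
        disjoint_family_on (\<lambda>i. {l i<..<r i}) {..<n} \<longrightarrow>
        (\<Sum>i<n. r i - l i) < \<delta> \<longrightarrow> (\<Sum>i<n. norm (f (r i) - f (l i))) < \<epsilon>"
  proof (intro exI[of _ \<delta>] conjI allI impI \<open>\<delta> > 0\<close>)
    fix n :: nat and l r :: "nat \<Rightarrow> real"
    assume *: "\<forall>i<n. c \<le> l i \<and> l i \<le> r i \<and> r i \<le> d"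
      "disjoint_family_on (\<lambda>i. {l i<..<r i}) {..<n}" "(\<Sum>i<n. r i - l i) < \<delta>"
    show "(\<Sum>i<n. norm (f (r i) - f (l i))) < \<epsilon>"
      using *(1) assms(2,3) by (intro \<delta>[OF _ *(2,3)]) force
  qed
qed

lemma abs_cont_on_imp_uniformly_continuous_on:
  assumes "abs_cont_on a b f"
  shows "uniformly_continuous_on {a..b} f"
  unfolding uniformly_continuous_on_def
proof (intro allI impI)
  fix \<epsilon> :: real assume "\<epsilon> > 0"
  then obtain \<delta> where "\<delta> > 0" and \<delta>: "\<And>(n::nat) l r.
        (\<forall>i<n. a \<le> l i \<and> l i \<le> r i \<and> r i \<le> b) \<Longrightarrow>
        disjoint_family_on (\<lambda>i. {l i<..<r i}) {..<n} \<Longrightarrow>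
        (\<Sum>i<n. r i - l i) < \<delta> \<Longrightarrow> (\<Sum>i<n. norm (f (r i) - f (l i))) < \<epsilon>"
    using assms(1) unfolding abs_cont_on_def by blast
  have *: "norm (f t - f s) < \<epsilon>" if "a \<le> s" "s \<le> t" "t \<le> b" "t - s < \<delta>" for s t
    using \<delta>[of "Suc 0" "\<lambda>_. s" "\<lambda>_. t"] that by (simp add: disjoint_family_on_def)
  show "\<exists>d>0. \<forall>x\<in>{a..b}. \<forall>x'\<in>{a..b}. dist x' x < d \<longrightarrow> dist (f x') (f x) < \<epsilon>"
  proof (intro exI[of _ \<delta>] conjI ballI impI \<open>\<delta> > 0\<close>)
    fix s t assume "s \<in> {a..b}" "t \<in> {a..b}" "dist t s < \<delta>"
    then show "dist (f t) (f s) < \<epsilon>"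
      using *[of s t] *[of t s] by (cases "s \<le> t") (auto simp: dist_norm norm_minus_commute)
  qed
qed

lemma lipschitz_imp_abs_cont_on:
  fixes f :: "real \<Rightarrow> 'a::real_normed_vector"
  assumes "\<And>s t. \<lbrakk>a \<le> s; s \<le> t; t \<le> b\<rbrakk> \<Longrightarrow> norm (f t - f s) \<le> B * (t - s)"
  shows "abs_cont_on a b f"
  unfolding abs_cont_on_def
proof (intro allI impI)
  fix \<epsilon> :: real assume "\<epsilon> > 0"
  define M where "M = \<bar>B\<bar> + 1"
  have "M > 0" by (simp add: M_def)
  show "\<exists>\<delta>>0. \<forall>(n::nat) l r.
        (\<forall>i<n. a \<le> l i \<and> l i \<le> r i \<and> r i \<le> b) \<longrightarrow>
        disjoint_family_on (\<lambda>i. {l i<..<r i}) {..<n} \<longrightarrow>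
        (\<Sum>i<n. r i - l i) < \<delta> \<longrightarrow> (\<Sum>i<n. norm (f (r i) - f (l i))) < \<epsilon>"
  proof (intro exI[of _ "\<epsilon> / M"] conjI allI impI)
    show "\<epsilon> / M > 0" using \<open>\<epsilon> > 0\<close> \<open>M > 0\<close> by simp
    fix n :: nat and l r :: "nat \<Rightarrow> real"
    assume lr: "\<forall>i<n. a \<le> l i \<and> l i \<le> r i \<and> r i \<le> b"
      and lt: "(\<Sum>i<n. r i - l i) < \<epsilon> / M"
    have "(\<Sum>i<n. norm (f (r i) - f (l i))) \<le> (\<Sum>i<n. M * (r i - l i))"
    proof (rule sum_mono)
      fix i assume "i \<in> {..<n}"
      then have i: "a \<le> l i" "l i \<le> r i" "r i \<le> b" using lr by auto
      have "norm (f (r i) - f (l i)) \<le> B * (r i - l i)" using i by (rule assms)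
      also have "\<dots> \<le> M * (r i - l i)" using i by (intro mult_right_mono) (auto simp: M_def)
      finally show "norm (f (r i) - f (l i)) \<le> M * (r i - l i)" .
    qed
    also have "\<dots> = M * (\<Sum>i<n. r i - l i)" by (rule sum_distrib_left[symmetric])
    also have "\<dots> < \<epsilon>" using lt \<open>M > 0\<close> by (metis pos_less_divide_eq mult.commute)
    finally show "(\<Sum>i<n. norm (f (r i) - f (l i))) < \<epsilon>" .
  qed
qed

text \<open>
  The function \<open>l - k * cot (k * l) * norm p ^ 2 - 4 * k * area\<close> of the elapsed length \<open>l\<close>, the
  endpoint \<open>p\<close> and the enclosed area calibrates Dido's problem: along a unit-speed curve its
  derivative is a sum of two squares.
\<close>

lemma dido_calibration_segment:
  fixes k l d p1 p3 q1 q3 :: real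
  assumes k: "0 < k" and l: "0 < l" and kl: "k * (l + d) < pi" and d: "0 \<le> d"
    and le: "(q1 - p1)\<^sup>2 + (q3 - p3)\<^sup>2 \<le> d\<^sup>2"
  shows "l - k * cot (k * l) * (p1\<^sup>2 + p3\<^sup>2) \<le>
         (l + d) - k * cot (k * (l + d)) * (q1\<^sup>2 + q3\<^sup>2) - 2 * k * (p1 * q3 - p3 * q1)"
proof (cases "d = 0")
  case True
  then have "(q1 - p1)\<^sup>2 + (q3 - p3)\<^sup>2 \<le> 0" using le by simp
  then have "q1 = p1" "q3 = p3" unfolding sum_power2_le_zero_iff by simp_all
  then show ?thesis using True by simp
next
  case False
  define v1 where "v1 = (q1 - p1) / d"
  define v3 where "v3 = (q3 - p3) / d"
  have q: "q1 = p1 + d * v1" "q3 = p3 + d * v3" using False by (simp_all add: v1_def v3_def)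
  have "v1\<^sup>2 + v3\<^sup>2 = ((q1 - p1)\<^sup>2 + (q3 - p3)\<^sup>2) / d\<^sup>2"
    by (simp add: v1_def v3_def power_divide add_divide_distrib)
  also have "\<dots> \<le> 1" using le False by (simp add: divide_le_eq_1)
  finally have v: "v1\<^sup>2 + v3\<^sup>2 \<le> 1" .
  \<comment> \<open>The calibration along the chord from \<open>p\<close> to \<open>q\<close>. Seen
    from the origin, a straight line sweeps area at a constant rate, whence the last term.\<close>
  define \<phi> where "\<phi> s = (l + s) - k * cot (k * (l + s)) * ((p1 + s * v1)\<^sup>2 + (p3 + s * v3)\<^sup>2)
     - 2 * k * s * (p1 * v3 - p3 * v1)" for s
  have "\<phi> 0 \<le> \<phi> d"
  proof (rule DERIV_nonneg_imp_nondecreasing[OF d])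
    fix s assume s: "0 \<le> s" "s \<le> d"
    have "0 < k * (l + s)" using k l s by simp
    moreover have "k * (l + s) < pi" using kl k s by (smt (verit) mult_left_mono)
    ultimately have sin: "sin (k * (l + s)) > 0" by (rule sin_gt_zero)
    define c where "c = cot (k * (l + s))"
    define z1 where "z1 = p1 + s * v1"
    define z3 where "z3 = p3 + s * v3"
    have inv: "inverse ((sin (k * (l + s)))\<^sup>2) = 1 + c\<^sup>2"
      using sin sin_cos_squared_add[of "k * (l + s)"] unfolding c_def cot_def
      by (simp add: field_simps)
    have D: "((\<lambda>s. cot (k * (l + s))) has_real_derivative - (1 + c\<^sup>2) * k) (at s)"
      unfolding inv[symmetric] by (rule DERIV_chain2[OF DERIV_cot]) (use sin in \<open>auto intro!: derivative_eq_intros\<close>)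
    have "(\<phi> has_real_derivative
        1 + k\<^sup>2 * (1 + c\<^sup>2) * (z1\<^sup>2 + z3\<^sup>2) - 2 * k * c * (z1 * v1 + z3 * v3) - 2 * k * (p1 * v3 - p3 * v1)) (at s)"
      unfolding \<phi>_def
      by (rule derivative_eq_intros D refl)+
        (simp add: c_def[symmetric] z1_def[symmetric] z3_def[symmetric], algebra)
    moreover have "0 \<le> 1 + k\<^sup>2 * (1 + c\<^sup>2) * (z1\<^sup>2 + z3\<^sup>2) - 2 * k * c * (z1 * v1 + z3 * v3) - 2 * k * (p1 * v3 - p3 * v1)"
    proof -
      \<comment> \<open>Both squares vanish on unit-speed circular arcs of radius
        \<open>1 / (2 * k)\<close> leaving the origin. A smaller speed only adds the nonnegative
        term \<open>1 - (v1\<^sup>2 + v3\<^sup>2)\<close> to the derivative.\<close>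
      have "0 \<le> (v1 - k * c * z1 + k * z3)\<^sup>2 + (v3 - k * c * z3 - k * z1)\<^sup>2" by simp
      also have "\<dots> = (v1\<^sup>2 + v3\<^sup>2) + k\<^sup>2 * (1 + c\<^sup>2) * (z1\<^sup>2 + z3\<^sup>2)
          - 2 * k * c * (z1 * v1 + z3 * v3) - 2 * k * (z1 * v3 - z3 * v1)"
        by algebra
      also have "z1 * v3 - z3 * v1 = p1 * v3 - p3 * v1" by (simp add: z1_def z3_def algebra_simps)
      finally show ?thesis using v by linarith
    qed
    ultimately show "\<exists>y. DERIV \<phi> s :> y \<and> 0 \<le> y" by blast
  qed
  then show ?thesis unfolding \<phi>_def q by (simp add: algebra_simps)
qed

section \<open>Displacement and swept area of a horizontal curve\<close>

lemma horizontal_velocity: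
  fixes a :: "real ^ 3" and g :: N32
  shows "fst (a $ 1 *\<^sub>R X1 g + a $ 2 *\<^sub>R X2 g + a $ 3 *\<^sub>R X3 g) = a"
    and "snd (a $ 1 *\<^sub>R X1 g + a $ 2 *\<^sub>R X2 g + a $ 3 *\<^sub>R X3 g) $ 2
      = (fst g $ 1 * a $ 3 - fst g $ 3 * a $ 1) / 2"
  by (simp_all add: X1_def X2_def X3_def Let_def vec_eq_iff forall_3 field_simps)

text \<open>The velocity exists only almost everywhere, but absolute continuity recovers increments
  from it; both statements are linear images of one vector integral. The second integrand is the
  rate at which area is swept from the origin in the plane of coordinates 1 and 3, the source of
  Dido's problem.\<close>

lemma horizontal_curve_has_integral:
  assumes "horizontal_curve \<gamma> u" "0 \<le> a" "a \<le> b" "b \<le> 1"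
  shows "(u has_integral (fst (\<gamma> b) - fst (\<gamma> a))) {a..b}"
    and "((\<lambda>s. (fst (\<gamma> s) $ 1 * u s $ 3 - fst (\<gamma> s) $ 3 * u s $ 1) / 2)
           has_integral (snd (\<gamma> b) $ 2 - snd (\<gamma> a) $ 2)) {a..b}"
proof -
  define v where "v s = u s $ 1 *\<^sub>R X1 (\<gamma> s) + u s $ 2 *\<^sub>R X2 (\<gamma> s) + u s $ 3 *\<^sub>R X3 (\<gamma> s)" for s
  have "AE s in lebesgue_on {0..1}. (\<gamma> has_vector_derivative v s) (at s within {0..1})"
    using assms(1) unfolding horizontal_curve_def v_def by simp
  then have "AE s in lebesgue. s \<in> {0..1} \<longrightarrow> (\<gamma> has_vector_derivative v s) (at s within {0..1})"
    by (subst (asm) AE_restrict_space_iff) auto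
  then obtain N where N: "N \<in> null_sets lebesgue"
    "{s. \<not> (s \<in> {0..1} \<longrightarrow> (\<gamma> has_vector_derivative v s) (at s within {0..1}))} \<subseteq> N"
    unfolding eventually_ae_filter by auto
  have v: "(v has_integral (\<gamma> b - \<gamma> a)) {a..b}"
  proof (rule fundamental_theorem_of_calculus_abs_cont)
    show "abs_cont_on a b \<gamma>" using assms abs_cont_on_subset unfolding horizontal_curve_def by blast
    show "negligible N" using N(1) by (simp add: negligible_iff_null_sets)
    fix x assume "x \<in> {a..b} - N"
    then have "(\<gamma> has_vector_derivative v x) (at x within {0..1})"
    proof -
      have "x \<in> {0..1}" using \<open>x \<in> {a..b} - N\<close> assms(2-4) by simp
      then show ?thesis using N(2) \<open>x \<in> {a..b} - N\<close> by auto
    qed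
    then show "(\<gamma> has_vector_derivative v x) (at x within {a..b})"
      using assms by (auto elim!: has_vector_derivative_within_subset)
  qed fact
  have 2: "(((\<lambda>g. snd g $ 2) \<circ> v) has_integral (snd (\<gamma> b - \<gamma> a) $ 2)) {a..b}"
    using has_integral_linear[OF v bounded_linear_compose[OF bounded_linear_vec_nth bounded_linear_snd]]
    by simp
  have "((fst \<circ> v) has_integral fst (\<gamma> b - \<gamma> a)) {a..b}"
    by (rule has_integral_linear[OF v bounded_linear_fst])
  moreover have "fst \<circ> v = u" using horizontal_velocity(1) by (auto simp: v_def fun_eq_iff)
  ultimately show "(u has_integral (fst (\<gamma> b) - fst (\<gamma> a))) {a..b}" by simp
  have "(\<lambda>g. snd g $ 2) \<circ> v = (\<lambda>s. (fst (\<gamma> s) $ 1 * u s $ 3 - fst (\<gamma> s) $ 3 * u s $ 1) / 2)"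
    using horizontal_velocity(2) by (auto simp: v_def fun_eq_iff)
  then show "((\<lambda>s. (fst (\<gamma> s) $ 1 * u s $ 3 - fst (\<gamma> s) $ 3 * u s $ 1) / 2)
           has_integral (snd (\<gamma> b) $ 2 - snd (\<gamma> a) $ 2)) {a..b}"
    using 2 by simp
qed

section \<open>The distance as a solution of Dido's problem\<close>

text \<open>Multiplied by \<open>r\<close>, the left side is what the calibration gives per squared
  chord, and the right side is the squared ratio of arc to chord.\<close>

lemma mu_plus_cot:
  assumes "sin r \<noteq> 0"
  shows "mu r + cot r = r / (sin r)\<^sup>2"
  using assms by (simp add: mu_def cot_def sin_double power2_eq_square diff_divide_distrib)

text \<open>A calibration with \<open>k = r / L\<close> that starts at \<open>0\<close> and never
  decreases is nonnegative at the end, which is the claim divided by \<open>L\<close>. To avoid the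
  cotangent at \<open>0\<close> the clock starts at \<open>\<epsilon>\<close>; monotonicity comes
  from cutting the curve into short pieces and comparing each with its chord.\<close>

lemma horizontal_length_ge:
  fixes r :: real
  assumes hc: "horizontal_curve \<gamma> u" and \<gamma>0: "\<gamma> 0 = 0" and r: "0 < r" "r < pi"
  shows "r * (cot r * ((fst (\<gamma> 1) $ 1)\<^sup>2 + (fst (\<gamma> 1) $ 3)\<^sup>2) + 4 * snd (\<gamma> 1) $ 2)
           \<le> (horizontal_length u)\<^sup>2"
proof -
  define L where "L = horizontal_length u"
  define x where "x s = fst (\<gamma> s)" for s
  define y where "y s = snd (\<gamma> s) $ 2" for s
  have uabs: "u absolutely_integrable_on {0..1}" and "abs_cont_on 0 1 \<gamma>"
    using hc unfolding horizontal_curve_def by auto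
  have nint: "(\<lambda>s. norm (u s)) integrable_on {a..b}" if "0 \<le> a" "b \<le> 1" for a b
    by (rule integrable_on_subinterval[OF absolutely_integrable_on_def[THEN iffD1, OF uabs, THEN conjunct2]])
      (use that in auto)
  define len where "len a b = integral {a..b} (\<lambda>s. norm (u s))" for a b
  \<comment> \<open>An undefined integral is \<open>0\<close>, so nonnegativity holds for all
    \<open>a\<close> and \<open>b\<close>.\<close>
  have len_ge0: "len a b \<ge> 0" for a b
    unfolding len_def by (cases "(\<lambda>s. norm (u s)) integrable_on {a..b}")
      (auto intro: integral_nonneg simp: not_integrable_integral)
  have len_add: "len 0 a + len a b = len 0 b" if "0 \<le> a" "a \<le> b" "b \<le> 1" for a b
    unfolding len_def using that by (intro Henstock_Kurzweil_Integration.integral_combine nint) auto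
  have L: "L = len 0 1" by (simp add: L_def len_def horizontal_length_def)
  have disp: "norm (x b - x a) \<le> len a b" if "0 \<le> a" "a \<le> b" "b \<le> 1" for a b
  proof -
    have *: "(u has_integral (x b - x a)) {a..b}"
      unfolding x_def by (rule horizontal_curve_has_integral(1)[OF hc that])
    then have "norm (integral {a..b} u) \<le> len a b"
      unfolding len_def using that by (intro integral_norm_bound_integral nint) (auto simp: has_integral_integrable)
    then show ?thesis using * by (simp add: integral_unique)
  qed
  \<comment> \<open>Area between a piece of the curve and its chord: subtracting the starting point
    from \<open>x s\<close> leaves an integrand bounded by oscillation times speed.\<close>
  have area: "\<bar>y b - y a - (x a $ 1 * x b $ 3 - x a $ 3 * x b $ 1) / 2\<bar> \<le> \<eta> * len a b"
    if ab: "0 \<le> a" "a \<le> b" "b \<le> 1" and osc: "\<And>s. s \<in> {a..b} \<Longrightarrow> norm (x s - x a) \<le> \<eta>" for a b \<eta>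
  proof -
    have u: "(u has_integral (x b - x a)) {a..b}"
      unfolding x_def by (rule horizontal_curve_has_integral(1)[OF hc ab])
    have u1: "((\<lambda>s. u s $ 1) has_integral (x b $ 1 - x a $ 1)) {a..b}"
      using has_integral_linear[OF u bounded_linear_vec_nth[of 1]] by (simp add: o_def)
    have u3: "((\<lambda>s. u s $ 3) has_integral (x b $ 3 - x a $ 3)) {a..b}"
      using has_integral_linear[OF u bounded_linear_vec_nth[of 3]] by (simp add: o_def)
    have "((\<lambda>s. (x s $ 1 * u s $ 3 - x s $ 3 * u s $ 1) / 2 - (x a $ 1 / 2 * u s $ 3 - x a $ 3 / 2 * u s $ 1))
        has_integral (y b - y a - (x a $ 1 / 2 * (x b $ 3 - x a $ 3) - x a $ 3 / 2 * (x b $ 1 - x a $ 1)))) {a..b}"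
      unfolding y_def x_def
      by (intro has_integral_diff has_integral_mult_right u1[unfolded x_def] u3[unfolded x_def]
          horizontal_curve_has_integral(2)[OF hc ab])
    then have A: "((\<lambda>s. ((x s - x a) $ 1 * u s $ 3 - (x s - x a) $ 3 * u s $ 1) / 2)
        has_integral (y b - y a - (x a $ 1 * x b $ 3 - x a $ 3 * x b $ 1) / 2)) {a..b}"
      by (rule has_integral_eq_rhs[OF has_integral_eq, rotated]) (simp_all add: field_simps)
    have "norm (integral {a..b} (\<lambda>s. ((x s - x a) $ 1 * u s $ 3 - (x s - x a) $ 3 * u s $ 1) / 2))
       \<le> integral {a..b} (\<lambda>s. \<eta> * norm (u s))"
    proof (rule integral_norm_bound_integral)
      show "(\<lambda>s. \<eta> * norm (u s)) integrable_on {a..b}"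
        using integrable_on_cmult_left[OF nint[OF ab(1,3)], of \<eta>] by simp
      fix s assume "s \<in> {a..b}"
      then have le: "norm (x s - x a) \<le> \<eta>" by (rule osc)
      have c: "\<bar>v $ i\<bar> \<le> norm v" for v :: "real ^ 3" and i by (rule component_le_norm_cart)
      have "\<bar>(x s - x a) $ 1 * u s $ 3\<bar> \<le> \<eta> * norm (u s)" "\<bar>(x s - x a) $ 3 * u s $ 1\<bar> \<le> \<eta> * norm (u s)"
        unfolding abs_mult using order_trans[OF norm_ge_zero le]
        by (intro mult_mono order_trans[OF c le] c; simp)+
      have half: "\<bar>(a - b) / 2\<bar> \<le> m" if "\<bar>a\<bar> \<le> m" "\<bar>b\<bar> \<le> m" for a b m :: real
        using that abs_triangle_ineq4[of a b] by (simp add: abs_divide)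
      show "norm (((x s - x a) $ 1 * u s $ 3 - (x s - x a) $ 3 * u s $ 1) / 2) \<le> \<eta> * norm (u s)"
        unfolding real_norm_def by (rule half) fact+
    qed (use A in \<open>auto simp: has_integral_integrable\<close>)
    then show ?thesis unfolding integral_unique[OF A] len_def by simp
  qed
  have key: "r * (cot r * ((x 1 $ 1)\<^sup>2 + (x 1 $ 3)\<^sup>2) + 4 * y 1) \<le> (L + \<epsilon>)\<^sup>2" if "\<epsilon> > 0" for \<epsilon>
  proof -
    have "L \<ge> 0" using len_ge0 L by simp
    \<comment> \<open>The half angle \<open>k * (\<epsilon> + len 0 s)\<close> rises to exactly
      \<open>r\<close> at the end and so stays below \<open>pi\<close>.\<close>
    define k where "k = r / (L + \<epsilon>)"
    have k: "k > 0" "k * (L + \<epsilon>) = r" using r \<open>\<epsilon> > 0\<close> \<open>L \<ge> 0\<close> by (simp_all add: k_def)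
    define \<Phi> where "\<Phi> s = (\<epsilon> + len 0 s) - k * cot (k * (\<epsilon> + len 0 s)) * ((x s $ 1)\<^sup>2 + (x s $ 3)\<^sup>2) - 4 * k * y s" for s
    have step: "\<Phi> b - \<Phi> a \<ge> - (4 * k * \<eta> * len a b)"
      if ab: "0 \<le> a" "a \<le> b" "b \<le> 1" and osc: "\<And>s. s \<in> {a..b} \<Longrightarrow> norm (x s - x a) \<le> \<eta>" for a b \<eta>
    proof -
      have lab: "\<epsilon> + len 0 b = (\<epsilon> + len 0 a) + len a b" using len_add[OF ab] by simp
      have "k * (\<epsilon> + len 0 b) \<le> k * (L + \<epsilon>)"
        using len_add[of b 1] ab len_ge0[of b 1] k L by (intro mult_left_mono) auto
      then have kl: "k * (\<epsilon> + len 0 a + len a b) < pi" using k r lab by simp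
      have "(x b $ 1 - x a $ 1)\<^sup>2 + (x b $ 3 - x a $ 3)\<^sup>2 \<le> (norm (x b - x a))\<^sup>2"
        unfolding norm_vec_def L2_set_def by (simp add: sum_3 sum_nonneg power2_eq_square)
      also have "\<dots> \<le> (len a b)\<^sup>2" using disp[OF ab] by (intro power_mono) auto
      finally have d: "(x b $ 1 - x a $ 1)\<^sup>2 + (x b $ 3 - x a $ 3)\<^sup>2 \<le> (len a b)\<^sup>2" .
      have "4 * k * (y b - y a - (x a $ 1 * x b $ 3 - x a $ 3 * x b $ 1) / 2) \<le> 4 * k * (\<eta> * len a b)"
        using abs_le_D1[OF area[OF ab osc]] k by (intro mult_left_mono) auto
      also have "4 * k * (y b - y a - (x a $ 1 * x b $ 3 - x a $ 3 * x b $ 1) / 2) =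
          4 * k * y b - 4 * k * y a - 2 * k * (x a $ 1 * x b $ 3 - x a $ 3 * x b $ 1)"
        by (simp add: field_simps)
      finally have D: "4 * k * y b - 4 * k * y a - 2 * k * (x a $ 1 * x b $ 3 - x a $ 3 * x b $ 1) \<le> 4 * k * \<eta> * len a b"
        by (simp only: mult.assoc)
      have "0 < \<epsilon> + len 0 a" using \<open>\<epsilon> > 0\<close> len_ge0[of 0 a] by simp
      from dido_calibration_segment[OF k(1) this kl len_ge0 d] D
      show ?thesis unfolding \<Phi>_def lab by linarith
    qed
    have "\<Phi> 1 - \<Phi> 0 \<ge> - e" if "e > 0" for e
    proof -
      \<comment> \<open>The errors of all pieces add up to \<open>4 * k * \<eta> * L\<close>, at
        most \<open>e\<close>; \<open>L + 1\<close> keeps the denominator positive.\<close>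
      define \<eta> where "\<eta> = e / (4 * k * (L + 1))"
      have "\<eta> > 0" using that k \<open>L \<ge> 0\<close> by (simp add: \<eta>_def)
      obtain \<delta> where "\<delta> > 0" and \<delta>: "\<And>s t. s \<in> {0..1} \<Longrightarrow> t \<in> {0..1} \<Longrightarrow> dist t s < \<delta> \<Longrightarrow> dist (\<gamma> t) (\<gamma> s) < \<eta>"
        using abs_cont_on_imp_uniformly_continuous_on[OF \<open>abs_cont_on 0 1 \<gamma>\<close>] \<open>\<eta> > 0\<close>
        unfolding uniformly_continuous_on_def by metis
      obtain n :: nat where n: "n > 0" "1 / real n < \<delta>"
        using real_arch_inverse[of \<delta>] \<open>\<delta> > 0\<close> by (auto simp: inverse_eq_divide)
      have "\<Phi> (real i / n) - \<Phi> 0 \<ge> - (4 * k * \<eta> * len 0 (real i / n))" if "i \<le> n" for i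
        using that
      proof (induction i)
        case 0
        show ?case using k \<open>\<eta> > 0\<close> by (simp add: len_def)
      next
        case (Suc i)
        have ab: "0 \<le> real i / n" "real i / n \<le> real (Suc i) / n" "real (Suc i) / n \<le> 1"
          using Suc.prems n by (auto simp: field_simps)
        have "norm (x s - x (real i / n)) \<le> \<eta>" if s: "s \<in> {real i / n..real (Suc i) / n}" for s
        proof -
          have "s - real i / n \<le> 1 / n" using s by (simp add: add_divide_distrib)
          then have "dist s (real i / n) < \<delta>" using s n by (simp add: dist_real_def)
          then have "dist (\<gamma> s) (\<gamma> (real i / n)) < \<eta>" using \<delta>[of "real i / n" s] s ab
            by (meson atLeastAtMost_iff order_trans)
          then show ?thesis unfolding x_def using dist_fst_le[of "\<gamma> s" "\<gamma> (real i / n)"]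
            by (simp add: dist_norm)
        qed
        from step[OF ab this] len_add[OF ab] Suc show ?case
          by (simp add: algebra_simps) (smt (verit) distrib_left)
      qed
      from this[of n] have "\<Phi> 1 - \<Phi> 0 \<ge> - (4 * k * \<eta> * L)" using n L by simp
      moreover have "4 * k * \<eta> * L \<le> e"
      proof -
        have "4 * k * \<eta> * L = e * (L / (L + 1))" using k by (simp add: \<eta>_def)
        also have "\<dots> \<le> e" using \<open>L \<ge> 0\<close> that by (intro mult_left_le) auto
        finally show ?thesis .
      qed
      ultimately show ?thesis by linarith
    qed
    then have "0 \<le> (\<Phi> 1 - \<Phi> 0) + e" if "e > 0" for e using that by fastforce
    then have "0 \<le> \<Phi> 1 - \<Phi> 0" by (rule field_le_epsilon)
    then have "\<Phi> 1 \<ge> \<Phi> 0" by simp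
    moreover have "\<Phi> 0 = \<epsilon>" by (simp add: \<Phi>_def len_def x_def y_def \<gamma>0)
    moreover have "\<Phi> 1 = (L + \<epsilon>) - k * (cot r * ((x 1 $ 1)\<^sup>2 + (x 1 $ 3)\<^sup>2) + 4 * y 1)"
      using k L by (simp add: \<Phi>_def algebra_simps)
    ultimately have "k * (cot r * ((x 1 $ 1)\<^sup>2 + (x 1 $ 3)\<^sup>2) + 4 * y 1) \<le> L + \<epsilon>" using \<open>\<epsilon> > 0\<close> by linarith
    then have "(L + \<epsilon>) * (k * (cot r * ((x 1 $ 1)\<^sup>2 + (x 1 $ 3)\<^sup>2) + 4 * y 1)) \<le> (L + \<epsilon>) * (L + \<epsilon>)"
      using \<open>L \<ge> 0\<close> \<open>\<epsilon> > 0\<close> by (intro mult_left_mono) auto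
    then show ?thesis using k(2) by (simp add: power2_eq_square mult.assoc[symmetric] mult.commute)
  qed
  \<comment> \<open>The head start of the clock is removed in the limit.\<close>
  have "((\<lambda>\<epsilon>. (L + \<epsilon>)\<^sup>2) \<longlongrightarrow> (L + 0)\<^sup>2) (at_right 0)" by (intro tendsto_intros)
  then have "r * (cot r * ((x 1 $ 1)\<^sup>2 + (x 1 $ 3)\<^sup>2) + 4 * y 1) \<le> (L + 0)\<^sup>2"
    by (rule tendsto_lowerbound) (auto simp: eventually_at_right_less intro!: eventually_mono[OF eventually_at_right_less] key)
  then show ?thesis by (simp add: L_def x_def y_def)
qed

text \<open>
  The minimiser is the circular arc with chord \<open>X\<close> and half opening angle \<open>r\<close>, traversed at
  constant speed.
\<close>

lemma horizontal_circular_arc: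
  fixes X r :: real
  assumes X: "X > 0" and r: "0 < r" "r < pi"
  obtains \<gamma> u where "horizontal_curve \<gamma> u" "\<gamma> 0 = 0"
    "\<gamma> 1 = (X *\<^sub>R vector [1, 0, 0], vector [0, X\<^sup>2 * mu r / 4, 0])"
    "horizontal_length u = X * r / sin r"
proof -
  have sr: "sin r > 0" using r by (rule sin_gt_zero)
  \<comment> \<open>\<open>c\<close> is the radius, from the chord \<open>X = 2 * c * sin r\<close>.
    The tangent direction \<open>\<phi>\<close> turns from \<open>- r\<close> to \<open>r\<close>,
    which puts the chord on the first axis; the central entry of \<open>\<gamma>\<close> is the area
    of the circular segment of angle \<open>2 * r * s\<close>.\<close>
  define c where "c = X / (2 * sin r)"
  define \<phi> where "\<phi> s = r * (2 * s - 1)" for s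
  define \<gamma> :: "real \<Rightarrow> N32" where "\<gamma> s = (vector [c * (sin (\<phi> s) + sin r), 0, c * (cos r - cos (\<phi> s))],
      vector [0, c\<^sup>2 * (r * s - sin (2 * r * s) / 2), 0])" for s
  define u :: "real \<Rightarrow> real ^ 3" where "u s = vector [2 * r * c * cos (\<phi> s), 0, 2 * r * c * sin (\<phi> s)]" for s
  define v :: "real \<Rightarrow> N32" where "v s = (u s, vector [0, c\<^sup>2 * (r - r * cos (2 * r * s)), 0])" for s
  have c: "c > 0" using X sr by (simp add: c_def)
    have 1: "((\<lambda>s. vector [f1 s, f2 s, f3 s] :: real ^ 3) has_vector_derivative vector [f1', f2', f3']) (at s within S)"
      if "(f1 has_real_derivative f1') (at s within S)" "(f2 has_real_derivative f2') (at s within S)"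
        "(f3 has_real_derivative f3') (at s within S)" for f1 f2 f3 f1' f2' f3' s S
    proof -
      have "((\<lambda>s. f1 s *\<^sub>R axis 1 1 + f2 s *\<^sub>R axis 2 1 + f3 s *\<^sub>R axis 3 1 :: real ^ 3) has_vector_derivative
          f1' *\<^sub>R axis 1 1 + f2' *\<^sub>R axis 2 1 + f3' *\<^sub>R axis 3 1) (at s within S)"
        using that by (intro has_vector_derivative_add has_vector_derivative_scaleR[where g' = 0, simplified])
          (auto intro: has_vector_derivative_const)
      moreover have "vector [a, b, d] = a *\<^sub>R axis 1 1 + b *\<^sub>R axis 2 1 + d *\<^sub>R (axis 3 1 :: real ^ 3)" for a b d :: real
        by (simp add: vec_eq_iff forall_3 axis_def)
      ultimately show ?thesis by simp
    qed
  have der: "(\<gamma> has_vector_derivative v s) (at s within S)" for s S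
  proof -
    have "((\<lambda>s. vector [c * (sin (\<phi> s) + sin r), 0, c * (cos r - cos (\<phi> s))] :: real ^ 3) has_vector_derivative u s) (at s within S)"
      unfolding u_def \<phi>_def by (rule 1) (auto intro!: derivative_eq_intros)
    moreover have "((\<lambda>s. vector [0, c\<^sup>2 * (r * s - sin (2 * r * s) / 2), 0] :: real ^ 3) has_vector_derivative
         vector [0, c\<^sup>2 * (r - r * cos (2 * r * s)), 0]) (at s within S)"
      by (rule 1) (auto intro!: derivative_eq_intros)
    ultimately show ?thesis unfolding \<gamma>_def[abs_def] v_def
      by (rule has_vector_derivative_Pair)
  qed
  \<comment> \<open>Horizontality of the central entry, as a polynomial identity in the sine and
    cosine of \<open>\<phi> s\<close>.\<close>
  have alg: "c\<^sup>2 * (r - r * (C * cos r - S * sin r)) * 2 =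
      c * (S + sin r) * (2 * r * c * S) - c * (cos r - C) * (2 * r * c * C)" if "S\<^sup>2 + C\<^sup>2 = 1" for S C
    using that by algebra
  have v: "v s = u s $ 1 *\<^sub>R X1 (\<gamma> s) + u s $ 2 *\<^sub>R X2 (\<gamma> s) + u s $ 3 *\<^sub>R X3 (\<gamma> s)" for s
  proof -
    have "cos (2 * r * s) = cos (\<phi> s + r)" by (simp add: \<phi>_def algebra_simps)
    then have cs: "cos (2 * r * s) = cos (\<phi> s) * cos r - sin (\<phi> s) * sin r" by (simp only: cos_add)
    have "c\<^sup>2 * (r - r * cos (2 * r * s)) =
        (fst (\<gamma> s) $ 1 * u s $ 3 - fst (\<gamma> s) $ 3 * u s $ 1) / 2"
      using alg[OF sin_cos_squared_add[of "\<phi> s"]] unfolding cs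
      by (simp add: \<gamma>_def u_def)
    then show ?thesis unfolding prod_eq_iff horizontal_velocity(1)
      by (simp add: v_def X1_def X2_def X3_def Let_def vec_eq_iff forall_3 u_def \<gamma>_def field_simps)
  qed
  have normu: "norm (u s) = 2 * r * c" for s
  proof -
    have "(2 * r * c * C) * (2 * r * c * C) + 0 * 0 + (2 * r * c * S) * (2 * r * c * S) = (2 * r * c)\<^sup>2 * (C\<^sup>2 + S\<^sup>2)" for C S
      by algebra
    then have "(norm (u s))\<^sup>2 = (2 * r * c)\<^sup>2 * ((cos (\<phi> s))\<^sup>2 + (sin (\<phi> s))\<^sup>2)"
      unfolding power2_norm_eq_inner inner_vec_def sum_3 u_def vector_3 inner_real_def by blast
    then have "(norm (u s))\<^sup>2 = (2 * r * c)\<^sup>2" by simp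
    then show ?thesis using r c by (subst (asm) power2_eq_iff_nonneg) auto
  qed
  have cont: "continuous_on UNIV u"
  proof (rule continuous_on_vector_derivative)
    show "(u has_vector_derivative vector [2 * r * c * (- sin (\<phi> s) * (2 * r)), 0, 2 * r * c * (cos (\<phi> s) * (2 * r))])
        (at s within UNIV)" for s
      unfolding u_def[abs_def] \<phi>_def by (rule 1) (auto intro!: derivative_eq_intros)
  qed
  \<comment> \<open>Any bound on the velocity serves: it makes \<open>\<gamma>\<close> Lipschitz and
    thus absolutely continuous.\<close>
  have "norm (v s) \<le> 2 * r * c + c\<^sup>2 * (2 * r)" for s
  proof -
    have "norm (v s) \<le> norm (u s) + norm (vector [0, c\<^sup>2 * (r - r * cos (2 * r * s)), 0] :: real ^ 3)"
      unfolding v_def by (rule norm_Pair_le)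
    also have "norm (vector [0, c\<^sup>2 * (r - r * cos (2 * r * s)), 0] :: real ^ 3) = \<bar>c\<^sup>2 * (r - r * cos (2 * r * s))\<bar>"
      by (simp add: norm_vec_def L2_set_def sum_3)
    also have "\<dots> = c\<^sup>2 * (r * (1 - cos (2 * r * s)))"
    proof -
      have eq: "r - r * cos (2 * r * s) = r * (1 - cos (2 * r * s))" by (simp add: algebra_simps)
      have "c\<^sup>2 * (r * (1 - cos (2 * r * s))) \<ge> 0" using r by (intro mult_nonneg_nonneg) auto
      then show ?thesis unfolding eq by (rule abs_of_nonneg)
    qed
    also have "\<dots> \<le> c\<^sup>2 * (r * 2)"
      using r cos_ge_minus_one[of "2 * r * s"] by (intro mult_left_mono) auto
    finally show ?thesis using normu by (simp add: mult.commute)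
  qed
  then have bound: "norm (v s - v 0) \<le> 2 * (2 * r * c + c\<^sup>2 * (2 * r))" for s
    using norm_triangle_ineq4[of "v s" "v 0"] by (smt (verit))
  have "norm (\<gamma> t - \<gamma> s) \<le> (2 * (2 * r * c + c\<^sup>2 * (2 * r)) + norm (v 0)) * (t - s)" if "s \<le> t" for s t
  proof -
    have "norm (\<gamma> t - \<gamma> s - (t - s) *\<^sub>R v 0) \<le> norm (t - s) * (2 * (2 * r * c + c\<^sup>2 * (2 * r)))"
      using der bound by (intro vector_differentiable_bound_linearization[where S = UNIV]) auto
    then have "norm (\<gamma> t - \<gamma> s - (t - s) *\<^sub>R v 0) \<le> 2 * (2 * r * c + c\<^sup>2 * (2 * r)) * (t - s)"
      using that by (simp only: real_norm_def abs_of_nonneg diff_ge_0_iff_ge mult.commute)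
    moreover have "norm ((t - s) *\<^sub>R v 0) = norm (v 0) * (t - s)" using that by simp
    ultimately show ?thesis
      using norm_triangle_ineq[of "\<gamma> t - \<gamma> s - (t - s) *\<^sub>R v 0" "(t - s) *\<^sub>R v 0"]
      unfolding distrib_right diff_add_cancel by linarith
  qed
  then have lip: "abs_cont_on 0 1 \<gamma>"
    by (intro lipschitz_imp_abs_cont_on)
  show ?thesis
  proof (rule that[of \<gamma> u])
    show "horizontal_curve \<gamma> u"
      unfolding horizontal_curve_def
      using lip der v
        absolutely_integrable_continuous_real[OF continuous_on_subset[OF cont subset_UNIV]] by auto
    show "\<gamma> 0 = 0" by (simp add: \<gamma>_def \<phi>_def zero_prod_def vec_eq_iff forall_3)
    show "\<gamma> 1 = (X *\<^sub>R vector [1, 0, 0], vector [0, X\<^sup>2 * mu r / 4, 0])"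
      using sr by (simp add: \<gamma>_def \<phi>_def vec_eq_iff forall_3 c_def mu_def field_simps power2_eq_square)
    show "horizontal_length u = X * r / sin r"
      by (simp add: horizontal_length_def normu c_def)
  qed
qed

text \<open>The arc of half angle \<open>r\<close> attains the bound of the calibration with the
  same \<open>r\<close>, so the infimum is a minimum.\<close>

lemma cc_dist_eq:
  fixes X r :: real
  assumes X: "X > 0" and r: "0 < r" "r < pi"
  shows "cc_dist (X *\<^sub>R vector [1, 0, 0], vector [0, X\<^sup>2 * mu r / 4, 0]) = X * r / sin r"
  unfolding cc_dist_def
proof (rule cInf_eq_minimum)
  have sr: "sin r > 0" using r by (rule sin_gt_zero)
  obtain \<gamma> u where "horizontal_curve \<gamma> u" "\<gamma> 0 = 0"
    "\<gamma> 1 = (X *\<^sub>R vector [1, 0, 0], vector [0, X\<^sup>2 * mu r / 4, 0])"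
    "horizontal_length u = X * r / sin r"
    using horizontal_circular_arc[OF assms] .
  then show "X * r / sin r \<in> {horizontal_length u |u \<gamma>. horizontal_curve \<gamma> u \<and> \<gamma> 0 = 0 \<and>
      \<gamma> 1 = (X *\<^sub>R vector [1, 0, 0], vector [0, X\<^sup>2 * mu r / 4, 0])}"
    by force
  fix L assume "L \<in> {horizontal_length u |u \<gamma>. horizontal_curve \<gamma> u \<and> \<gamma> 0 = 0 \<and>
      \<gamma> 1 = (X *\<^sub>R vector [1, 0, 0], vector [0, X\<^sup>2 * mu r / 4, 0])}"
  then obtain \<gamma> u where hc: "horizontal_curve \<gamma> u" "\<gamma> 0 = 0" and L: "L = horizontal_length u"
    and \<gamma>1: "\<gamma> 1 = (X *\<^sub>R vector [1, 0, 0], vector [0, X\<^sup>2 * mu r / 4, 0])"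
    by auto
  have "(X * r / sin r)\<^sup>2 = X\<^sup>2 * r * (mu r + cot r)"
    using sr by (subst mu_plus_cot) (auto simp: power2_eq_square)
  also have "\<dots> \<le> L\<^sup>2" using horizontal_length_ge[OF hc r] L by (simp add: \<gamma>1 algebra_simps)
  finally have "(X * r / sin r)\<^sup>2 \<le> L\<^sup>2" .
  moreover have "L \<ge> 0" unfolding L horizontal_length_def
    by (cases "(\<lambda>s. norm (u s)) integrable_on {0..1}") (auto intro: integral_nonneg simp: not_integrable_integral)
  ultimately show "X * r / sin r \<le> L" by (rule power2_le_imp_le)
qed

section \<open>The functions $\mu$ and $\Upsilon$\<close>

text \<open>The difference of the two sides has derivative \<open>x * sin x\<close>.\<close>

lemma sin_minus_r_cos_pos:
  fixes r :: real
  assumes "0 < r" "r < pi"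
  shows "r * cos r < sin r"
proof -
  have "(\<lambda>r. sin r - r * cos r) 0 < (\<lambda>r. sin r - r * cos r) r"
  proof (rule DERIV_pos_imp_increasing_open[OF assms(1)])
    fix x assume x: "0 < x" "x < r"
    have "((\<lambda>r. sin r - r * cos r) has_real_derivative x * sin x) (at x)"
      by (auto intro!: derivative_eq_intros)
    moreover have "x * sin x > 0" using x assms by (simp add: sin_gt_zero)
    ultimately show "\<exists>y. DERIV (\<lambda>r. sin r - r * cos r) x :> y \<and> 0 < y" by blast
  qed (intro continuous_intros)
  then show ?thesis by simp
qed

lemma one_minus_r_cot_pos:
  fixes r :: real
  assumes "0 < r" "r < pi"
  shows "1 - r * cot r > 0"
  using sin_minus_r_cos_pos[OF assms] sin_gt_zero[OF assms] by (simp add: cot_def field_simps)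

lemma Upsilon_pos: "\<lbrakk>0 < r; r < pi\<rbrakk> \<Longrightarrow> Upsilon r > 0"
  using one_minus_r_cot_pos[of r] by (simp add: Upsilon_def)

lemma mu_eq: "sin r \<noteq> 0 \<Longrightarrow> mu r = r / (sin r)\<^sup>2 - cot r"
  by (simp add: mu_def cot_def sin_double power2_eq_square diff_divide_distrib)

lemma mu_has_derivative:
  assumes "0 < r" "r < pi"
  shows "(mu has_real_derivative 2 * (1 - r * cot r) / (sin r)\<^sup>2) (at r)"
proof (rule DERIV_cong_ev[THEN iffD2, OF refl _ refl])
  have s: "sin r > 0" using assms by (rule sin_gt_zero)
  show "((\<lambda>r. r / (sin r)\<^sup>2 - cot r) has_real_derivative 2 * (1 - r * cot r) / (sin r)\<^sup>2) (at r)"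
  proof -
    have "((\<lambda>r. r / (sin r)\<^sup>2) has_real_derivative
        (1 * (sin r)\<^sup>2 - r * (2 * sin r * cos r)) / ((sin r)\<^sup>2 * (sin r)\<^sup>2)) (at r)"
      using s by (intro DERIV_divide) (auto intro!: derivative_eq_intros)
    from DERIV_diff[OF this DERIV_cot] show ?thesis
      using s by (auto elim!: DERIV_cong simp: cot_def field_simps power2_eq_square)
  qed
  have "eventually (\<lambda>x. x \<in> {0<..<pi}) (nhds r)"
    using assms by (intro eventually_nhds_in_open) auto
  then show "eventually (\<lambda>x. mu x = x / (sin x)\<^sup>2 - cot x) (nhds r)"
    by eventually_elim (simp add: mu_eq sin_gt_zero less_imp_neq[THEN not_sym])
qed

lemma mu_strict_mono:
  assumes "0 < r" "r < s" "s < pi"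
  shows "mu r < mu s"
proof (rule DERIV_pos_imp_increasing[OF assms(2)])
  fix x assume x: "r \<le> x" "x \<le> s"
  have "2 * (1 - x * cot x) / (sin x)\<^sup>2 > 0"
    using one_minus_r_cot_pos[of x] sin_gt_zero[of x] x assms by simp
  then show "\<exists>y. DERIV mu x :> y \<and> 0 < y" using mu_has_derivative[of x] x assms by force
qed

lemma mu_minus: "mu (- r) = - mu r"
  unfolding mu_def by (simp add: minus_divide_left)

text \<open>Uniqueness of \<open>r\<close> is claimed on all of \<open>(- pi, pi)\<close>. Oddness
  of \<open>mu\<close> excludes the negative half, and monotonicity on \<open>(0, pi)\<close> does
  the rest.\<close>

lemma mu_pos_iff:
  assumes "- pi < r" "r < pi"
  shows "0 < mu r \<longleftrightarrow> 0 < r"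
proof -
  have pos: "mu s > 0" if "0 < s" "s < pi" for s
  proof -
    have "sin s * cos s < s"
    proof -
      have "(\<lambda>x. x - sin x * cos x) 0 < (\<lambda>x. x - sin x * cos x) s"
      proof (rule DERIV_pos_imp_increasing_open[OF that(1)])
        fix x assume x: "0 < x" "x < s"
        have "((\<lambda>x. x - sin x * cos x) has_real_derivative 1 - (cos x * cos x - sin x * sin x)) (at x)"
          by (auto intro!: derivative_eq_intros)
        moreover have "1 - (cos x * cos x - sin x * sin x) = 2 * (sin x * sin x)"
          using sin_cos_squared_add[of x] unfolding power2_eq_square by linarith
        moreover have "sin x > 0" using x that by (intro sin_gt_zero) auto
        ultimately show "\<exists>y. DERIV (\<lambda>x. x - sin x * cos x) x :> y \<and> 0 < y" by (metis mult_pos_pos zero_less_numeral)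
      qed (intro continuous_intros)
      then show ?thesis by simp
    qed
    then show ?thesis using sin_gt_zero[OF that] by (simp add: mu_def sin_double)
  qed
  show ?thesis
  proof (cases "r > 0")
    case False
    then have "r = 0 \<or> mu (- r) > 0" using pos[of "- r"] assms by linarith
    moreover have "mu 0 = 0" by (simp add: mu_def)
    ultimately show ?thesis using False unfolding mu_minus by auto
  qed (use pos assms in auto)
qed

lemma mu_ex1:
  assumes "m > 0"
  obtains r where "0 < r" "r < pi" "mu r = m" "\<And>\<rho>. \<lbrakk>- pi < \<rho>; \<rho> < pi; mu \<rho> = m\<rbrakk> \<Longrightarrow> \<rho> = r"
proof -
  have "((\<lambda>x::real. (2 * x - sin (2 * x)) / (2 * (sin x)\<^sup>2)) \<longlongrightarrow> 0) (at_right 0)" by real_asymp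
  then have "eventually (\<lambda>x. mu x < m) (at_right 0)"
    unfolding mu_def using assms by (rule order_tendstoD)
  moreover have "eventually (\<lambda>x. x \<in> {0<..<1}) (at_right (0::real))"
    by (rule eventually_at_right_real) simp
  ultimately have "eventually (\<lambda>x. mu x < m \<and> x \<in> {0<..<1}) (at_right (0::real))"
    by eventually_elim simp
  then obtain a where a: "mu a < m" "0 < a" "a < 1"
    using eventually_happens[where net = "at_right (0::real)"] by fastforce
  \<comment> \<open>The right end of the interval, with \<open>y = pi - \<rho>\<close>. Together
    with the limit at \<open>0\<close> it brackets \<open>m\<close> for the intermediate value
    theorem.\<close>
  have "filterlim (\<lambda>y. (2 * (pi - y) - sin (2 * (pi - y))) / (2 * (sin (pi - y))\<^sup>2)) at_top (at_right 0)" by real_asymp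
  then have "eventually (\<lambda>y. mu (pi - y) > m) (at_right 0)"
    unfolding mu_def by (simp add: filterlim_at_top_dense)
  moreover have "eventually (\<lambda>x. x \<in> {0<..<pi - 1}) (at_right (0::real))"
    using pi_gt3 by (intro eventually_at_right_real) simp
  ultimately have "eventually (\<lambda>y. mu (pi - y) > m \<and> y \<in> {0<..<pi - 1}) (at_right (0::real))"
    by eventually_elim simp
  then obtain y where y: "mu (pi - y) > m" "0 < y" "y < pi - 1"
    using eventually_happens[where net = "at_right (0::real)"] by fastforce
  have "\<exists>r. a \<le> r \<and> r \<le> pi - y \<and> mu r = m"
  proof (rule IVT)
    show "\<forall>x. a \<le> x \<and> x \<le> pi - y \<longrightarrow> isCont mu x"
      using a y by (auto intro!: DERIV_isCont mu_has_derivative)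
  qed (use a y in auto)
  then obtain r where r: "a \<le> r" "r \<le> pi - y" "mu r = m" by blast
  show ?thesis
  proof (rule that[of r])
    fix \<rho> assume \<rho>: "- pi < \<rho>" "\<rho> < pi" "mu \<rho> = m"
    then have "\<rho> > 0" using mu_pos_iff assms by blast
    then show "\<rho> = r" using mu_strict_mono[of \<rho> r] mu_strict_mono[of r \<rho>] r a y \<rho>
      by (cases \<rho> r rule: linorder_cases) auto
  qed (use r a y in auto)
qed

text \<open>\<open>mu\<close> appears because it is the derivative of \<open>1 - r * cot r\<close>,
  the denominator of \<open>Upsilon\<close>.\<close>

lemma Upsilon_has_derivative:
  assumes "0 < r" "r < pi"
  shows "(Upsilon has_real_derivative (2 * Upsilon r / r - (Upsilon r)\<^sup>2 * mu r / r\<^sup>2)) (at r)"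
proof -
  have s: "sin r > 0" using assms by (rule sin_gt_zero)
  have d: "((\<lambda>r. 1 - r * cot r) has_real_derivative mu r) (at r)"
  proof -
    have "((\<lambda>r. 1 - r * cot r) has_real_derivative 0 - (1 * cot r + (- inverse ((sin r)\<^sup>2)) * r)) (at r)"
      using s by (intro DERIV_diff DERIV_mult DERIV_cot DERIV_const DERIV_ident) auto
    then show ?thesis using s by (simp add: mu_eq divide_inverse mult.commute)
  qed
  have "((\<lambda>r. r\<^sup>2 / (1 - r * cot r)) has_real_derivative
      (2 * r * (1 - r * cot r) - r\<^sup>2 * mu r) / ((1 - r * cot r) * (1 - r * cot r))) (at r)"
    using DERIV_divide[OF _ d, of "\<lambda>r. r\<^sup>2" "2 * r"] one_minus_r_cot_pos[OF assms]
    DERIV_power[OF DERIV_ident, where n = 2, of r UNIV] by simp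
  moreover have "(2 * r * (1 - r * cot r) - r\<^sup>2 * mu r) / ((1 - r * cot r) * (1 - r * cot r))
     = 2 * Upsilon r / r - (Upsilon r)\<^sup>2 * mu r / r\<^sup>2"
  proof -
    have "(2 * r * v - r\<^sup>2 * m) / (v * v) = 2 * (r\<^sup>2 / v) / r - (r\<^sup>2 / v)\<^sup>2 * m / r\<^sup>2" if "v > 0" for v m
      using that assms by (simp add: field_simps power2_eq_square)
    then show ?thesis unfolding Upsilon_def using one_minus_r_cot_pos[OF assms] by blast
  qed
  ultimately show ?thesis unfolding Upsilon_def[abs_def] by simp
qed

text \<open>The left side is the curvature of the exponent at the saddle in the direction of
  \<open>x\<close>; through this identity the derivative of \<open>Upsilon\<close> enters the
  asymptotics.\<close>

lemma deriv_Upsilon: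
  assumes "0 < r" "r < pi"
  shows "mu r / (2 * r) - 1 / Upsilon r = r * (- deriv Upsilon r) / (2 * (Upsilon r)\<^sup>2)"
  unfolding DERIV_imp_deriv[OF Upsilon_has_derivative[OF assms]]
  using Upsilon_pos[OF assms] assms by (simp add: field_simps power2_eq_square)

lemma deriv_Upsilon_neg:
  assumes "0 < r" "r < pi"
  shows "- deriv Upsilon r > 0"
proof -
  have s: "sin r > 0" using assms by (rule sin_gt_zero)
  \<comment> \<open>The sign in question is that of
    \<open>r\<^sup>2 + r * sin r * cos r - 2 * (sin r)\<^sup>2\<close>, a quarter of
    \<open>q (2 * r)\<close>. Differentiating \<open>q\<close> gives \<open>p\<close>, and the
    derivative of \<open>p\<close> factors at half the angle into positive terms.\<close>
  define p where "p x = 2 * x - 3 * sin x + x * cos x" for x :: real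
  define q where "q x = x\<^sup>2 + x * sin x - 4 + 4 * cos x" for x :: real
  have p: "p x > 0" if "0 < x" "x < 2 * pi" for x
  proof -
    have "p 0 < p x"
    proof (rule DERIV_pos_imp_increasing_open[OF that(1)])
      fix y assume y: "0 < y" "y < x"
      define z where "z = y / 2"
      have z: "y = 2 * z" "0 < z" "z < pi" using y that by (auto simp: z_def)
      have "(p has_real_derivative 2 - 2 * cos y - y * sin y) (at y)"
        unfolding p_def by (auto intro!: derivative_eq_intros)
      moreover have "2 - 2 * cos y - y * sin y = 4 * sin z * (sin z - z * cos z)"
        unfolding z(1) cos_double_sin sin_double by (simp add: algebra_simps power2_eq_square)
      moreover have "4 * sin z * (sin z - z * cos z) > 0"
        using sin_minus_r_cos_pos[OF z(2,3)] sin_gt_zero[OF z(2,3)] by simp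
      ultimately show "\<exists>D. DERIV p y :> D \<and> 0 < D" by metis
    qed (auto simp: p_def intro!: continuous_intros)
    then show ?thesis by (simp add: p_def)
  qed
  have "0 < 2 * r" using assms by simp
  then have "q 0 < q (2 * r)"
  proof (rule DERIV_pos_imp_increasing_open)
    fix y assume y: "0 < y" "y < 2 * r"
    have "(q has_real_derivative p y) (at y)"
      unfolding p_def q_def by (auto intro!: derivative_eq_intros)
    moreover have "p y > 0" using y assms by (intro p) auto
    ultimately show "\<exists>D. DERIV q y :> D \<and> 0 < D" by blast
  qed (auto simp: q_def intro!: continuous_intros)
  then have q: "0 < r\<^sup>2 + r * sin r * cos r - 2 * (sin r)\<^sup>2"
    by (simp add: q_def cos_double_sin sin_double power2_eq_square)
  have "mu r / (2 * r) - 1 / Upsilon r = (r\<^sup>2 + r * sin r * cos r - 2 * (sin r)\<^sup>2) / (2 * r\<^sup>2 * (sin r)\<^sup>2)"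
    using s assms unfolding mu_eq[OF less_imp_neq[OF s, THEN not_sym]] Upsilon_def cot_def
    by (simp add: field_simps power2_eq_square)
  also have "\<dots> > 0" using q s assms by simp
  finally have "r * (- deriv Upsilon r) / (2 * (Upsilon r)\<^sup>2) > 0" by (simp only: deriv_Upsilon[OF assms])
  then show ?thesis using Upsilon_pos[OF assms] assms by (simp add: zero_less_divide_iff zero_less_mult_iff mult_less_0_iff divide_less_0_iff)
qed

section \<open>The entire function $\sinh\sqrt w/\sqrt w$ and its logarithmic derivative\<close>

text \<open>
  The functions of $w = |\lambda|^2$ in the heat kernel, written so that they are visibly holomorphic
  off the points \<open>- pole k\<close>: \<open>shc (z\<^sup>2) = sinh z / z\<close> and \<open>cpsi (z\<^sup>2) = (z * coth z - 1) / z\<^sup>2\<close>.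
\<close>

definition pole :: "nat \<Rightarrow> real" where
  "pole k = (real (Suc k) * pi)\<^sup>2"

definition shc :: "complex \<Rightarrow> complex" where
  "shc w = lim (\<lambda>n. \<Prod>k<n. 1 + w / of_real (pole k))"

definition cpsi :: "complex \<Rightarrow> complex" where
  "cpsi w = 2 * deriv shc w / shc w"

lemma pole_pos: "pole k > 0"
  by (simp add: pole_def)

lemma pole_ge: "pole k \<ge> pi\<^sup>2"
  unfolding pole_def by (intro power_mono) (auto simp: mult_le_cancel_right1)

lemma summable_inverse_pole: "summable (\<lambda>k. 1 / pole k)"
proof -
  have "summable (\<lambda>k. inverse (real (Suc k) ^ 2))"
    by (subst summable_Suc_iff) (rule inverse_power_summable, simp)
  then have "summable (\<lambda>k. inverse (real (Suc k) ^ 2) * (1 / pi\<^sup>2))" by (rule summable_mult2)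
  then show ?thesis by (simp add: pole_def power_mult_distrib divide_inverse)
qed

text \<open>Locally uniform rather than pointwise convergence gives holomorphy of the limit and
  allows logarithmic differentiation factor by factor.\<close>

lemma uniform_limit_shc:
  "uniform_limit (cball 0 R) (\<lambda>n w. \<Prod>k<n. 1 + w / of_real (pole k)) shc sequentially"
proof -
  have "uniformly_convergent_on (cball 0 R) (\<lambda>n w. \<Prod>k<n. 1 + w / complex_of_real (pole k))"
  proof (rule uniformly_convergent_on_prod)
    show "uniformly_convergent_on (cball 0 R) (\<lambda>N w. \<Sum>k<N. norm (w / complex_of_real (pole k)))"
    proof (rule Weierstrass_m_test')
      show "summable (\<lambda>k. R * (1 / pole k))" by (intro summable_mult summable_inverse_pole)
      show "norm (norm (w / complex_of_real (pole n))) \<le> R * (1 / pole n)" if "w \<in> cball 0 R" for n w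
        using that pole_pos[of n] by (auto simp: norm_divide intro: divide_right_mono)
    qed
  qed (use pole_pos in \<open>auto intro!: continuous_intros simp: less_imp_neq[THEN not_sym]\<close>)
  then show ?thesis unfolding uniformly_convergent_uniform_limit_iff shc_def[abs_def] .
qed

lemma shc_LIMSEQ: "(\<lambda>n. \<Prod>k<n. 1 + w / of_real (pole k)) \<longlonglongrightarrow> shc w"
  by (rule tendsto_uniform_limitI[OF uniform_limit_shc[of "norm w"]]) simp

lemma holomorphic_shc [holomorphic_intros]: "shc holomorphic_on A"
proof -
  have "shc holomorphic_on UNIV"
  proof (rule holomorphic_uniform_sequence[where f = "\<lambda>n w. \<Prod>k<n. 1 + w / of_real (pole k)"])
    show "(\<lambda>w. \<Prod>k<n. 1 + w / of_real (pole k)) holomorphic_on UNIV" for n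
      using pole_pos by (auto intro!: holomorphic_intros simp: less_imp_neq[THEN not_sym])
    fix x :: complex
    show "\<exists>d>0. cball x d \<subseteq> UNIV \<and>
      uniform_limit (cball x d) (\<lambda>n w. \<Prod>k<n. 1 + w / of_real (pole k)) shc sequentially"
    proof (intro exI[of _ 1] conjI)
      have "cball x 1 \<subseteq> cball 0 (norm x + 1)"
      proof
        fix y assume "y \<in> cball x 1"
        then show "y \<in> cball 0 (norm x + 1)"
          using norm_triangle_sub[of y x] by (simp add: dist_norm norm_minus_commute)
      qed
      then show "uniform_limit (cball x 1) (\<lambda>n w. \<Prod>k<n. 1 + w / of_real (pole k)) shc sequentially"
        by (rule uniform_limit_on_subset[OF uniform_limit_shc])
    qed auto
  qed auto
  then show ?thesis by (rule holomorphic_on_subset) simp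
qed

text \<open>Euler's product for the sine, taken at \<open>\<i> * z / pi\<close>.\<close>

lemma shc_square: "z * shc (z\<^sup>2) = sinh z"
proof -
  define y where "y = \<i> * z / of_real pi"
  have "(\<lambda>n. of_real pi * y * (\<Prod>k=1..n. 1 - y^2 / of_nat k^2)) \<longlonglongrightarrow> sin (of_real pi * y)"
    by (rule sin_product_formula_complex)
  also have "(\<lambda>n. of_real pi * y * (\<Prod>k=1..n. 1 - y^2 / of_nat k^2)) =
     (\<lambda>n. \<i> * z * (\<Prod>k<n. 1 + z\<^sup>2 / of_real (pole k)))"
  proof
    fix n
    have "(\<Prod>k=1..n. 1 - y^2 / of_nat k^2) = (\<Prod>k<n. 1 + z\<^sup>2 / complex_of_real (pole k))"
      unfolding One_nat_def prod.atLeast1_atMost_eq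
      by (intro prod.cong refl) (auto simp: y_def pole_def power_mult_distrib power_divide)
    then show "of_real pi * y * (\<Prod>k=1..n. 1 - y^2 / of_nat k^2) = \<i> * z * (\<Prod>k<n. 1 + z\<^sup>2 / of_real (pole k))"
      by (simp add: y_def)
  qed
  also have "sin (of_real pi * y) = \<i> * sinh z"
    by (simp add: y_def sinh_conv_sin)
  finally have "(\<lambda>n. \<i> * z * (\<Prod>k<n. 1 + z\<^sup>2 / of_real (pole k))) \<longlonglongrightarrow> \<i> * sinh z" .
  moreover have "(\<lambda>n. \<i> * z * (\<Prod>k<n. 1 + z\<^sup>2 / of_real (pole k))) \<longlonglongrightarrow> \<i> * z * shc (z\<^sup>2)"
    by (intro tendsto_mult_left shc_LIMSEQ)
  ultimately have "\<i> * z * shc (z\<^sup>2) = \<i> * sinh z" by (rule LIMSEQ_unique[rotated])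
  then show ?thesis by simp
qed

lemma shc_0: "shc 0 = 1"
  using shc_LIMSEQ[of 0] by (simp add: LIMSEQ_const_iff)

text \<open>Obtained by differentiating \<open>z * shc (z\<^sup>2) = sinh z\<close>; it identifies
  \<open>cpsi\<close> with the coefficient in the heat kernel.\<close>

lemma cpsi_square:
  assumes "sinh z \<noteq> 0"
  shows "z\<^sup>2 * cpsi (z\<^sup>2) = z * cosh z / sinh z - 1"
proof -
  have D: "(shc has_field_derivative deriv shc (z\<^sup>2)) (at (z\<^sup>2))"
    by (rule holomorphic_derivI[OF holomorphic_shc[of UNIV]]) auto
  have "((\<lambda>z. z * shc (z\<^sup>2)) has_field_derivative (1 * shc (z\<^sup>2) + (deriv shc (z\<^sup>2) * (2 * z)) * z)) (at z)"
    by (rule DERIV_mult[OF DERIV_ident DERIV_chain2[where f = shc and g = "\<lambda>z. z\<^sup>2", OF D]]) (auto intro!: derivative_eq_intros)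
  moreover have "((\<lambda>z. z * shc (z\<^sup>2)) has_field_derivative cosh z) (at z)"
    unfolding shc_square by (auto intro!: derivative_eq_intros)
  ultimately have "shc (z\<^sup>2) + 2 * z\<^sup>2 * deriv shc (z\<^sup>2) = cosh z"
    using DERIV_unique by (fastforce simp: power2_eq_square mult_ac)
  moreover have "z \<noteq> 0" using assms by auto
  moreover have "shc (z\<^sup>2) = sinh z / z" using shc_square[of z] \<open>z \<noteq> 0\<close> by (simp add: field_simps)
  ultimately have eq: "2 * z\<^sup>2 * deriv shc (z\<^sup>2) = cosh z - sinh z / z" by (simp add: algebra_simps)
  have "z\<^sup>2 * cpsi (z\<^sup>2) = (2 * z\<^sup>2 * deriv shc (z\<^sup>2)) / shc (z\<^sup>2)" by (simp add: cpsi_def)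
  also have "\<dots> = (cosh z - sinh z / z) / (sinh z / z)" unfolding eq \<open>shc (z\<^sup>2) = sinh z / z\<close> ..
  also have "\<dots> = z * cosh z / sinh z - 1" using assms \<open>z \<noteq> 0\<close> by (simp add: field_simps)
  finally show ?thesis .
qed

lemma cpsi_sums:
  assumes "shc w \<noteq> 0"
  shows "(\<lambda>k. 2 / (of_real (pole k) + w)) sums cpsi w"
proof -
  have "(\<lambda>k. deriv (\<lambda>w. 1 + w / of_real (pole k)) w / (1 + w / of_real (pole k))) sums (deriv shc w / shc w)"
  proof (rule logderiv_prodinf_complex_uniform_limit)
    show "uniform_limit (ball 0 (norm w + 1)) (\<lambda>n w. \<Prod>k<n. 1 + w / of_real (pole k)) shc sequentially"
      by (rule uniform_limit_on_subset[OF uniform_limit_shc]) (rule ball_subset_cball)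
    show "(\<lambda>w. 1 + w / of_real (pole k)) holomorphic_on ball 0 (norm w + 1)" for k
      using pole_pos[of k] by (auto intro!: holomorphic_intros)
  qed (use assms in auto)
  also have "(\<lambda>k. deriv (\<lambda>w. 1 + w / of_real (pole k)) w / (1 + w / of_real (pole k))) = (\<lambda>k. 1 / (of_real (pole k) + w))"
  proof
    fix k
    have p: "complex_of_real (pole k) \<noteq> 0" using pole_pos[of k] by simp
    have "((\<lambda>w. 1 + w / of_real (pole k)) has_field_derivative 1 / of_real (pole k)) (at w)"
      using p by (auto intro!: derivative_eq_intros)
    then have "deriv (\<lambda>w. 1 + w / of_real (pole k)) w = 1 / of_real (pole k)" by (rule DERIV_imp_deriv)
    moreover have "1 + w / of_real (pole k) = (of_real (pole k) + w) / of_real (pole k)"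
      using p by (simp add: field_simps)
    ultimately show "deriv (\<lambda>w. 1 + w / of_real (pole k)) w / (1 + w / of_real (pole k)) = 1 / (of_real (pole k) + w)"
      using p by simp
  qed
  finally have "(\<lambda>k. 2 * (1 / (of_real (pole k) + w))) sums (2 * (deriv shc w / shc w))" by (rule sums_mult)
  then show ?thesis by (simp add: cpsi_def)
qed

text \<open>Factor by factor, \<open>(1 - \<sigma> / pole k) * (1 + s / pole k) \<le> 1 + (s -
  \<sigma>) / pole k\<close>, and the right side is at most the modulus of the factor of
  \<open>shc w\<close>. The first factors multiply to the positive number
  \<open>norm (shc (- \<sigma>))\<close>. Three of the second factors give cubic growth in
  \<open>s\<close>, enough for integrability on three-dimensional space.\<close>

lemma shc_lower_bound:
  assumes "0 \<le> \<sigma>" "\<sigma> < pi\<^sup>2"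
  obtains c where "c > 0" "\<And>w s. \<lbrakk>0 \<le> s; s - \<sigma> \<le> Re w\<rbrakk> \<Longrightarrow> c * (1 + s) ^ 3 \<le> norm (shc w)"
proof -
  have lt: "\<sigma> < pole k" for k using pole_ge[of k] assms by simp
  have pos: "norm (shc (- of_real \<sigma>)) > 0"
  proof (cases "\<sigma> = 0")
    case False
    \<comment> \<open>At \<open>- \<sigma> = (\<i> * t)\<^sup>2\<close> the value is
      \<open>sin t / t\<close>, positive because \<open>t < pi\<close>.\<close>
    define t where "t = sqrt \<sigma>"
    have t: "0 < t" "t < pi" "t\<^sup>2 = \<sigma>"
      using assms False by (auto simp: t_def real_sqrt_less_iff intro: real_less_lsqrt)
    have "\<i> * of_real t * shc ((\<i> * of_real t)\<^sup>2) = \<i> * of_real (sin t)"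
      unfolding shc_square by (simp add: sin_of_real[symmetric] sin_conv_sinh)
    moreover have "(\<i> * of_real t)\<^sup>2 = - complex_of_real \<sigma>" using t(3) by (simp add: power_mult_distrib flip: of_real_power)
    moreover have "sin t > 0" using t by (intro sin_gt_zero)
    ultimately have "shc (- of_real \<sigma>) \<noteq> 0" using t by auto
    then show ?thesis by simp
  qed (simp add: shc_0)
  \<comment> \<open>\<open>pole 2\<close> is the largest of the first three poles, so each of these
    factors is at least \<open>(1 + s) / pole 2\<close>.\<close>
  define c where "c = norm (shc (- of_real \<sigma>)) / (pole 2) ^ 3"
  show ?thesis
  proof (rule that)
    show "c > 0" using pos pole_pos by (simp add: c_def)
    fix w s assume s: "0 \<le> s" "s - \<sigma> \<le> Re w"
    have "norm (\<Prod>k<n. 1 + - complex_of_real \<sigma> / of_real (pole k)) * (\<Prod>k<n. 1 + s / pole k)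
          \<le> norm (\<Prod>k<n. 1 + w / of_real (pole k))" for n
      unfolding prod_norm[symmetric] prod.distrib[symmetric]
    proof (rule prod_mono, safe)
      fix k
      have p: "pole k > 0" by (rule pole_pos)
      have "1 + - of_real \<sigma> / of_real (pole k) = complex_of_real (1 - \<sigma> / pole k)" by simp
      then have 1: "norm (1 + - of_real \<sigma> / complex_of_real (pole k)) = 1 - \<sigma> / pole k"
        using lt[of k] p by (simp only: norm_of_real) (simp add: divide_le_eq)
      show "0 \<le> norm (1 + - of_real \<sigma> / complex_of_real (pole k)) * (1 + s / pole k)"
        using s p by simp
      have "(1 - \<sigma> / pole k) * (1 + s / pole k) \<le> 1 + (s - \<sigma>) / pole k"
        using s p assms by (simp add: field_simps)
      also have "\<dots> \<le> Re (1 + w / of_real (pole k))"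
        using s p by (simp add: divide_right_mono)
      also have "\<dots> \<le> norm (1 + w / of_real (pole k))" by (rule complex_Re_le_cmod)
      finally show "norm (1 + - of_real \<sigma> / complex_of_real (pole k)) * (1 + s / pole k)
          \<le> norm (1 + w / of_real (pole k))" unfolding 1 .
    qed
    moreover have "((1 + s) / pole 2) ^ 3 \<le> (\<Prod>k<n. 1 + s / pole k)" if "n \<ge> 3" for n
    proof -
      have p2: "pole k \<le> pole 2" if "k \<le> 2" for k
        unfolding pole_def using that by (intro power_mono mult_right_mono) auto
      have "(1 + s) / pole 2 \<le> 1 + s / pole k" if "k < 3" for k
      proof -
        have "pole 2 \<ge> 1" using pole_ge[of 2] pi_ge_two by (smt (verit) one_le_power)
        then have "1 / pole 2 \<le> 1" by simp
        moreover have "s / pole 2 \<le> s / pole k" using p2[of k] that s pole_pos[of k] by (intro divide_left_mono) auto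
        ultimately show ?thesis by (simp add: add_divide_distrib)
      qed
      then have "(\<Prod>k<(3::nat). (1 + s) / pole 2) \<le> (\<Prod>k<3. 1 + s / pole k)"
        using s pole_pos by (intro prod_mono) (auto simp: less_imp_le)
      also have "\<dots> \<le> (\<Prod>k<n. 1 + s / pole k)"
        using that s pole_pos by (intro prod_mono2) (auto simp: less_imp_le add_nonneg_nonneg divide_nonneg_pos)
      finally show ?thesis by simp
    qed
    ultimately have "norm (\<Prod>k<n. 1 + - of_real \<sigma> / complex_of_real (pole k)) * ((1 + s) / pole 2) ^ 3
          \<le> norm (\<Prod>k<n. 1 + w / of_real (pole k))" if "n \<ge> 3" for n
      using that by (meson mult_left_mono norm_ge_zero order_trans)
    then have "norm (shc (- of_real \<sigma>)) * ((1 + s) / pole 2) ^ 3 \<le> norm (shc w)"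
      by (intro LIMSEQ_le[OF tendsto_mult_right[OF tendsto_norm[OF shc_LIMSEQ]] tendsto_norm[OF shc_LIMSEQ]]) blast
    then show "c * (1 + s) ^ 3 \<le> norm (shc w)" by (simp add: c_def power_divide)
  qed
qed

text \<open>The case \<open>s = 0\<close> of the lower bound. The half-plane reaches up to the first
  zero \<open>- pole 0\<close>; on it \<open>1 / shc\<close> and \<open>cpsi\<close> are
  holomorphic.\<close>

lemma shc_nonzero:
  assumes "- (pi\<^sup>2) < Re w"
  shows "shc w \<noteq> 0"
proof -
  define \<sigma> where "\<sigma> = max 0 (- Re w)"
  have "0 \<le> \<sigma>" "\<sigma> < pi\<^sup>2" using assms by (auto simp: \<sigma>_def)
  then obtain c where "c > 0" "\<And>w s. \<lbrakk>0 \<le> s; s - \<sigma> \<le> Re w\<rbrakk> \<Longrightarrow> c * (1 + s) ^ 3 \<le> norm (shc w)"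
    using shc_lower_bound by blast
  moreover have "0 - \<sigma> \<le> Re w" by (simp add: \<sigma>_def max_def)
  ultimately show ?thesis by (metis le_numeral_extra(3) mult_1_right norm_zero not_le one_power2 add_0_right power_one)
qed

lemma holomorphic_cpsi: "cpsi holomorphic_on {w. - (pi\<^sup>2) < Re w}"
  unfolding cpsi_def[abs_def] using shc_nonzero
  by (auto intro!: holomorphic_intros simp: open_halfspace_Re_gt)

lemma Re_of_real_times: "Re (complex_of_real a * z) = a * Re z"
  by simp

text \<open>The strict maximum at the saddle. In use, \<open>s\<close> is the squared norm of the
  real part of \<lambda> and \<open>p\<close> the square of its component along \<open>x\<close>. In
  the partial fractions each term is \<open>2 - 2 * (pole k + p) * Re (1 / D)\<close> with
  \<open>D = pole k + w\<close>, and \<open>Re (1 / D) \<le> 1 / (pole k - \<sigma> + s)\<close>.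
  Even in the worst case \<open>p = s\<close> each term exceeds its value at the saddle by a
  multiple of \<open>\<sigma> * s\<close>. The surplus for \<open>k = 0\<close> is kept as the gap,
  the others are dropped.\<close>

lemma Re_cpsi_ge:
  assumes \<sigma>: "0 \<le> \<sigma>" "\<sigma> < pi\<^sup>2" and p: "0 \<le> p" "p \<le> s" and w: "s - \<sigma> \<le> Re w"
  shows "- \<sigma> * Re (cpsi (- of_real \<sigma>)) + 2 * \<sigma> * s / ((pi\<^sup>2 - \<sigma>) * (pi\<^sup>2 - \<sigma> + s))
           \<le> Re (cpsi w * (w - of_real p))"
proof -
  have lt: "\<sigma> < pole k" for k using pole_ge[of k] \<sigma> by simp
  have "(\<lambda>k. 2 / (of_real (pole k) + - of_real \<sigma>)) sums cpsi (- complex_of_real \<sigma>)"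
    using \<sigma> by (intro cpsi_sums shc_nonzero) auto
  then have "(\<lambda>k. - \<sigma> * Re (2 / (of_real (pole k) + - of_real \<sigma>))) sums (- \<sigma> * Re (cpsi (- complex_of_real \<sigma>)))"
    by (intro sums_mult sums_Re)
  moreover have "Re (2 / (of_real (pole k) + - complex_of_real \<sigma>)) = 2 / (pole k - \<sigma>)" for k
    by (metis Re_complex_of_real add_uminus_conv_diff of_real_diff of_real_divide of_real_numeral)
  ultimately have "(\<lambda>k. - \<sigma> * (2 / (pole k - \<sigma>))) sums (- \<sigma> * Re (cpsi (- complex_of_real \<sigma>)))" by simp
  then have 1: "(\<lambda>k. - \<sigma> * (2 / (pole k - \<sigma>)) + (if k = 0 then 2 * \<sigma> * s / ((pi\<^sup>2 - \<sigma>) * (pi\<^sup>2 - \<sigma> + s)) else 0))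
      sums (- \<sigma> * Re (cpsi (- complex_of_real \<sigma>)) + 2 * \<sigma> * s / ((pi\<^sup>2 - \<sigma>) * (pi\<^sup>2 - \<sigma> + s)))"
    by (intro sums_add sums_single)
  have "(\<lambda>k. 2 / (of_real (pole k) + w)) sums cpsi w"
    using \<sigma> p w by (intro cpsi_sums shc_nonzero) auto
  then have 2: "(\<lambda>k. Re (2 / (of_real (pole k) + w) * (w - of_real p))) sums Re (cpsi w * (w - of_real p))"
    by (intro sums_Re sums_mult2)
  show ?thesis
  proof (rule sums_le[OF _ 1 2])
    fix k
    define a where "a = pole k - \<sigma>"
    have a: "a > 0" "pole k = a + \<sigma>" using lt[of k] by (auto simp: a_def)
    define D where "D = of_real (pole k) + w"
    have ReD: "a + s \<le> Re D" using w by (simp add: D_def a_def)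
    have nD: "a + s \<le> norm D" using ReD complex_Re_le_cmod[of D] by simp
    have "D \<noteq> 0" using nD a p by auto
    have "2 / D * (w - of_real p) = of_real 2 - of_real (2 * (pole k + p)) * (1 / D)"
      using \<open>D \<noteq> 0\<close> by (simp add: field_simps) (simp add: D_def algebra_simps)
    then have "Re (2 / D * (w - of_real p)) = 2 - 2 * (pole k + p) * Re (1 / D)"
      by (simp only: minus_complex.simps Re_complex_of_real Re_of_real_times)
    moreover have "Re (1 / D) \<le> 1 / (a + s)"
    proof -
      have "Re (1 / D) \<le> norm (1 / D)" by (rule complex_Re_le_cmod)
      also have "\<dots> = 1 / norm D" by (simp add: norm_divide)
      also have "\<dots> \<le> 1 / (a + s)" using nD a p by (intro divide_left_mono mult_pos_pos) auto
      finally show ?thesis .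
    qed
    then have "2 * (pole k + p) * Re (1 / D) \<le> 2 * (pole k + p) * (1 / (a + s))"
      using pole_pos[of k] p by (intro mult_left_mono) auto
    ultimately have "2 - 2 * (pole k + p) / (a + s) \<le> Re (2 / D * (w - of_real p))" by simp
    moreover have "- \<sigma> * (2 / a) + (if k = 0 then 2 * \<sigma> * s / (a * (a + s)) else 0) \<le> 2 - 2 * (pole k + p) / (a + s)"
    proof -
      have "2 - 2 * (pole k + p) / (a + s) - (- \<sigma> * (2 / a)) = 2 * (a * (s - p) + \<sigma> * s) / (a * (a + s))"
        using a p by (simp add: field_simps)
      also have "\<dots> \<ge> 2 * \<sigma> * s / (a * (a + s))" using a p by (intro divide_right_mono) auto
      moreover have "2 * \<sigma> * s / (a * (a + s)) \<ge> 0" using a p \<sigma> by simp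
      ultimately show ?thesis by auto
    qed
    moreover have "a = pi\<^sup>2 - \<sigma>" if "k = 0" using that by (simp add: a_def pole_def)
    ultimately show "- \<sigma> * (2 / (pole k - \<sigma>)) + (if k = 0 then 2 * \<sigma> * s / ((pi\<^sup>2 - \<sigma>) * (pi\<^sup>2 - \<sigma> + s)) else 0)
        \<le> Re (2 / (of_real (pole k) + w) * (w - of_real p))"
      unfolding a_def[symmetric] D_def[symmetric] by (auto split: if_splits)
  qed
qed

section \<open>Lebesgue integrals on $\mathbb R^3$ and with a holomorphic parameter\<close>

text \<open>Covers three changes of variable: translation by the real part of the shift, the
  reflection of \<lambda>, and dilation by \<open>sqrt h\<close>.\<close>

lemma lborel_integral_affine:
  fixes f :: "'a::euclidean_space \<Rightarrow> 'b::{banach, second_countable_topology}"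
  assumes "c \<noteq> 0" and f: "f \<in> borel_measurable borel"
  shows "integral\<^sup>L lborel f = \<bar>c\<bar> ^ DIM('a) *\<^sub>R (LINT x|lborel. f (t + c *\<^sub>R x))"
proof -
  have "integral\<^sup>L lborel f = integral\<^sup>L (density (distr lborel borel (\<lambda>x. t + c *\<^sub>R x)) (\<lambda>_. \<bar>c\<bar> ^ DIM('a))) f"
    using lborel_affine[OF assms(1), of t] by simp
  also have "\<dots> = (LINT x|distr lborel borel (\<lambda>x. t + c *\<^sub>R x). \<bar>c\<bar> ^ DIM('a) *\<^sub>R f x)"
    using f by (intro integral_density) auto
  also have "\<dots> = \<bar>c\<bar> ^ DIM('a) *\<^sub>R (LINT x|lborel. f (t + c *\<^sub>R x))"
    using f by (subst integral_distr) auto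
  finally show ?thesis .
qed

lemma has_bochner_integral_lborel_prod:
  fixes f :: "'a::euclidean_space \<Rightarrow> real \<Rightarrow> real"
  assumes f: "\<And>b. b \<in> Basis \<Longrightarrow> has_bochner_integral lborel (f b) (I b)"
    and nn: "\<And>b x. b \<in> Basis \<Longrightarrow> 0 \<le> f b x"
  shows "has_bochner_integral lborel (\<lambda>x::'a. \<Prod>b\<in>Basis. f b (x \<bullet> b)) (\<Prod>b\<in>Basis. I b)"
proof (rule has_bochner_integral_nn_integral)
  have m: "f b \<in> borel_measurable borel" if "b \<in> Basis" for b
    using borel_measurable_has_bochner_integral[OF f[OF that]] by simp
  have I: "I b \<ge> 0" if "b \<in> Basis" for b
  proof -
    have "0 \<le> integral\<^sup>L lborel (f b)" using nn[OF that] by (rule Bochner_Integration.integral_nonneg)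
    then show ?thesis using has_bochner_integral_integral_eq[OF f[OF that]] by simp
  qed
  show "(\<lambda>x::'a. \<Prod>b\<in>Basis. f b (x \<bullet> b)) \<in> borel_measurable lborel"
    by (intro borel_measurable_prod) (simp add: measurable_compose[OF _ m])
  show "AE x in lborel. 0 \<le> (\<Prod>b\<in>Basis. f b (x \<bullet> b))" using nn by (intro AE_I2 prod_nonneg) auto
  show "0 \<le> (\<Prod>b\<in>Basis. I b)" using I by (intro prod_nonneg) auto
  have "(\<integral>\<^sup>+x. ennreal (\<Prod>b\<in>Basis. f b (x \<bullet> b)) \<partial>lborel) = (\<integral>\<^sup>+x. (\<Prod>b\<in>Basis. ennreal (f b (x \<bullet> b))) \<partial>lborel)"
    using nn by (intro nn_integral_cong prod_ennreal[symmetric]) auto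
  also have "\<dots> = (\<Prod>b\<in>Basis. (\<integral>\<^sup>+x. ennreal (f b x) \<partial>lborel))"
    by (rule nn_integral_lborel_prod) (auto intro: measurable_compose[OF m])
  also have "\<dots> = (\<Prod>b\<in>Basis. ennreal (I b))"
    using f nn by (intro prod.cong refl) (simp add: has_bochner_integral_iff nn_integral_eq_integral)
  also have "\<dots> = ennreal (\<Prod>b\<in>Basis. I b)" using I by (intro prod_ennreal) auto
  finally show "(\<integral>\<^sup>+x. ennreal (\<Prod>b\<in>Basis. f b (x \<bullet> b)) \<partial>lborel) = ennreal (\<Prod>b\<in>Basis. I b)" .
qed

lemma integrable_inverse_one_plus_square: "integrable lborel (\<lambda>x::real. 1 / (1 + x\<^sup>2))"
proof -
  have "set_integrable lborel (einterval (-\<infinity>) \<infinity>) (\<lambda>x::real. 1 / (1 + x\<^sup>2))"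
  proof (rule interval_integral_FTC_nonneg(1))
    show "DERIV arctan x :> 1 / (1 + x\<^sup>2)" for x
      using DERIV_arctan[of x] by (simp add: inverse_eq_divide)
    show "isCont (\<lambda>x::real. 1 / (1 + x\<^sup>2)) x" for x
      by (intro continuous_intros) (simp add: add_nonneg_eq_0_iff)
    show "((arctan \<circ> real_of_ereal) \<longlongrightarrow> - (pi/2)) (at_right (-\<infinity>))"
      by (simp add: ereal_tendsto_simps tendsto_arctan_at_bot)
    show "((arctan \<circ> real_of_ereal) \<longlongrightarrow> pi/2) (at_left \<infinity>)"
      by (simp add: ereal_tendsto_simps tendsto_arctan_at_top)
  qed auto
  then show ?thesis by (simp add: set_integrable_def)
qed

lemma prod_Basis_real3:
  "(\<Prod>b\<in>(Basis :: (real ^ 3) set). g b) = g (axis 1 1) * g (axis 2 1) * g (axis 3 1)"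
proof -
  have eq: "(Basis :: (real ^ 3) set) = (\<lambda>i. axis i 1) ` UNIV" by (auto simp: Basis_vec_def)
  have "(\<Prod>b\<in>(Basis :: (real ^ 3) set). g b) = (\<Prod>i\<in>UNIV. g (axis i 1))"
    unfolding eq by (subst prod.reindex) (auto simp: inj_on_def axis_eq_axis)
  also have "\<dots> = g (axis 1 1) * g (axis 2 1) * g (axis 3 1)" unfolding UNIV_3 by (simp add: ac_simps)
  finally show ?thesis .
qed

lemma norm_square_real3: "(norm (l :: real ^ 3))\<^sup>2 = (l $ 1)\<^sup>2 + (l $ 2)\<^sup>2 + (l $ 3)\<^sup>2"
  by (simp only: power2_norm_eq_inner) (simp add: inner_vec_def sum_3 power2_eq_square)

text \<open>The common majorant for all limits below. Bounding the three factors by one coordinate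
  each reduces it to one-dimensional integrals.\<close>

lemma integrable_inverse_one_plus_norm_square_cubed:
  "integrable lborel (\<lambda>l::real ^ 3. 1 / (1 + (norm l)\<^sup>2) ^ 3)"
proof (rule Bochner_Integration.integrable_bound)
  have "has_bochner_integral lborel (\<lambda>x::real ^ 3. \<Prod>b\<in>Basis. 1 / (1 + (x \<bullet> b)\<^sup>2))
      (\<Prod>b\<in>(Basis :: (real ^ 3) set). LINT x|lborel. 1 / (1 + x\<^sup>2))"
    by (rule has_bochner_integral_lborel_prod)
      (auto intro: has_bochner_integral_integrable integrable_inverse_one_plus_square)
  then show "integrable lborel (\<lambda>x::real ^ 3. \<Prod>b\<in>Basis. 1 / (1 + (x \<bullet> b)\<^sup>2))"
    by (simp add: has_bochner_integral_iff)
  show "AE l::real ^ 3 in lborel. norm (1 / (1 + (norm l)\<^sup>2) ^ 3) \<le> norm (\<Prod>b\<in>Basis. 1 / (1 + (l \<bullet> b)\<^sup>2))"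
  proof (rule AE_I2)
    fix l :: "real ^ 3"
    have "(1 + (l $ 1)\<^sup>2) * (1 + (l $ 2)\<^sup>2) * (1 + (l $ 3)\<^sup>2) \<le> (1 + (norm l)\<^sup>2) * (1 + (norm l)\<^sup>2) * (1 + (norm l)\<^sup>2)"
      by (intro mult_mono mult_nonneg_nonneg) (auto simp: norm_square_real3)
    then have "1 / (1 + (norm l)\<^sup>2) ^ 3 \<le> 1 / ((1 + (l $ 1)\<^sup>2) * (1 + (l $ 2)\<^sup>2) * (1 + (l $ 3)\<^sup>2))"
      by (intro divide_left_mono mult_pos_pos) (auto simp: power3_eq_cube add_pos_nonneg)
    also have "\<dots> = (\<Prod>b\<in>Basis. 1 / (1 + (l \<bullet> b)\<^sup>2))"
      by (simp add: prod_Basis_real3 cart_eq_inner_axis[symmetric])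
    finally show "norm (1 / (1 + (norm l)\<^sup>2) ^ 3) \<le> norm (\<Prod>b\<in>Basis. 1 / (1 + (l \<bullet> b)\<^sup>2))"
      by (simp add: order_trans[OF _ abs_ge_self])
  qed
qed simp

section \<open>Gaussian integrals\<close>

lemma gaussian_integral:
  fixes a :: real
  assumes "a > 0"
  shows "has_bochner_integral lborel (\<lambda>x. exp (- (a * x\<^sup>2))) (sqrt (pi / a))"
proof -
  define \<sigma> where "\<sigma> = sqrt (1 / (2 * a))"
  have \<sigma>: "\<sigma> > 0" "\<sigma>\<^sup>2 = 1 / (2 * a)" using assms by (simp_all add: \<sigma>_def)
  have "has_bochner_integral lborel (\<lambda>x. sqrt (pi / a) * normal_density 0 \<sigma> x) (sqrt (pi / a) * 1)"
    using \<sigma>(1) by (intro has_bochner_integral_mult_right) (simp add: has_bochner_integral_iff)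
  moreover have "sqrt (pi / a) * normal_density 0 \<sigma> x = exp (- (a * x\<^sup>2))" for x
    using assms by (simp add: normal_density_def \<sigma>(2) real_sqrt_divide mult.commute)
  ultimately show ?thesis by simp
qed

lemma gaussian_integral_real3:
  fixes a b c :: real
  assumes "a > 0" "b > 0" "c > 0"
  shows "has_bochner_integral lborel (\<lambda>l::real ^ 3. exp (- (a * (l $ 1)\<^sup>2 + b * (l $ 2)\<^sup>2 + c * (l $ 3)\<^sup>2)))
     (pi powr (3 / 2) / sqrt (a * b * c))"
proof -
  define d :: "real ^ 3" where "d = vector [a, b, c]"
  have d: "d \<bullet> axis 1 1 = a" "d \<bullet> axis 2 1 = b" "d \<bullet> axis 3 1 = c"
    by (simp_all add: d_def cart_eq_inner_axis[symmetric])
  have "has_bochner_integral lborel (\<lambda>l::real ^ 3. \<Prod>e\<in>Basis. exp (- ((d \<bullet> e) * (l \<bullet> e)\<^sup>2)))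
     (\<Prod>e\<in>Basis. sqrt (pi / (d \<bullet> e)))"
  proof (rule has_bochner_integral_lborel_prod)
    fix e :: "real ^ 3" assume "e \<in> Basis"
    then have "d \<bullet> e > 0" using assms d by (auto simp: Basis_vec_def) (metis d exhaust_3)
    then show "has_bochner_integral lborel (\<lambda>x. exp (- ((d \<bullet> e) * x\<^sup>2))) (sqrt (pi / (d \<bullet> e)))"
      by (rule gaussian_integral)
  qed simp
  moreover have "(\<Prod>e\<in>Basis. exp (- ((d \<bullet> e) * (l \<bullet> e)\<^sup>2))) = exp (- (a * (l $ 1)\<^sup>2 + b * (l $ 2)\<^sup>2 + c * (l $ 3)\<^sup>2))"
    for l :: "real ^ 3"
    by (simp add: prod_Basis_real3 d_def cart_eq_inner_axis[symmetric] mult_exp_exp)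
  moreover have "(\<Prod>e\<in>Basis. sqrt (pi / (d \<bullet> e))) = pi powr (3 / 2) / sqrt (a * b * c)"
  proof -
    have "pi powr (3 / 2) = pi powr (1 + 1 / 2)" by simp
    also have "\<dots> = pi * sqrt pi" by (subst powr_add) (simp add: powr_half_sqrt)
    finally show ?thesis by (simp add: prod_Basis_real3 d real_sqrt_divide real_sqrt_mult)
  qed
  ultimately show ?thesis by simp
qed

text \<open>Cauchy's inequality turns a local majorant \<open>g\<close> of the integrand into the
  majorant \<open>g x * (2 / r)\<close> of its difference quotients, so dominated convergence along
  sequences allows differentiation under the integral.\<close>

lemma holomorphic_on_lebesgue_integral:
  fixes f :: "'a \<Rightarrow> complex \<Rightarrow> complex"
  assumes S: "open S" and holo: "\<And>x. f x holomorphic_on S"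
    and meas: "\<And>z. z \<in> S \<Longrightarrow> (\<lambda>x. f x z) \<in> borel_measurable M"
    and dom: "\<And>z. z \<in> S \<Longrightarrow> \<exists>r>0. cball z r \<subseteq> S \<and> (\<exists>g. integrable M g \<and> (\<forall>x. \<forall>w\<in>cball z r. norm (f x w) \<le> g x))"
  shows "(\<lambda>z. LINT x|M. f x z) holomorphic_on S"
  unfolding holomorphic_on_open[OF S]
proof
  fix z assume "z \<in> S"
  then obtain r g where r: "r > 0" "cball z r \<subseteq> S" and g: "integrable M g"
    and fg: "\<And>x w. w \<in> cball z r \<Longrightarrow> norm (f x w) \<le> g x"
    using dom by metis
  have fint: "integrable M (\<lambda>x. f x w)" if "w \<in> cball z r" for w
    using fg[OF that] meas[of w] that r by (intro Bochner_Integration.integrable_bound[OF g])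
      (auto intro!: AE_I2 intro: order_trans[OF _ abs_ge_self])
  \<comment> \<open>Around each point of the half-size disc there is a disc of radius
    \<open>r / 2\<close> on which the majorant is valid, as Cauchy's inequality requires.\<close>
  define B where "B = ball z (r / 2)"
  have quot: "norm ((f x w - f x z) / (w - z)) \<le> g x * (2 / r)" if w: "w \<in> B" for x w
  proof -
    have "norm (f x w - f x z) \<le> (g x * (2 / r)) * norm (w - z)"
    proof (rule field_differentiable_bound[where S = B])
      fix y assume y: "y \<in> B"
      have sub: "cball y (r / 2) \<subseteq> cball z r"
      proof
        fix v assume "v \<in> cball y (r / 2)"
        then show "v \<in> cball z r" using y dist_triangle[of z v y] by (auto simp: B_def dist_commute)
      qed
      have "f x holomorphic_on cball y (r / 2)"
        using holo r(2) sub by (meson holomorphic_on_subset order_trans)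
      then have "norm ((deriv ^^ 1) (f x) y) \<le> fact 1 * g x / (r / 2) ^ 1"
        using r(1) sub by (intro Cauchy_inequality)
          (auto intro: holomorphic_on_subset holomorphic_on_imp_continuous_on fg simp: dist_norm)
      then show "norm (deriv (f x) y) \<le> g x * (2 / r)" by simp
      have "y \<in> S" using y r sub \<open>r > 0\<close> by (meson centre_in_cball half_gt_zero less_imp_le subsetD)
      then show "(f x has_field_derivative deriv (f x) y) (at y within B)"
        using holo S by (intro holomorphic_derivI)
    qed (use r w in \<open>auto simp: B_def\<close>)
    moreover have "0 \<le> g x" using order_trans[OF norm_ge_zero fg[of z x]] r by simp
    ultimately show ?thesis using r by (cases "w = z") (auto simp: norm_divide field_simps)
  qed
  have der: "(f x has_field_derivative deriv (f x) z) (at z)" for x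
    using holo S \<open>z \<in> S\<close> by (intro holomorphic_derivI)
  have dlim: "((\<lambda>w. (f x w - f x z) / (w - z)) \<longlongrightarrow> deriv (f x) z) (at z within B)" for x
    using der[of x] unfolding has_field_derivative_iff by (rule tendsto_within_subset) simp
  have zB: "z \<in> B" "B \<subseteq> cball z r" "open B" using r by (auto simp: B_def)
  have seq: "(\<lambda>i. LINT x|M. (f x (X i) - f x z) / (X i - z)) \<longlonglongrightarrow> (LINT x|M. deriv (f x) z)"
    if X: "\<And>i. X i \<in> B - {z}" "X \<longlonglongrightarrow> z" for X
  proof (rule integral_dominated_convergence)
    have lim: "(\<lambda>i. (f x (X i) - f x z) / (X i - z)) \<longlonglongrightarrow> deriv (f x) z" for x
      using dlim[of x] X unfolding tendsto_at_iff_sequentially comp_def by blast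
    show m: "(\<lambda>x. (f x (X i) - f x z) / (X i - z)) \<in> borel_measurable M" for i
      using X zB r \<open>z \<in> S\<close> by (intro borel_measurable_divide borel_measurable_diff meas borel_measurable_const) auto
    show "(\<lambda>x. deriv (f x) z) \<in> borel_measurable M"
      by (rule borel_measurable_LIMSEQ_metric[OF m lim])
    show "integrable M (\<lambda>x. g x * (2 / r))" using g by simp
    show "AE x in M. (\<lambda>i. (f x (X i) - f x z) / (X i - z)) \<longlonglongrightarrow> deriv (f x) z" using lim by simp
    show "AE x in M. norm ((f x (X i) - f x z) / (X i - z)) \<le> g x * (2 / r)" for i
      using quot X by simp
  qed
  have "((\<lambda>w. LINT x|M. (f x w - f x z) / (w - z)) \<longlongrightarrow> (LINT x|M. deriv (f x) z)) (at z within B)"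
    unfolding tendsto_at_iff_sequentially comp_def using seq by blast
  then have "((\<lambda>w. ((LINT x|M. f x w) - (LINT x|M. f x z)) / (w - z)) \<longlongrightarrow> (LINT x|M. deriv (f x) z)) (at z within B)"
  proof (rule Lim_transform_within[OF _ zero_less_one])
    fix w assume "w \<in> B"
    then have "w \<in> cball z r" "z \<in> cball z r" using zB by auto
    then show "(LINT x|M. (f x w - f x z) / (w - z)) = ((LINT x|M. f x w) - (LINT x|M. f x z)) / (w - z)"
      unfolding integral_divide_zero by (subst Bochner_Integration.integral_diff[OF fint fint]) auto
  qed
  then have "((\<lambda>w. LINT x|M. f x w) has_field_derivative (LINT x|M. deriv (f x) z)) (at z)"
    unfolding has_field_derivative_iff at_within_open[OF zB(1,3)] .
  then show "\<exists>f'. ((\<lambda>w. LINT x|M. f x w) has_field_derivative f') (at z)" by blast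
qed

section \<open>Shifting the domain of integration\<close>

text \<open>
  With $\lambda$ replaced by $\lambda + z e_2$, \<open>quad\<close> continues $|\lambda|^2$ and the exponent of the heat
  kernel at \<open>x = X e\<^sub>1\<close> is \<open>- X\<^sup>2 / (4 h) * (1 + phase l z)\<close> plus a term linear in $\lambda$.
\<close>

definition quad :: "real ^ 3 \<Rightarrow> complex \<Rightarrow> complex" where
  "quad l z = of_real ((l $ 1)\<^sup>2 + (l $ 3)\<^sup>2) + (of_real (l $ 2) + z)\<^sup>2"

definition phase :: "real ^ 3 \<Rightarrow> complex \<Rightarrow> complex" where
  "phase l z = cpsi (quad l z) * (quad l z - of_real ((l $ 1)\<^sup>2))"

text \<open>The heat kernel integrand at \<lambda> + z e2; in use, \<open>A\<close> is
  \<open>X\<^sup>2 / (4 * h)\<close> and \<open>B\<close> is \<open>t2 / h\<close>.\<close>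

definition shifted :: "real \<Rightarrow> real \<Rightarrow> real ^ 3 \<Rightarrow> complex \<Rightarrow> complex" where
  "shifted A B l z = exp (- of_real A * (1 + phase l z) + \<i> * of_real B * (of_real (l $ 2) + z)) / shc (quad l z)"

lemma Re_quad: "Re (quad l z) = (l $ 1)\<^sup>2 + (l $ 3)\<^sup>2 + (l $ 2 + Re z)\<^sup>2 - (Im z)\<^sup>2"
  by (simp add: quad_def power2_eq_square)

lemma Re_quad_gt: "\<bar>Im z\<bar> < pi \<Longrightarrow> - (pi\<^sup>2) < Re (quad l z)"
proof -
  assume "\<bar>Im z\<bar> < pi"
  then have "(Im z)\<^sup>2 < pi\<^sup>2" by (metis abs_le_square_iff abs_of_nonneg not_le pi_ge_zero)
  moreover have "0 \<le> (l $ 1)\<^sup>2 + (l $ 3)\<^sup>2 + (l $ 2 + Re z)\<^sup>2" by simp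
  ultimately show ?thesis unfolding Re_quad by linarith
qed

lemma holomorphic_shifted: "shifted A B l holomorphic_on {z. \<bar>Im z\<bar> < pi}"
proof -
  have q: "quad l holomorphic_on {z. \<bar>Im z\<bar> < pi}"
    unfolding quad_def[abs_def] by (intro holomorphic_intros)
  have c: "(\<lambda>z. cpsi (quad l z)) holomorphic_on {z. \<bar>Im z\<bar> < pi}"
    using holomorphic_on_compose_gen[OF q holomorphic_cpsi] Re_quad_gt by (force simp: o_def)
  have s: "(\<lambda>z. shc (quad l z)) holomorphic_on {z. \<bar>Im z\<bar> < pi}"
    using holomorphic_on_compose_gen[OF q holomorphic_shc[of UNIV]] by (simp add: o_def)
  have "(\<lambda>z. exp (- of_real A * (1 + cpsi (quad l z) * (quad l z - of_real ((l $ 1)\<^sup>2)))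
      + \<i> * of_real B * (of_real (l $ 2) + z)) / shc (quad l z)) holomorphic_on {z. \<bar>Im z\<bar> < pi}"
    using Re_quad_gt shc_nonzero by (intro holomorphic_intros q c s) auto
  then show ?thesis unfolding shifted_def[abs_def] phase_def .
qed

lemma continuous_on_shc_quad: "\<bar>Im z\<bar> < pi \<Longrightarrow> continuous_on UNIV (\<lambda>l. shc (quad l z))"
  by (rule continuous_on_compose2[OF holomorphic_on_imp_continuous_on[OF holomorphic_shc[of UNIV]]])
    (auto simp: quad_def intro!: continuous_intros)

lemma continuous_on_phase: "\<bar>Im z\<bar> < pi \<Longrightarrow> continuous_on UNIV (\<lambda>l. phase l z)"
  unfolding phase_def
proof (intro continuous_on_mult)
  assume "\<bar>Im z\<bar> < pi"
  then show "continuous_on UNIV (\<lambda>l. cpsi (quad l z))"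
    using Re_quad_gt by (intro continuous_on_compose2[OF holomorphic_on_imp_continuous_on[OF holomorphic_cpsi]])
      (auto simp: quad_def intro!: continuous_intros)
qed (auto simp: quad_def intro!: continuous_intros)

lemma borel_measurable_shifted:
  assumes "\<bar>Im z\<bar> < pi"
  shows "(\<lambda>l. shifted A B l z) \<in> borel_measurable borel"
proof (rule borel_measurable_continuous_onI)
  show "continuous_on UNIV (\<lambda>l. shifted A B l z)"
    unfolding shifted_def using shc_nonzero[OF Re_quad_gt[OF assms]]
    by (intro continuous_intros continuous_on_phase continuous_on_shc_quad assms) auto
qed

text \<open>The exponential is only bounded here, by dropping the gap in \<open>Re_cpsi_ge\<close>;
  all decay comes from \<open>shc\<close>. The bound \<open>R\<close> on the real part is needed
  because decay holds in the distance to a translated centre.\<close>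

lemma shifted_bound:
  assumes \<tau>: "0 \<le> \<tau>" "\<tau> < pi" and A: "A \<ge> 0"
  obtains M where "\<And>l z. \<lbrakk>\<bar>Im z\<bar> \<le> \<tau>; \<bar>Re z\<bar> \<le> R\<rbrakk> \<Longrightarrow> norm (shifted A B l z) \<le> M * (1 / (1 + (norm l)\<^sup>2) ^ 3)"
proof -
  define \<sigma> where "\<sigma> = \<tau>\<^sup>2"
  have \<sigma>: "0 \<le> \<sigma>" "\<sigma> < pi\<^sup>2" using \<tau> power_strict_mono[of \<tau> pi 2] by (auto simp: \<sigma>_def)
  obtain c where c: "c > 0" "\<And>w s. \<lbrakk>0 \<le> s; s - \<sigma> \<le> Re w\<rbrakk> \<Longrightarrow> c * (1 + s) ^ 3 \<le> norm (shc w)"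
    using shc_lower_bound[OF \<sigma>] by blast
  define N where "N = exp (- A * (1 - \<sigma> * Re (cpsi (- of_real \<sigma>))) + \<bar>B\<bar> * \<tau>)"
  \<comment> \<open>From \<open>(l $ 2)\<^sup>2 \<le> 2 * (l $ 2 + Re z)\<^sup>2 + 2 * (Re
    z)\<^sup>2\<close>, chosen so that
    \<open>1 + (norm l)\<^sup>2 \<le> K * (1 + s)\<close>.\<close>
  define K where "K = 2 + 2 * R\<^sup>2"
  show ?thesis
  proof (rule that[of "N * (K ^ 3 / c)"])
    fix l :: "real ^ 3" and z assume z: "\<bar>Im z\<bar> \<le> \<tau>" "\<bar>Re z\<bar> \<le> R"
    define s where "s = (l $ 1)\<^sup>2 + (l $ 3)\<^sup>2 + (l $ 2 + Re z)\<^sup>2"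
    have s: "0 \<le> s" "(l $ 1)\<^sup>2 \<le> s" by (auto simp: s_def)
    have "(Im z)\<^sup>2 \<le> \<sigma>" using z(1) unfolding \<sigma>_def by (metis abs_ge_zero power2_abs power_mono)
    then have w: "s - \<sigma> \<le> Re (quad l z)" unfolding Re_quad s_def by linarith
    have "- \<sigma> * Re (cpsi (- of_real \<sigma>)) + 2 * \<sigma> * s / ((pi\<^sup>2 - \<sigma>) * (pi\<^sup>2 - \<sigma> + s)) \<le> Re (phase l z)"
      unfolding phase_def using \<sigma> s w by (intro Re_cpsi_ge) auto
    moreover have "2 * \<sigma> * s / ((pi\<^sup>2 - \<sigma>) * (pi\<^sup>2 - \<sigma> + s)) \<ge> 0" using \<sigma> s by simp
    ultimately have "- \<sigma> * Re (cpsi (- of_real \<sigma>)) \<le> Re (phase l z)" by linarith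
    then have "A * (1 - \<sigma> * Re (cpsi (- of_real \<sigma>))) \<le> A * (1 + Re (phase l z))"
      using A by (intro mult_left_mono) auto
    moreover have "- B * Im z \<le> \<bar>B\<bar> * \<tau>"
    proof -
      have "- B * Im z \<le> \<bar>B\<bar> * \<bar>Im z\<bar>" using abs_ge_minus_self[of "B * Im z"] by (simp add: abs_mult)
      also have "\<dots> \<le> \<bar>B\<bar> * \<tau>" using z(1) by (intro mult_left_mono) auto
      finally show ?thesis .
    qed
    ultimately have "Re (- of_real A * (1 + phase l z) + \<i> * of_real B * (of_real (l $ 2) + z))
        \<le> - A * (1 - \<sigma> * Re (cpsi (- of_real \<sigma>))) + \<bar>B\<bar> * \<tau>" by simp
    then have e: "norm (exp (- of_real A * (1 + phase l z) + \<i> * of_real B * (of_real (l $ 2) + z))) \<le> N"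
      unfolding N_def norm_exp_eq_Re by simp
    have "(l $ 2)\<^sup>2 \<le> 2 * (l $ 2 + Re z)\<^sup>2 + 2 * (Re z)\<^sup>2"
      using zero_le_power2[of "l $ 2 + 2 * Re z"] by (simp add: power2_eq_square algebra_simps)
    moreover have "(Re z)\<^sup>2 \<le> R\<^sup>2" using z(2) by (metis abs_ge_zero power2_abs power_mono)
    moreover have "1 + (p1 + p2 + p3) \<le> (2 + 2 * q) * (1 + (p1 + p3 + u))"
      if "p2 \<le> 2 * u + 2 * a" "a \<le> q" "0 \<le> q" "0 \<le> u" "0 \<le> p1" "0 \<le> p3" for p1 p2 p3 q u a :: real
    proof -
      define y where "y = q * (p1 + p3 + u)"
      have "0 \<le> y" using that by (simp add: y_def)
      then have "1 + (p1 + p2 + p3) \<le> 2 + 2 * (p1 + p3 + u) + 2 * q + 2 * y" using that by argo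
      also have "\<dots> = (2 + 2 * q) * (1 + (p1 + p3 + u))" by (simp add: y_def algebra_simps)
      finally show ?thesis .
    qed
    ultimately have "1 + (norm l)\<^sup>2 \<le> K * (1 + s)"
      unfolding norm_square_real3 K_def s_def by (metis zero_le_power2)
    then have "(1 + (norm l)\<^sup>2) ^ 3 \<le> (K * (1 + s)) ^ 3" by (intro power_mono) (auto intro: add_nonneg_nonneg)
    then have le: "(1 + (norm l)\<^sup>2) ^ 3 \<le> K ^ 3 * (1 + s) ^ 3" by (simp only: power_mult_distrib)
    have pos: "0 < (1 + (norm l)\<^sup>2) ^ 3" "0 < c * (1 + s) ^ 3" using c s by (auto intro: add_pos_nonneg)
    have "1 / norm (shc (quad l z)) \<le> 1 / (c * (1 + s) ^ 3)"
      using c(2)[OF s(1) w] pos(2) by (intro frac_le) auto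
    also have "\<dots> \<le> K ^ 3 / c * (1 / (1 + (norm l)\<^sup>2) ^ 3)"
    proof -
      have "1 / (c * v) \<le> k / c * (1 / u)" if "u \<le> k * v" "0 < u" "0 < c * v" for u v k
        using that c(1) by (simp add: field_simps zero_less_mult_iff)
      from this[OF le pos] show ?thesis .
    qed
    finally have "1 / norm (shc (quad l z)) \<le> K ^ 3 / c * (1 / (1 + (norm l)\<^sup>2) ^ 3)" .
    then have "norm (exp (- of_real A * (1 + phase l z) + \<i> * of_real B * (of_real (l $ 2) + z))) * (1 / norm (shc (quad l z)))
        \<le> N * (K ^ 3 / c * (1 / (1 + (norm l)\<^sup>2) ^ 3))"
      using e by (intro mult_mono) (auto simp: N_def)
    then show "norm (shifted A B l z) \<le> N * (K ^ 3 / c) * (1 / (1 + (norm l)\<^sup>2) ^ 3)"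
      unfolding shifted_def norm_divide by (simp add: mult.assoc)
  qed
qed

lemma open_strip: "open {z. \<bar>Im z\<bar> < a}"
  by (intro open_Collect_less continuous_intros)

lemma convex_strip: "convex {z. \<bar>Im z\<bar> < a}"
proof -
  have "{z. \<bar>Im z\<bar> < a} = {z. Im z < a} \<inter> {z. Im z > - a}" by auto
  then show ?thesis by (simp add: convex_Int convex_halfspace_Im_lt convex_halfspace_Im_gt)
qed

text \<open>
  The integral over the shifted space is holomorphic in the shift and, by translation invariance of
  Lebesgue measure, does not depend on its real part; hence it is constant.
\<close>

lemma integral_shifted_eq:
  assumes "\<bar>\<tau>\<bar> < pi" "A \<ge> 0"
  shows "(LINT l|lborel. shifted A B l 0) = (LINT l|lborel. shifted A B l (\<i> * of_real \<tau>))"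
proof -
  define F where "F z = (LINT l|lborel. shifted A B l z)" for z
  define S where "S = {z::complex. \<bar>Im z\<bar> < pi}"
  have S: "open S" "convex S" by (auto simp: S_def open_strip convex_strip)
  have "F holomorphic_on S"
    unfolding F_def
  proof (rule holomorphic_on_lebesgue_integral[OF S(1)])
    show "shifted A B l holomorphic_on S" for l unfolding S_def by (rule holomorphic_shifted)
    show "(\<lambda>l. shifted A B l z) \<in> borel_measurable lborel" if "z \<in> S" for z
      using borel_measurable_shifted that by (auto simp: S_def)
    fix z assume "z \<in> S"
    \<comment> \<open>Halfway between \<open>\<bar>Im z\<bar>\<close> and \<open>pi\<close>: the
      disc around \<open>z\<close> lies in a narrower closed strip, on which one majorant
      works.\<close>
    define \<tau> where "\<tau> = (\<bar>Im z\<bar> + pi) / 2"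
    define r where "r = (pi - \<bar>Im z\<bar>) / 2"
    have r: "r > 0" "0 \<le> \<tau>" "\<tau> < pi" "\<bar>Im z\<bar> + r = \<tau>" using \<open>z \<in> S\<close> by (auto simp: S_def r_def \<tau>_def field_simps)
    obtain M where M: "\<And>l w. \<lbrakk>\<bar>Im w\<bar> \<le> \<tau>; \<bar>Re w\<bar> \<le> \<bar>Re z\<bar> + r\<rbrakk> \<Longrightarrow>
        norm (shifted A B l w) \<le> M * (1 / (1 + (norm l)\<^sup>2) ^ 3)"
      using shifted_bound[OF r(2,3) assms(2)] by blast
    have w: "\<bar>Im w\<bar> \<le> \<tau> \<and> \<bar>Re w\<bar> \<le> \<bar>Re z\<bar> + r" if "w \<in> cball z r" for w
      using that abs_Re_le_cmod[of "w - z"] abs_Im_le_cmod[of "w - z"] r(4)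
      by (simp add: dist_norm norm_minus_commute) linarith
    show "\<exists>r>0. cball z r \<subseteq> S \<and> (\<exists>g. integrable lborel g \<and> (\<forall>l. \<forall>w\<in>cball z r. norm (shifted A B l w) \<le> g l))"
    proof (intro exI conjI allI ballI)
      show "cball z r \<subseteq> S" using w r(3) by (force simp: S_def)
      show "integrable lborel (\<lambda>l::real ^ 3. M * (1 / (1 + (norm l)\<^sup>2) ^ 3))"
        by (intro integrable_mult_right integrable_inverse_one_plus_norm_square_cubed)
      show "norm (shifted A B l w) \<le> M * (1 / (1 + (norm l)\<^sup>2) ^ 3)" if "w \<in> cball z r" for l w
        using M w[OF that] by blast
    qed (rule r(1))
  qed
  \<comment> \<open>A real shift only translates the second coordinate of \<open>l\<close>.\<close>
  have trans: "F (z + of_real a) = F z" if "z \<in> S" for z a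
  proof -
    have "shifted A B l (z + of_real a) = shifted A B (a *\<^sub>R axis 2 1 + 1 *\<^sub>R l) z" for l
    proof -
      define v where "v = a *\<^sub>R axis 2 1 + 1 *\<^sub>R l"
      have "v $ 1 = l $ 1" "v $ 2 = a + l $ 2" "v $ 3 = l $ 3" by (auto simp: v_def axis_def)
      then show ?thesis unfolding v_def[symmetric] shifted_def phase_def quad_def by (simp add: ac_simps)
    qed
    then show ?thesis unfolding F_def
      using lborel_integral_affine[of 1 "\<lambda>l. shifted A B l z" "a *\<^sub>R axis 2 1"] borel_measurable_shifted that
      by (simp add: S_def)
  qed
  have "(F has_field_derivative 0) (at z within S)" if zS: "z \<in> S" for z
  proof -
    obtain D where D: "(F has_field_derivative D) (at z)"
      using holomorphic_on_open[OF S(1), THEN iffD1, OF \<open>F holomorphic_on S\<close>, rule_format, OF zS]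
      by blast
    then have "((\<lambda>h. (F (z + h) - F z) / h) \<longlongrightarrow> D) (at 0)" by (simp add: DERIV_def)
    \<comment> \<open>The complex derivative may be computed along real increments, for which the
      difference quotients vanish.\<close>
    moreover have "filterlim (\<lambda>n. complex_of_real (1 / real (Suc n))) (at 0) sequentially"
      unfolding filterlim_at using tendsto_of_real[OF LIMSEQ_inverse_real_of_nat, where 'a = complex]
      by (auto simp: inverse_eq_divide simp del: of_nat_Suc of_real_divide)
    ultimately have "(\<lambda>n. (F (z + of_real (1 / real (Suc n))) - F z) / of_real (1 / real (Suc n))) \<longlonglongrightarrow> D"
      by (rule filterlim_compose)
    then have "(\<lambda>n::nat. 0) \<longlonglongrightarrow> D" unfolding trans[OF that] by simp
    then have "D = 0" by (simp add: LIMSEQ_const_iff)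
    then show ?thesis using D by (auto intro: DERIV_subset)
  qed
  then obtain c where "\<forall>z\<in>S. F z = c"
    using has_field_derivative_zero_constant[OF S(2)] by blast
  then have "F 0 = F (\<i> * of_real \<tau>)" using assms by (simp add: S_def)
  then show ?thesis by (simp add: F_def)
qed

lemma borel_measurable_sinh_cosh [measurable]:
  "(sinh :: real \<Rightarrow> real) \<in> borel_measurable borel" "(cosh :: real \<Rightarrow> real) \<in> borel_measurable borel"
  by (intro borel_measurable_continuous_onI continuous_intros)+

lemma heat_profile_eq_integral_shifted:
  fixes X h t2 :: real
  assumes "X > 0" "h > 0"
  shows "heat_profile ((1 / sqrt h) *\<^sub>R (X *\<^sub>R vector [1, 0, 0])) ((1 / h) *\<^sub>R vector [0, t2, 0])
    = (LINT l|lborel. shifted (X\<^sup>2 / (4 * h)) (t2 / h) l 0)"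
  unfolding heat_profile_def
proof (rule integral_cong_AE)
  show "(\<lambda>l. shifted (X\<^sup>2 / (4 * h)) (t2 / h) l 0) \<in> borel_measurable lborel"
    using borel_measurable_shifted[of 0] by simp
  \<comment> \<open>At \<open>l = 0\<close> the integrands differ: division by zero makes the first
    one \<open>0\<close>, whereas \<open>shc 0 = 1\<close>.\<close>
  have "AE l in lborel. (l :: real ^ 3) \<noteq> 0" by (rule AE_lborel_singleton)
  then show "AE l::real ^ 3 in lborel. of_real (norm l / sinh (norm l)) *
        exp (- (1 / 4) *
             (of_real ((norm ((1 / sqrt h) *\<^sub>R (X *\<^sub>R vector [1, 0, 0] :: real ^ 3)))\<^sup>2 +
                (norm l * (cosh (norm l) / sinh (norm l)) - 1) / (norm l)\<^sup>2 *
                ((norm l)\<^sup>2 * (norm ((1 / sqrt h) *\<^sub>R (X *\<^sub>R vector [1, 0, 0] :: real ^ 3)))\<^sup>2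
                  - (l \<bullet> ((1 / sqrt h) *\<^sub>R (X *\<^sub>R vector [1, 0, 0])))\<^sup>2))
              - 4 * \<i> * of_real (((1 / h) *\<^sub>R vector [0, t2, 0]) \<bullet> l)))
     = shifted (X\<^sup>2 / (4 * h)) (t2 / h) l 0"
  proof eventually_elim
    fix l :: "real ^ 3" assume "l \<noteq> 0"
    define n where "n = norm l"
    have n: "n > 0" "sinh n > 0" using \<open>l \<noteq> 0\<close> by (auto simp: n_def)
    have sh: "sinh (complex_of_real n) = of_real (sinh n)" "cosh (complex_of_real n) = of_real (cosh n)"
      by (simp_all add: sinh_def cosh_def exp_of_real[symmetric] scaleR_conv_of_real)
    have q: "quad l 0 = (complex_of_real n)\<^sup>2"
      by (simp add: quad_def n_def norm_square_real3 flip: of_real_power)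
    have "complex_of_real n * shc ((complex_of_real n)\<^sup>2) = of_real (sinh n)"
      by (simp add: shc_square sh)
    then have s: "shc (quad l 0) = of_real (sinh n / n)" unfolding q using n by (simp add: field_simps)
    have "(complex_of_real n)\<^sup>2 * cpsi ((complex_of_real n)\<^sup>2) = of_real (n * (cosh n / sinh n) - 1)"
      using cpsi_square[of "complex_of_real n"] n by (simp add: sh)
    then have p: "cpsi (quad l 0) = of_real ((n * (cosh n / sinh n) - 1) / n\<^sup>2)"
      unfolding q using n by (simp add: field_simps)
    have ph: "phase l 0 = of_real ((n * (cosh n / sinh n) - 1) / n\<^sup>2 * (n\<^sup>2 - (l $ 1)\<^sup>2))"
      unfolding phase_def p unfolding q by simp
    have nx: "(norm ((1 / sqrt h) *\<^sub>R (X *\<^sub>R vector [1, 0, 0] :: real ^ 3)))\<^sup>2 = X\<^sup>2 / h"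
      unfolding norm_square_real3 using assms by (simp add: power_divide power_mult_distrib)
    have lx: "(l \<bullet> ((1 / sqrt h) *\<^sub>R (X *\<^sub>R vector [1, 0, 0])))\<^sup>2 = (l $ 1)\<^sup>2 * (X\<^sup>2 / h)"
      using assms by (simp add: inner_vec_def sum_3 power_divide power_mult_distrib)
    have tl: "((1 / h) *\<^sub>R vector [0, t2, 0]) \<bullet> l = t2 / h * l $ 2" by (simp add: inner_vec_def sum_3)
    have e: "- (1 / 4) * (complex_of_real (X\<^sup>2 / h + u / n\<^sup>2 * (n\<^sup>2 * (X\<^sup>2 / h) - (l $ 1)\<^sup>2 * (X\<^sup>2 / h))) - 4 * \<i> * of_real (t2 / h * l $ 2))
       = - of_real (X\<^sup>2 / (4 * h)) * (1 + of_real (u / n\<^sup>2 * (n\<^sup>2 - (l $ 1)\<^sup>2))) + \<i> * of_real (t2 / h) * of_real (l $ 2)" for u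
      using assms n by (simp add: field_simps)
    show "of_real (norm l / sinh (norm l)) *
        exp (- (1 / 4) *
             (of_real ((norm ((1 / sqrt h) *\<^sub>R (X *\<^sub>R vector [1, 0, 0] :: real ^ 3)))\<^sup>2 +
                (norm l * (cosh (norm l) / sinh (norm l)) - 1) / (norm l)\<^sup>2 *
                ((norm l)\<^sup>2 * (norm ((1 / sqrt h) *\<^sub>R (X *\<^sub>R vector [1, 0, 0] :: real ^ 3)))\<^sup>2
                  - (l \<bullet> ((1 / sqrt h) *\<^sub>R (X *\<^sub>R vector [1, 0, 0])))\<^sup>2))
              - 4 * \<i> * of_real (((1 / h) *\<^sub>R vector [0, t2, 0]) \<bullet> l)))
       = shifted (X\<^sup>2 / (4 * h)) (t2 / h) l 0"
      unfolding n_def[symmetric] nx lx tl e shifted_def s ph by simp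
  qed
qed measurable

text \<open>Conjugating the integrand amounts to reflecting \<lambda>. This makes the relative error
  in the theorem a real number, although the integral at the saddle is complex by form.\<close>

lemma heat_profile_real: "heat_profile x t \<in> \<real>"
proof -
  define f :: "real ^ 3 \<Rightarrow> complex" where "f l = of_real (norm l / sinh (norm l)) *
        exp (- (1 / 4) *
             (of_real ((norm x)\<^sup>2 +
                (norm l * (cosh (norm l) / sinh (norm l)) - 1) / (norm l)\<^sup>2 *
                ((norm l)\<^sup>2 * (norm x)\<^sup>2 - (l \<bullet> x)\<^sup>2))
              - 4 * \<i> * of_real (t \<bullet> l)))" for l
  have [measurable]: "f \<in> borel_measurable borel" unfolding f_def by measurable
  have "cnj (f l) = f (- l)" for l by (simp add: f_def exp_cnj)
  moreover have "cnj (integral\<^sup>L lborel f) = (LINT l|lborel. cnj (f l))" by simp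
  ultimately have "cnj (integral\<^sup>L lborel f) = (LINT l|lborel. f (0 + (-1) *\<^sub>R l))" by simp
  also have "\<dots> = integral\<^sup>L lborel f"
    using lborel_integral_affine[of "-1" f 0] by simp
  finally have "integral\<^sup>L lborel f \<in> \<real>" by (simp add: Reals_cnj_iff)
  then show ?thesis by (simp add: heat_profile_def f_def[abs_def])
qed

section \<open>Laplace's method at the saddle point\<close>

text \<open>In use, \<open>n\<close> is the squared norm of the rescaled variable and
  \<open>s = k\<^sup>2 * n\<close> that of the original one. For small \<open>s\<close> the
  exponential decays in \<open>n\<close>; for \<open>s\<close> comparable with \<open>n\<close> the
  denominator does. The bound is free of \<open>s\<close>, hence uniform in
  \<open>k\<close>.\<close>

lemma exp_cubic_bound:
  fixes \<alpha> Q :: real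
  assumes "\<alpha> > 0" "Q > 0"
  obtains M where "M > 0" "\<And>n s. \<lbrakk>0 \<le> n; 0 \<le> s\<rbrakk> \<Longrightarrow> exp (- (\<alpha> * n / (Q + s))) / (1 + s) ^ 3 \<le> M / (1 + n) ^ 3"
proof -
  define \<beta> where "\<beta> = \<alpha> / (3 * (1 + Q))"
  define \<delta> where "\<delta> = min 1 \<beta>"
  have \<beta>: "\<beta> > 0" using assms by (simp add: \<beta>_def)
  then have \<delta>: "0 < \<delta>" "\<delta> \<le> 1" "\<delta> \<le> \<beta>" by (auto simp: \<delta>_def)
  show ?thesis
  proof (rule that[of "1 / \<delta> ^ 3"])
    fix n s :: real assume ns: "0 \<le> n" "0 \<le> s"
    define x where "x = \<alpha> * n / (Q + s)"
    have x: "x \<ge> 0" using assms ns by (simp add: x_def)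
    \<comment> \<open>The cube of \<open>1 + y \<le> exp y\<close> at \<open>y = x / 3\<close>, to
      match the cubic denominator.\<close>
    have "(1 + x / 3) ^ 3 \<le> exp (x / 3) ^ 3" using x exp_ge_add_one_self[of "x / 3"] by (intro power_mono) auto
    also have "\<dots> = exp x" by (simp add: exp_of_nat_mult[symmetric])
    finally have e: "(1 + x / 3) ^ 3 \<le> exp x" .
    have "\<delta> * (1 + n) \<le> (1 + x / 3) * (1 + s)"
    proof -
      have "(Q + s) * 1 \<le> (1 + Q) * (1 + s)" using assms ns by (simp add: algebra_simps)
      then have "1 / (1 + Q) \<le> (1 + s) / (Q + s)" using assms ns by (simp add: field_simps)
      then have "\<alpha> * n / 3 * (1 / (1 + Q)) \<le> \<alpha> * n / 3 * ((1 + s) / (Q + s))"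
        using assms ns by (intro mult_left_mono) auto
      then have "\<beta> * n \<le> x / 3 * (1 + s)" by (simp add: \<beta>_def x_def mult.commute)
      moreover have "\<delta> * n \<le> \<beta> * n" using \<delta> ns by (intro mult_right_mono) auto
      ultimately have "\<delta> + \<delta> * n \<le> 1 + s + x / 3 * (1 + s)" using \<delta> ns by argo
      then show ?thesis by (simp add: algebra_simps)
    qed
    then have "(\<delta> * (1 + n)) ^ 3 \<le> ((1 + x / 3) * (1 + s)) ^ 3" using \<delta> ns by (intro power_mono) auto
    also have "\<dots> \<le> exp x * (1 + s) ^ 3" unfolding power_mult_distrib using e ns by (intro mult_right_mono) auto
    finally have *: "(\<delta> * (1 + n)) ^ 3 \<le> exp x * (1 + s) ^ 3" .
    have "exp (- x) / (1 + s) ^ 3 = 1 / (exp x * (1 + s) ^ 3)" by (simp add: exp_minus field_simps)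
    also have "\<dots> \<le> 1 / (\<delta> * (1 + n)) ^ 3"
      using * \<delta> ns by (intro divide_left_mono mult_pos_pos) auto
    finally show "exp (- (\<alpha> * n / (Q + s))) / (1 + s) ^ 3 \<le> 1 / \<delta> ^ 3 / (1 + n) ^ 3"
      by (simp add: x_def power_mult_distrib)
  qed (use \<delta> in simp)
qed

lemma cpsi_neg_square:
  assumes "\<zeta> \<noteq> 0" "norm \<zeta> < pi"
  shows "- (\<zeta>\<^sup>2) * cpsi (- (\<zeta>\<^sup>2)) = \<zeta> * cos \<zeta> / sin \<zeta> - 1" and "sin \<zeta> \<noteq> 0"
    and "- (pi\<^sup>2) < Re (- (\<zeta>\<^sup>2))" and "shc (- (\<zeta>\<^sup>2)) = sin \<zeta> / \<zeta>"
proof -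
  have sq: "(\<i> * \<zeta>)\<^sup>2 = - (\<zeta>\<^sup>2)" by (simp add: power_mult_distrib)
  have "Re (\<zeta>\<^sup>2) \<le> norm (\<zeta>\<^sup>2)" by (rule complex_Re_le_cmod)
  also have "\<dots> < pi\<^sup>2" using assms unfolding norm_power by (intro power_strict_mono) auto
  finally show gt: "- (pi\<^sup>2) < Re (- (\<zeta>\<^sup>2))" by simp
  have "\<i> * \<zeta> * shc ((\<i> * \<zeta>)\<^sup>2) = sinh (\<i> * \<zeta>)" by (rule shc_square)
  then have "- \<i> * (\<i> * \<zeta> * shc (- (\<zeta>\<^sup>2))) = sin \<zeta>" unfolding sq sin_conv_sinh by simp
  moreover have "- \<i> * (\<i> * \<zeta> * shc (- (\<zeta>\<^sup>2))) = \<zeta> * shc (- (\<zeta>\<^sup>2))" by (simp flip: mult.assoc)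
  ultimately have s: "\<zeta> * shc (- (\<zeta>\<^sup>2)) = sin \<zeta>" by simp
  then show "sin \<zeta> \<noteq> 0" using shc_nonzero[OF gt] assms by (metis mult_eq_0_iff)
  show "shc (- (\<zeta>\<^sup>2)) = sin \<zeta> / \<zeta>" using s assms by (simp add: field_simps)
  have sh: "sinh (\<i> * \<zeta>) = \<i> * sin \<zeta>" and ch: "cosh (\<i> * \<zeta>) = cos \<zeta>"
    by (simp_all add: sinh_conv_sin cosh_conv_cos)
  show "- (\<zeta>\<^sup>2) * cpsi (- (\<zeta>\<^sup>2)) = \<zeta> * cos \<zeta> / sin \<zeta> - 1"
    using cpsi_square[of "\<i> * \<zeta>"] \<open>sin \<zeta> \<noteq> 0\<close> unfolding sq sh ch by simp
qed

lemma holomorphic_Taylor_2: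
  assumes "open S" "f holomorphic_on S" "w \<in> S"
  obtains B \<rho> where "\<rho> > 0" "\<And>z. norm (z - w) < \<rho> \<Longrightarrow>
     norm (f z - (f w + deriv f w * (z - w) + deriv (deriv f) w * (z - w)\<^sup>2 / 2)) \<le> B * norm (z - w) ^ 3"
proof -
  obtain \<rho> where \<rho>: "\<rho> > 0" "cball w \<rho> \<subseteq> S" using assms open_contains_cball by blast
  have hol: "(deriv ^^ i) f holomorphic_on S" for i using assms by (intro holomorphic_higher_deriv) auto
  have "compact ((deriv ^^ 3) f ` cball w \<rho>)"
    using hol \<rho> by (intro compact_continuous_image holomorphic_on_imp_continuous_on) (auto intro: holomorphic_on_subset)
  then obtain B where B: "\<And>z. z \<in> cball w \<rho> \<Longrightarrow> norm ((deriv ^^ 3) f z) \<le> B"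
    using compact_imp_bounded bounded_iff by (metis imageI)
  show ?thesis
  proof (rule that[OF \<rho>(1)])
    fix z assume z: "norm (z - w) < \<rho>"
    have "norm ((deriv ^^ 0) f z - (\<Sum>i\<le>2. (deriv ^^ i) f w * (z - w) ^ i / fact i)) \<le> B * norm (z - w) ^ Suc 2 / fact 2"
    proof (rule complex_Taylor[of "cball w \<rho>"])
      show "((deriv ^^ i) f has_field_derivative (deriv ^^ Suc i) f x) (at x within cball w \<rho>)" if "x \<in> cball w \<rho>" for i x
        using holomorphic_derivI[OF hol[of i] assms(1), of x "cball w \<rho>"] that \<rho> by auto
      show "norm ((deriv ^^ Suc 2) f x) \<le> B" if "x \<in> cball w \<rho>" for x using B[OF that] by (simp add: numeral_3_eq_3 numeral_2_eq_2)
    qed (use z \<rho> in \<open>auto simp: dist_norm norm_minus_commute\<close>)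
    then show "norm (f z - (f w + deriv f w * (z - w) + deriv (deriv f) w * (z - w)\<^sup>2 / 2)) \<le> B / 2 * norm (z - w) ^ 3"
      by (simp add: numeral_2_eq_2 numeral_3_eq_3 fact_2)
  qed
qed

text \<open>At \<open>w = z\<^sup>2\<close> this is \<open>z * coth z - 1\<close>. The phase is
  \<open>gcpsi w\<close> minus \<open>(l $ 1)\<^sup>2 * cpsi w\<close>: the first part needs a
  second-order expansion, the second is already quadratic and needs only continuity.\<close>

definition gcpsi :: "complex \<Rightarrow> complex" where
  "gcpsi w = w * cpsi w"

lemma open_cpsi_domain: "open {w. - (pi\<^sup>2) < Re w}"
  by (simp add: open_halfspace_Re_gt)

lemma holomorphic_gcpsi: "gcpsi holomorphic_on {w. - (pi\<^sup>2) < Re w}"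
  unfolding gcpsi_def[abs_def] by (intro holomorphic_intros holomorphic_cpsi)

text \<open>Differentiating \<open>gcpsi (- (\<zeta>\<^sup>2)) = \<zeta> * cot \<zeta> - 1\<close>
  once gives \<open>- mu\<close> at \<open>\<zeta> = r\<close>, which makes \<open>r\<close> the
  saddle; twice gives \<open>- 2\<close> times the second expression. That expression is half the
  derivative of \<open>mu\<close> and the curvature along the shift.\<close>

lemma gcpsi_derivs:
  assumes "0 < r" "r < pi"
  shows "deriv gcpsi (- (of_real r)\<^sup>2) = of_real (mu r / (2 * r))"
    and "deriv gcpsi (- (of_real r)\<^sup>2) - 2 * (of_real r)\<^sup>2 * deriv (deriv gcpsi) (- (of_real r)\<^sup>2)
           = of_real ((1 - r * cot r) / (sin r)\<^sup>2)"
proof -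
  define H where "H = {w. - (pi\<^sup>2) < Re w}"
  \<comment> \<open>This radius keeps \<open>\<zeta>\<close> away from \<open>0\<close> and of
    modulus below \<open>pi\<close>.\<close>
  define U where "U = ball (complex_of_real r) (min r (pi - r))"
  have U: "open U" "of_real r \<in> U" using assms by (auto simp: U_def)
  have inU: "\<zeta> \<noteq> 0 \<and> norm \<zeta> < pi" if "\<zeta> \<in> U" for \<zeta>
  proof -
    have "norm (of_real r - \<zeta>) < min r (pi - r)" using that by (simp add: U_def dist_norm)
    then show ?thesis using norm_triangle_ineq2[of \<zeta> "of_real r"] assms by (auto simp: norm_minus_commute)
  qed
  have cu: "- (\<zeta>\<^sup>2) * cpsi (- (\<zeta>\<^sup>2)) = \<zeta> * cos \<zeta> / sin \<zeta> - 1" "sin \<zeta> \<noteq> 0" "- (pi\<^sup>2) < Re (- (\<zeta>\<^sup>2))"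
    if "\<zeta> \<in> U" for \<zeta>
    using cpsi_neg_square[of \<zeta>] inU[OF that] by blast+
  have hol: "gcpsi holomorphic_on H" "deriv gcpsi holomorphic_on H"
    unfolding H_def by (auto intro!: holomorphic_gcpsi holomorphic_deriv open_cpsi_domain)
  have H: "open H" unfolding H_def by (rule open_cpsi_domain)
  have mem: "- (\<zeta>\<^sup>2) \<in> H" if "\<zeta> \<in> U" for \<zeta> using cu(3)[OF that] by (simp add: H_def)
  have D1: "- (2 * \<zeta>) * deriv gcpsi (- (\<zeta>\<^sup>2)) = cos \<zeta> / sin \<zeta> - \<zeta> / (sin \<zeta>)\<^sup>2" if "\<zeta> \<in> U" for \<zeta>
  proof -
    have "((\<lambda>\<zeta>. gcpsi (- (\<zeta>\<^sup>2))) has_field_derivative deriv gcpsi (- (\<zeta>\<^sup>2)) * (- (2 * \<zeta>))) (at \<zeta>)"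
      by (rule DERIV_chain2[where f = gcpsi and g = "\<lambda>\<zeta>. - (\<zeta>\<^sup>2)", OF holomorphic_derivI[OF hol(1) H mem[OF that]]])
        (auto intro!: derivative_eq_intros)
    moreover have "((\<lambda>\<zeta>. gcpsi (- (\<zeta>\<^sup>2))) has_field_derivative (cos \<zeta> / sin \<zeta> - \<zeta> / (sin \<zeta>)\<^sup>2)) (at \<zeta>)"
    proof (rule has_field_derivative_transform_within_open[OF _ U(1) that])
      have D: "((\<lambda>\<zeta>. \<zeta> * cos \<zeta> / sin \<zeta> - 1) has_field_derivative
         ((1 * cos \<zeta> + (- sin \<zeta>) * \<zeta>) * sin \<zeta> - (\<zeta> * cos \<zeta>) * cos \<zeta>) / (sin \<zeta> * sin \<zeta>) - 0) (at \<zeta>)"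
        using cu(2)[OF that] by (intro DERIV_diff DERIV_divide DERIV_mult DERIV_ident DERIV_cos DERIV_sin DERIV_const)
      have alg: "((1 * C + (- s) * \<zeta>) * s - (\<zeta> * C) * C) / (s * s) - 0 = C / s - \<zeta> / s\<^sup>2"
        if "s \<noteq> 0" "s\<^sup>2 + C\<^sup>2 = 1" for s C :: complex
      proof -
        have "(1 * C + (- s) * \<zeta>) * s - (\<zeta> * C) * C = C * s - \<zeta> * (s\<^sup>2 + C\<^sup>2)" by (simp add: algebra_simps power2_eq_square)
        then show ?thesis using that by (simp add: diff_divide_distrib power2_eq_square)
      qed
      show "((\<lambda>\<zeta>. \<zeta> * cos \<zeta> / sin \<zeta> - 1) has_field_derivative (cos \<zeta> / sin \<zeta> - \<zeta> / (sin \<zeta>)\<^sup>2)) (at \<zeta>)"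
        using D unfolding alg[OF cu(2)[OF that] sin_cos_squared_add] .
      show "y * cos y / sin y - 1 = gcpsi (- y\<^sup>2)" if "y \<in> U" for y
        using cu(1)[OF that] by (simp add: gcpsi_def)
    qed
    ultimately show ?thesis using DERIV_unique by (metis mult.commute)
  qed
  define R where "R = complex_of_real r"
  have RU: "R \<in> U" using U by (simp add: R_def)
  have sR: "sin R = of_real (sin r)" "cos R = of_real (cos r)" by (simp_all add: R_def sin_of_real cos_of_real)
  have s: "sin r > 0" using assms by (rule sin_gt_zero)
  have G1: "- (2 * R) * deriv gcpsi (- (R\<^sup>2)) = - of_real (mu r)"
    unfolding D1[OF RU] sR mu_eq[OF less_imp_neq[OF s, THEN not_sym]] cot_def by (simp add: R_def)
  then show 1: "deriv gcpsi (- (of_real r)\<^sup>2) = of_real (mu r / (2 * r))"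
    using assms unfolding R_def by (simp add: field_simps)
  define G2 where "G2 = deriv (deriv gcpsi) (- (R\<^sup>2))"
  have d2: "((\<lambda>\<zeta>. deriv gcpsi (- (\<zeta>\<^sup>2))) has_field_derivative G2 * (- (2 * R))) (at R)"
    unfolding G2_def by (rule DERIV_chain2[where f = "deriv gcpsi" and g = "\<lambda>\<zeta>. - (\<zeta>\<^sup>2)", OF holomorphic_derivI[OF hol(2) H mem[OF RU]]])
        (auto intro!: derivative_eq_intros)
  have "((\<lambda>\<zeta>. - (2 * \<zeta>) * deriv gcpsi (- (\<zeta>\<^sup>2))) has_field_derivative
      - (2 * 1) * deriv gcpsi (- (R\<^sup>2)) + (G2 * (- (2 * R))) * (- (2 * R))) (at R)"
    by (intro DERIV_mult d2 DERIV_minus DERIV_cmult DERIV_ident)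
  then have "((\<lambda>\<zeta>. cos \<zeta> / sin \<zeta> - \<zeta> / (sin \<zeta>)\<^sup>2) has_field_derivative
      - (2 * 1) * deriv gcpsi (- (R\<^sup>2)) + (G2 * (- (2 * R))) * (- (2 * R))) (at R)"
    by (rule has_field_derivative_transform_within_open[OF _ U(1) RU]) (rule D1)
  moreover have "((\<lambda>\<zeta>. cos \<zeta> / sin \<zeta> - \<zeta> / (sin \<zeta>)\<^sup>2) has_field_derivative
     ((- sin R) * sin R - cos R * cos R) / (sin R * sin R) - (1 * (sin R)\<^sup>2 - R * (2 * sin R * cos R)) / ((sin R)\<^sup>2 * (sin R)\<^sup>2)) (at R)"
    using cu(2)[OF RU] by (intro DERIV_diff DERIV_divide DERIV_ident DERIV_cos DERIV_sin)
      (auto intro!: derivative_eq_intros)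
  ultimately have "- (2 * 1) * deriv gcpsi (- (R\<^sup>2)) + (G2 * (- (2 * R))) * (- (2 * R)) =
     ((- sin R) * sin R - cos R * cos R) / (sin R * sin R) - (1 * (sin R)\<^sup>2 - R * (2 * sin R * cos R)) / ((sin R)\<^sup>2 * (sin R)\<^sup>2)"
    by (rule DERIV_unique)
  also have "(- sin R) * sin R - cos R * cos R = - 1"
    using sin_cos_squared_add[of R] by (simp add: power2_eq_square) (metis add.inverse_distrib_swap add.commute minus_add_distrib uminus_add_conv_diff)
  also have "- 1 / (sin R * sin R) - (1 * (sin R)\<^sup>2 - R * (2 * sin R * cos R)) / ((sin R)\<^sup>2 * (sin R)\<^sup>2)
      = - 2 * of_real ((1 - r * cot r) / (sin r)\<^sup>2)"
    unfolding sR using s by (simp add: R_def cot_def field_simps power2_eq_square)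
  finally have E: "- (2 * 1) * deriv gcpsi (- (R\<^sup>2)) + (G2 * (- (2 * R))) * (- (2 * R))
      = - 2 * of_real ((1 - r * cot r) / (sin r)\<^sup>2)" .
  have "- 2 * (deriv gcpsi (- (R\<^sup>2)) - 2 * R\<^sup>2 * G2) = - (2 * 1) * deriv gcpsi (- (R\<^sup>2)) + (G2 * (- (2 * R))) * (- (2 * R))"
    by (simp add: power2_eq_square algebra_simps)
  then have "- 2 * (deriv gcpsi (- (R\<^sup>2)) - 2 * R\<^sup>2 * G2) = - 2 * of_real ((1 - r * cot r) / (sin r)\<^sup>2)"
    unfolding E .
  then have "deriv gcpsi (- (R\<^sup>2)) - 2 * R\<^sup>2 * G2 = of_real ((1 - r * cot r) / (sin r)\<^sup>2)"
    by (subst (asm) mult_left_cancel) auto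
  then show "deriv gcpsi (- (of_real r)\<^sup>2) - 2 * (of_real r)\<^sup>2 * deriv (deriv gcpsi) (- (of_real r)\<^sup>2)
           = of_real ((1 - r * cot r) / (sin r)\<^sup>2)"
    unfolding G2_def R_def .
qed

section \<open>Quadratic expansion of the exponent at the saddle\<close>

lemma isCont_shc: "isCont shc w"
  using holomorphic_on_imp_continuous_on[OF holomorphic_shc[of UNIV]]
  by (simp add: continuous_on_eq_continuous_at)

lemma quad_scaleR:
  "quad (k *\<^sub>R y) (\<i> * of_real r) = - (of_real r)\<^sup>2 + of_real k * (of_real (k * (norm y)\<^sup>2) + 2 * \<i> * of_real (r * y $ 2))"
  unfolding norm_square_real3 by (simp add: quad_def power_mult_distrib algebra_simps power2_eq_square)

lemma cpsi_at_saddle: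
  assumes "0 < r" "r < pi"
  shows "cpsi (- (of_real r)\<^sup>2) = of_real (1 / Upsilon r)"
    and "gcpsi (- (of_real r)\<^sup>2) = of_real (r * cot r - 1)"
    and "shc (- (of_real r)\<^sup>2) = of_real (sin r / r)"
    and "- (pi\<^sup>2) < Re (- (complex_of_real r)\<^sup>2)"
proof -
  have *: "complex_of_real r \<noteq> 0" "norm (complex_of_real r) < pi" using assms by auto
  show 2: "gcpsi (- (of_real r)\<^sup>2) = of_real (r * cot r - 1)"
    using cpsi_neg_square(1)[OF *] by (simp add: gcpsi_def cot_def sin_of_real cos_of_real)
  moreover have "- (of_real r)\<^sup>2 * complex_of_real (1 / Upsilon r) = of_real (- (r\<^sup>2) * (1 / Upsilon r))" by simp
  moreover have "- (r\<^sup>2) * (1 / Upsilon r) = r * cot r - 1"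
    using assms one_minus_r_cot_pos[OF assms] by (simp add: Upsilon_def)
  ultimately have "- (of_real r)\<^sup>2 * cpsi (- (of_real r)\<^sup>2) = - (of_real r)\<^sup>2 * complex_of_real (1 / Upsilon r)"
    unfolding gcpsi_def by metis
  then show "cpsi (- (of_real r)\<^sup>2) = of_real (1 / Upsilon r)"
    by (subst (asm) mult_left_cancel) (use assms in auto)
  show "shc (- (of_real r)\<^sup>2) = of_real (sin r / r)"
    using cpsi_neg_square(4)[OF *] by (simp add: sin_of_real)
  show "- (pi\<^sup>2) < Re (- (complex_of_real r)\<^sup>2)" by (rule cpsi_neg_square(3)[OF *])
qed

text \<open>
  The exponent at the scaled and shifted point \<open>k * y\<close>, with its value and its linear part at the
  saddle point removed; \<open>k\<close> plays the role of \<open>sqrt h\<close>.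
\<close>

definition saddle_phase :: "real \<Rightarrow> real \<Rightarrow> real ^ 3 \<Rightarrow> complex" where
  "saddle_phase r k y =
     (phase (k *\<^sub>R y) (\<i> * of_real r) - of_real (r * cot r - 1) - \<i> * of_real (mu r * k * y $ 2)) / of_real (k\<^sup>2)"

text \<open>Taylor expansion of \<open>gcpsi\<close> at \<open>w0\<close>, where
  \<open>w k - w0 = k * \<kappa> k\<close> and \<open>\<kappa> k\<close> tends to
  \<open>2 * \<i> * r * y $ 2\<close>. The remainder is cubic in \<open>k\<close> and disappears
  after division by \<open>k\<^sup>2\<close>; the square of \<open>\<kappa>\<close> alters only the
  coefficient of \<open>(y $ 2)\<^sup>2\<close>, so the limiting form is diagonal.\<close>

lemma saddle_phase_tendsto:
  assumes r: "0 < r" "r < pi"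
  shows "((\<lambda>k. saddle_phase r k y) \<longlongrightarrow>
     of_real ((mu r / (2 * r) - 1 / Upsilon r) * (y $ 1)\<^sup>2 + (1 - r * cot r) / (sin r)\<^sup>2 * (y $ 2)\<^sup>2
        + mu r / (2 * r) * (y $ 3)\<^sup>2)) (at_right 0)"
proof -
  define w0 where "w0 = - (complex_of_real r)\<^sup>2"
  define \<kappa> where "\<kappa> k = of_real (k * (norm y)\<^sup>2) + 2 * \<i> * of_real (r * y $ 2)" for k
  define w where "w k = w0 + of_real k * \<kappa> k" for k
  define G1 where "G1 = deriv gcpsi w0"
  define G2 where "G2 = deriv (deriv gcpsi) w0"
  define Rem where "Rem k = gcpsi (w k) - (gcpsi w0 + G1 * (w k - w0) + G2 * (w k - w0)\<^sup>2 / 2)" for k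
  note sad = cpsi_at_saddle[OF r, folded w0_def]
  have G: "G1 = of_real (mu r / (2 * r))" "G1 - 2 * (of_real r)\<^sup>2 * G2 = of_real ((1 - r * cot r) / (sin r)\<^sup>2)"
    using gcpsi_derivs[OF r] unfolding G1_def G2_def w0_def by auto
  have quad: "quad (k *\<^sub>R y) (\<i> * of_real r) = w k" for k
    unfolding quad_scaleR w_def w0_def \<kappa>_def ..
  have \<kappa>: "(\<kappa> \<longlongrightarrow> 2 * \<i> * of_real (r * y $ 2)) (at_right 0)"
  proof -
    have "(\<kappa> \<longlongrightarrow> of_real (0 * (norm y)\<^sup>2) + 2 * \<i> * of_real (r * y $ 2)) (at_right 0)"
      unfolding \<kappa>_def by (intro tendsto_intros)
    then show ?thesis by simp
  qed
  have kl: "((\<lambda>k. complex_of_real k) \<longlongrightarrow> 0) (at_right 0)"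
    using tendsto_of_real[of "\<lambda>k::real. k" 0 "at_right 0", where 'a = complex] by simp
  have "(w \<longlongrightarrow> w0 + 0 * (2 * \<i> * of_real (r * y $ 2))) (at_right 0)"
    unfolding w_def by (intro tendsto_intros \<kappa> kl)
  then have w: "(w \<longlongrightarrow> w0) (at_right 0)" by simp
  have "((\<lambda>k. cpsi (w k)) \<longlongrightarrow> cpsi w0) (at_right 0)"
  proof (rule isCont_tendsto_compose[OF _ w])
    show "isCont cpsi w0"
      using holomorphic_on_imp_continuous_on[OF holomorphic_cpsi] open_cpsi_domain sad(4)
      by (simp add: continuous_on_eq_continuous_at)
  qed
  then have c: "((\<lambda>k. cpsi (w k)) \<longlongrightarrow> of_real (1 / Upsilon r)) (at_right 0)" unfolding sad(1) .
  have mem: "w0 \<in> {w. - (pi\<^sup>2) < Re w}" using sad(4) by simp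
  obtain B \<rho> where B: "\<rho> > 0" "\<And>z. norm (z - w0) < \<rho> \<Longrightarrow>
     norm (gcpsi z - (gcpsi w0 + G1 * (z - w0) + G2 * (z - w0)\<^sup>2 / 2)) \<le> B * norm (z - w0) ^ 3"
    using holomorphic_Taylor_2[OF open_cpsi_domain holomorphic_gcpsi mem, folded G1_def G2_def] by blast
  have "((\<lambda>k. Rem k / of_real (k\<^sup>2)) \<longlongrightarrow> 0) (at_right 0)"
  proof (rule Lim_null_comparison)
    have "eventually (\<lambda>k. norm (w k - w0) < \<rho>) (at_right 0)"
      using tendstoD[OF w B(1)] by (simp add: dist_norm)
    moreover have "eventually (\<lambda>k. k > 0) (at_right (0::real))" by (rule eventually_at_right_less)
    ultimately show "eventually (\<lambda>k. norm (Rem k / of_real (k\<^sup>2)) \<le> B * (k * norm (\<kappa> k) ^ 3)) (at_right 0)"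
    proof eventually_elim
      case (elim k)
      have "norm (Rem k) \<le> B * norm (w k - w0) ^ 3" unfolding Rem_def by (rule B(2)[OF elim(1)])
      also have "norm (w k - w0) = k * norm (\<kappa> k)" using elim by (simp add: w_def norm_mult)
      finally have "norm (Rem k) / k\<^sup>2 \<le> B * (k * norm (\<kappa> k)) ^ 3 / k\<^sup>2" by (rule divide_right_mono) simp
      also have "\<dots> = B * (k * norm (\<kappa> k) ^ 3)" using elim by (simp add: power2_eq_square power3_eq_cube)
      finally show ?case by (simp add: norm_divide norm_power)
    qed
    have "((\<lambda>k. B * (k * norm (\<kappa> k) ^ 3)) \<longlongrightarrow> B * (0 * norm (2 * \<i> * of_real (r * y $ 2)) ^ 3)) (at_right 0)"
      by (intro tendsto_intros \<kappa>)
    then show "((\<lambda>k. B * (k * norm (\<kappa> k) ^ 3)) \<longlongrightarrow> 0) (at_right 0)" by simp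
  qed
  then have "((\<lambda>k. Rem k / of_real (k\<^sup>2) + G1 * of_real ((norm y)\<^sup>2) + G2 * (\<kappa> k)\<^sup>2 / 2 - of_real ((y $ 1)\<^sup>2) * cpsi (w k))
     \<longlongrightarrow> 0 + G1 * of_real ((norm y)\<^sup>2) + G2 * (2 * \<i> * of_real (r * y $ 2))\<^sup>2 / 2 - of_real ((y $ 1)\<^sup>2) * of_real (1 / Upsilon r)) (at_right 0)"
    by (intro tendsto_intros \<kappa> c) auto
  also have "0 + G1 * of_real ((norm y)\<^sup>2) + G2 * (2 * \<i> * of_real (r * y $ 2))\<^sup>2 / 2 - of_real ((y $ 1)\<^sup>2) * of_real (1 / Upsilon r)
     = G1 * (of_real (y $ 1))\<^sup>2 + (G1 - 2 * (of_real r)\<^sup>2 * G2) * (of_real (y $ 2))\<^sup>2 + G1 * (of_real (y $ 3))\<^sup>2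
       - of_real ((y $ 1)\<^sup>2) * of_real (1 / Upsilon r)"
    by (simp add: norm_square_real3 power_mult_distrib algebra_simps)
  also have "\<dots> = of_real ((mu r / (2 * r) - 1 / Upsilon r) * (y $ 1)\<^sup>2 + (1 - r * cot r) / (sin r)\<^sup>2 * (y $ 2)\<^sup>2
        + mu r / (2 * r) * (y $ 3)\<^sup>2)"
    unfolding G(2) unfolding G(1) by (simp add: algebra_simps)
  finally show ?thesis
  proof (rule Lim_transform_eventually)
    show "eventually (\<lambda>k. Rem k / of_real (k\<^sup>2) + G1 * of_real ((norm y)\<^sup>2) + G2 * (\<kappa> k)\<^sup>2 / 2 - of_real ((y $ 1)\<^sup>2) * cpsi (w k)
        = saddle_phase r k y) (at_right 0)"
      using eventually_at_right_less[of "0::real"]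
    proof eventually_elim
      case (elim k)
      have wk: "w k - w0 = of_real k * \<kappa> k" by (simp add: w_def)
      have "phase (k *\<^sub>R y) (\<i> * of_real r) = gcpsi (w k) - of_real ((k * y $ 1)\<^sup>2) * cpsi (w k)"
        unfolding phase_def quad by (simp add: gcpsi_def algebra_simps)
      moreover have "gcpsi (w k) = Rem k + of_real (r * cot r - 1) + G1 * (of_real k * \<kappa> k) + G2 * (of_real k * \<kappa> k)\<^sup>2 / 2"
        unfolding Rem_def wk sad(2) by simp
      \<comment> \<open>Stationarity: the part of first order in \<open>k\<close> is exactly the
        linear term subtracted in \<open>saddle_phase\<close>, because
        \<open>G1 = mu r / (2 * r)\<close>.\<close>
      moreover have "G1 * (of_real k * \<kappa> k) = of_real (k\<^sup>2) * (G1 * of_real ((norm y)\<^sup>2)) + \<i> * of_real (mu r * k * y $ 2)"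
        unfolding G(1) \<kappa>_def using r by (simp add: field_simps power2_eq_square)
      ultimately have "phase (k *\<^sub>R y) (\<i> * of_real r) - of_real (r * cot r - 1) - \<i> * of_real (mu r * k * y $ 2)
         = Rem k + of_real (k\<^sup>2) * (G1 * of_real ((norm y)\<^sup>2)) + of_real (k\<^sup>2) * (G2 * (\<kappa> k)\<^sup>2 / 2)
            - of_real (k\<^sup>2) * (of_real ((y $ 1)\<^sup>2) * cpsi (w k))"
        by (simp add: power_mult_distrib algebra_simps)
      then show ?case unfolding saddle_phase_def using elim
        by (simp add: add_divide_distrib diff_divide_distrib)
    qed
  qed
qed

text \<open>Here the gap of \<open>Re_cpsi_ge\<close> is kept: divided by \<open>k\<^sup>2\<close>
  it yields the exponential decay that \<open>exp_cubic_bound\<close> merges with that of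
  \<open>1 / shc\<close>, uniformly in \<open>k\<close>.\<close>

lemma saddle_integrand_bound:
  assumes r: "0 < r" "r < pi" and q: "q > 0"
  obtains M where "\<And>k y. k > 0 \<Longrightarrow>
    norm (exp (- of_real q * saddle_phase r k y) / shc (quad (k *\<^sub>R y) (\<i> * of_real r))) \<le> M * (1 / (1 + (norm y)\<^sup>2) ^ 3)"
proof -
  define \<sigma> where "\<sigma> = r\<^sup>2"
  have \<sigma>: "0 < \<sigma>" "\<sigma> < pi\<^sup>2" using r power_strict_mono[of r pi 2] by (auto simp: \<sigma>_def)
  obtain c where c: "c > 0" "\<And>w s. \<lbrakk>0 \<le> s; s - \<sigma> \<le> Re w\<rbrakk> \<Longrightarrow> c * (1 + s) ^ 3 \<le> norm (shc w)"
    using shc_lower_bound[of \<sigma>] \<sigma> by auto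
  define Q where "Q = pi\<^sup>2 - \<sigma>"
  define \<alpha> where "\<alpha> = q * (2 * \<sigma> / Q)"
  have Q: "Q > 0" "\<alpha> > 0" using \<sigma> q by (auto simp: Q_def \<alpha>_def)
  obtain M where M: "M > 0" "\<And>n s. \<lbrakk>0 \<le> n; 0 \<le> s\<rbrakk> \<Longrightarrow> exp (- (\<alpha> * n / (Q + s))) / (1 + s) ^ 3 \<le> M / (1 + n) ^ 3"
    using exp_cubic_bound[OF Q(2,1)] by blast
  show ?thesis
  proof (rule that[of "M / c"])
    fix k :: real and y :: "real ^ 3" assume k: "k > 0"
    define n where "n = (norm y)\<^sup>2"
    define s where "s = k\<^sup>2 * n"
    have n: "0 \<le> n" "0 \<le> s" by (auto simp: n_def s_def)
    define w where "w = quad (k *\<^sub>R y) (\<i> * of_real r)"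
    have Rew: "Re w = s - \<sigma>"
      unfolding w_def Re_quad s_def n_def norm_square_real3 \<sigma>_def by (simp add: power_mult_distrib algebra_simps)
    have p: "(k * y $ 1)\<^sup>2 \<le> s" unfolding s_def n_def norm_square_real3 power_mult_distrib by (intro mult_left_mono) auto
    have "complex_of_real \<sigma> = (of_real r)\<^sup>2" by (simp add: \<sigma>_def)
    then have "cpsi (- of_real \<sigma>) = of_real (1 / Upsilon r)" using cpsi_at_saddle(1)[OF r] by simp
    then have "- \<sigma> * Re (cpsi (- of_real \<sigma>)) = r * cot r - 1"
      using r one_minus_r_cot_pos[OF r] by (simp add: Upsilon_def \<sigma>_def)
    then have "r * cot r - 1 + 2 * \<sigma> * s / (Q * (Q + s)) \<le> Re (cpsi w * (w - of_real ((k * y $ 1)\<^sup>2)))"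
      using Re_cpsi_ge[of \<sigma> "(k * y $ 1)\<^sup>2" s w] \<sigma> p Rew by (simp add: Q_def)
    then have ge: "2 * \<sigma> * s / (Q * (Q + s)) \<le> Re (phase (k *\<^sub>R y) (\<i> * of_real r)) - (r * cot r - 1)"
      by (simp add: phase_def w_def)
    have Re_div: "Re (z / of_real a) = Re z / a" for z a by simp
    have "Re (saddle_phase r k y) = (Re (phase (k *\<^sub>R y) (\<i> * of_real r)) - (r * cot r - 1)) / k\<^sup>2"
      unfolding saddle_phase_def Re_div by simp
    also have "\<dots> \<ge> 2 * \<sigma> * s / (Q * (Q + s)) / k\<^sup>2" using ge by (rule divide_right_mono) simp
    also have "2 * \<sigma> * s / (Q * (Q + s)) / k\<^sup>2 = 2 * \<sigma> / Q * (n / (Q + s))" using k by (simp add: s_def)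
    finally have "q * (2 * \<sigma> / Q * (n / (Q + s))) \<le> q * Re (saddle_phase r k y)" using q by (intro mult_left_mono) auto
    then have "\<alpha> * n / (Q + s) \<le> q * Re (saddle_phase r k y)" by (simp add: \<alpha>_def)
    then have e: "norm (exp (- of_real q * saddle_phase r k y)) \<le> exp (- (\<alpha> * n / (Q + s)))"
      unfolding norm_exp_eq_Re by simp
    have "c * (1 + s) ^ 3 > 0" using c n by simp
    then have "norm (exp (- of_real q * saddle_phase r k y)) / norm (shc w) \<le> exp (- (\<alpha> * n / (Q + s))) / (c * (1 + s) ^ 3)"
      using c(2)[OF n(2), of w] Rew e by (intro frac_le) auto
    also have "\<dots> = exp (- (\<alpha> * n / (Q + s))) / (1 + s) ^ 3 / c" by simp
    also have "\<dots> \<le> M / (1 + n) ^ 3 / c" using M(2)[OF n] c(1) by (intro divide_right_mono) auto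
    finally show "norm (exp (- of_real q * saddle_phase r k y) / shc (quad (k *\<^sub>R y) (\<i> * of_real r))) \<le> M / c * (1 / (1 + (norm y)\<^sup>2) ^ 3)"
      by (simp add: norm_divide w_def n_def mult.commute)
  qed
qed

text \<open>What remains of the heat profile after the factors \<open>h powr (3 / 2)\<close> and the
  Gaussian in the distance are split off; \<open>q\<close> is \<open>X\<^sup>2 / 4\<close> and
  \<open>k\<close> is \<open>sqrt h\<close>.\<close>

definition saddle_integral :: "real \<Rightarrow> real \<Rightarrow> real \<Rightarrow> complex" where
  "saddle_integral r q k = (LINT y|lborel. exp (- of_real q * saddle_phase r k y) / shc (quad (k *\<^sub>R y) (\<i> * of_real r)))"

text \<open>Dominated convergence to a Gaussian; the factor \<open>r / sin r\<close> is the value of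
  \<open>1 / shc\<close> at the saddle.\<close>

lemma saddle_integral_tendsto:
  assumes r: "0 < r" "r < pi" and q: "q > 0"
    and coeffs: "a = mu r / (2 * r) - 1 / Upsilon r" "b = (1 - r * cot r) / (sin r)\<^sup>2" "c = mu r / (2 * r)"
    and pos: "a > 0" "b > 0" "c > 0"
  shows "(saddle_integral r q \<longlongrightarrow> of_real (pi powr (3 / 2) / sqrt ((q * a) * (q * b) * (q * c)) * (r / sin r))) (at_right 0)"
proof -
  define f where "f k y = exp (- of_real q * saddle_phase r k y) / shc (quad (k *\<^sub>R y) (\<i> * of_real r))" for k y
  define g where "g y = complex_of_real (exp (- (q * a * (y $ 1)\<^sup>2 + q * b * (y $ 2)\<^sup>2 + q * c * (y $ 3)\<^sup>2)) * (r / sin r))"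
    for y :: "real ^ 3"
  obtain M where M: "\<And>k y. k > 0 \<Longrightarrow> norm (f k y) \<le> M * (1 / (1 + (norm y)\<^sup>2) ^ 3)"
    unfolding f_def using saddle_integrand_bound[OF r q] by blast
  have im: "\<bar>Im (\<i> * complex_of_real r)\<bar> < pi" using r by simp
  have meas: "f k \<in> borel_measurable borel" for k
  proof (rule borel_measurable_continuous_onI)
    have "continuous_on UNIV (\<lambda>y. phase (k *\<^sub>R y) (\<i> * of_real r))" "continuous_on UNIV (\<lambda>y. shc (quad (k *\<^sub>R y) (\<i> * of_real r)))"
      by (rule continuous_on_compose2[OF continuous_on_phase[OF im]] continuous_on_compose2[OF continuous_on_shc_quad[OF im]];
          auto intro!: continuous_intros)+
    \<comment> \<open>At \<open>k = 0\<close> the quotient in \<open>saddle_phase\<close> is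
      \<open>0\<close> by convention, so continuity holds there too.\<close>
    then show "continuous_on UNIV (f k)" unfolding f_def saddle_phase_def
      using shc_nonzero[OF Re_quad_gt[OF im]]
      by (cases "k = 0") (auto intro!: continuous_intros)
  qed
  have lim: "((\<lambda>k. f k y) \<longlongrightarrow> g y) (at_right 0)" for y
  proof -
    have "((\<lambda>k. quad (k *\<^sub>R y) (\<i> * of_real r)) \<longlongrightarrow> quad (0 *\<^sub>R y) (\<i> * of_real r)) (at_right 0)"
      unfolding quad_def by (intro tendsto_intros)
    then have "((\<lambda>k. quad (k *\<^sub>R y) (\<i> * of_real r)) \<longlongrightarrow> - (of_real r)\<^sup>2) (at_right 0)"
      by (simp add: quad_def power_mult_distrib)
    then have "((\<lambda>k. shc (quad (k *\<^sub>R y) (\<i> * of_real r))) \<longlongrightarrow> shc (- (of_real r)\<^sup>2)) (at_right 0)"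
      by (rule isCont_tendsto_compose[OF isCont_shc])
    then have s: "((\<lambda>k. shc (quad (k *\<^sub>R y) (\<i> * of_real r))) \<longlongrightarrow> of_real (sin r / r)) (at_right 0)"
      unfolding cpsi_at_saddle(3)[OF r] .
    have "sin r > 0" using r by (rule sin_gt_zero)
    then have "((\<lambda>k. f k y) \<longlongrightarrow> exp (- of_real q * of_real (a * (y $ 1)\<^sup>2 + b * (y $ 2)\<^sup>2 + c * (y $ 3)\<^sup>2)) / of_real (sin r / r)) (at_right 0)"
      unfolding f_def coeffs using r by (intro tendsto_intros saddle_phase_tendsto s) auto
    also have "exp (- of_real q * of_real (a * (y $ 1)\<^sup>2 + b * (y $ 2)\<^sup>2 + c * (y $ 3)\<^sup>2)) / of_real (sin r / r) = g y"
      unfolding g_def by (simp add: exp_of_real[symmetric] algebra_simps)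
    finally show ?thesis .
  qed
  have "(saddle_integral r q \<longlongrightarrow> integral\<^sup>L lborel g) (at_right 0)"
    unfolding tendsto_at_iff_sequentially comp_def saddle_integral_def f_def[symmetric]
  proof (intro allI impI)
    fix X :: "nat \<Rightarrow> real" assume X: "\<forall>i. X i \<in> {0<..} - {0}" "X \<longlonglongrightarrow> 0"
    have Xf: "filterlim X (at_right 0) sequentially"
    proof -
      have "X i \<noteq> 0 \<and> X i \<in> {0<..}" for i using spec[OF X(1), of i] by auto
      then show ?thesis unfolding filterlim_at using X(2) by simp
    qed
    show "(\<lambda>i. integral\<^sup>L lborel (f (X i))) \<longlonglongrightarrow> integral\<^sup>L lborel g"
    proof (rule integral_dominated_convergence)
      show "integrable lborel (\<lambda>y::real ^ 3. M * (1 / (1 + (norm y)\<^sup>2) ^ 3))"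
        by (intro integrable_mult_right integrable_inverse_one_plus_norm_square_cubed)
      show "AE y in lborel. (\<lambda>i. f (X i) y) \<longlonglongrightarrow> g y"
        by (intro AE_I2 filterlim_compose[OF lim Xf])
      show "AE y in lborel. norm (f (X i) y) \<le> M * (1 / (1 + (norm y)\<^sup>2) ^ 3)" for i
        using M X(1) by auto
      show "f (X i) \<in> borel_measurable lborel" for i using meas by simp
      show "g \<in> borel_measurable lborel" unfolding g_def by measurable
    qed
  qed
  moreover have "has_bochner_integral lborel g (of_real (pi powr (3 / 2) / sqrt ((q * a) * (q * b) * (q * c)) * (r / sin r)))"
    unfolding g_def using gaussian_integral_real3[of "q * a" "q * b" "q * c"] q pos
    by (intro has_bochner_integral_of_real has_bochner_integral_mult_left) auto
  ultimately show ?thesis by (simp add: has_bochner_integral_integral_eq)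
qed

section \<open>Assembly of the asymptotic formula\<close>

lemma heat_profile_eq_saddle_integral:
  assumes X: "X > 0" and h: "h > 0" and r: "0 < r" "r < pi" and t2: "t2 = X\<^sup>2 * mu r / 4"
  shows "heat_profile ((1 / sqrt h) *\<^sub>R (X *\<^sub>R vector [1, 0, 0])) ((1 / h) *\<^sub>R vector [0, t2, 0])
    = of_real (h powr (3 / 2) * exp (- (X * r / sin r)\<^sup>2 / (4 * h))) * saddle_integral r (X\<^sup>2 / 4) (sqrt h)"
proof -
  define A where "A = X\<^sup>2 / (4 * h)"
  define k where "k = sqrt h"
  have k: "k > 0" "k\<^sup>2 = h" using h by (auto simp: k_def)
  have A: "A \<ge> 0" "t2 / h = A * mu r" using X h by (auto simp: A_def t2)
  have s: "sin r > 0" using r by (rule sin_gt_zero)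
  have im: "\<bar>Im (\<i> * complex_of_real r)\<bar> < pi" using r by simp
  have "heat_profile ((1 / sqrt h) *\<^sub>R (X *\<^sub>R vector [1, 0, 0])) ((1 / h) *\<^sub>R vector [0, t2, 0])
     = (LINT l|lborel. shifted A (t2 / h) l (\<i> * of_real r))"
    unfolding heat_profile_eq_integral_shifted[OF X h] A_def[symmetric]
    using r A by (intro integral_shifted_eq) auto
  \<comment> \<open>Rescaling by \<open>k = sqrt h\<close> produces \<open>h powr (3 / 2)\<close>,
    which turns the prefactor \<open>h powr (- 9 / 2)\<close> into
    \<open>h powr (- 3)\<close>.\<close>
  also have "\<dots> = \<bar>k\<bar> ^ DIM(real ^ 3) *\<^sub>R (LINT y|lborel. shifted A (t2 / h) (0 + k *\<^sub>R y) (\<i> * of_real r))"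
    using k borel_measurable_shifted[OF im] by (intro lborel_integral_affine) auto
  also have "\<dots> = \<bar>k\<bar> ^ 3 *\<^sub>R (LINT y|lborel. of_real (exp (- (X * r / sin r)\<^sup>2 / (4 * h))) *
       (exp (- of_real (X\<^sup>2 / 4) * saddle_phase r k y) / shc (quad (k *\<^sub>R y) (\<i> * of_real r))))"
  proof -
    have "shifted A (t2 / h) (0 + k *\<^sub>R y) (\<i> * of_real r) = of_real (exp (- (X * r / sin r)\<^sup>2 / (4 * h))) *
       (exp (- of_real (X\<^sup>2 / 4) * saddle_phase r k y) / shc (quad (k *\<^sub>R y) (\<i> * of_real r)))" for y
    proof -
      define P where "P = phase (k *\<^sub>R y) (\<i> * of_real r)"
      have ph: "P = of_real (k\<^sup>2) * saddle_phase r k y + of_real (r * cot r - 1) + \<i> * of_real (mu r * k * y $ 2)"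
        unfolding saddle_phase_def P_def[symmetric] using k(1) by (simp add: field_simps)
      have Ak: "of_real A * of_real (k\<^sup>2) = complex_of_real (X\<^sup>2 / 4)" using h k by (simp add: A_def)
      \<comment> \<open>The critical value of the exponent is minus the squared arc length over
        \<open>4 * h\<close>: here the saddle meets Dido's problem.\<close>
      have d: "A * (r * cot r + mu r * r) = (X * r / sin r)\<^sup>2 / (4 * h)"
      proof -
        have "r * cot r + mu r * r = r * (mu r + cot r)" by (simp add: algebra_simps)
        also have "\<dots> = r\<^sup>2 / (sin r)\<^sup>2" using s by (simp add: mu_eq power2_eq_square)
        finally show ?thesis by (simp add: A_def power_mult_distrib power_divide)
      qed
      \<comment> \<open>The terms linear in \<open>y $ 2\<close> cancel because
        \<open>t2 / h = A * mu r\<close>, the equation that determines \<open>r\<close>.\<close>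
      have "- of_real A * (1 + P) + \<i> * of_real (t2 / h) * (of_real ((k *\<^sub>R y) $ 2) + \<i> * of_real r)
         = - (of_real A * of_real (k\<^sup>2)) * saddle_phase r k y + of_real (- (A * (r * cot r + mu r * r)))"
        unfolding ph A(2) by (simp add: algebra_simps)
      also have "\<dots> = - of_real (X\<^sup>2 / 4) * saddle_phase r k y + of_real (- (X * r / sin r)\<^sup>2 / (4 * h))"
        unfolding Ak d by simp
      finally have eq: "- of_real A * (1 + P) + \<i> * of_real (t2 / h) * (of_real ((k *\<^sub>R y) $ 2) + \<i> * of_real r)
         = - of_real (X\<^sup>2 / 4) * saddle_phase r k y + of_real (- (X * r / sin r)\<^sup>2 / (4 * h))" .
      show ?thesis unfolding shifted_def add_0 P_def[symmetric] eq exp_add exp_of_real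
        by (simp only: times_divide_eq_right mult.commute)
    qed
    then show ?thesis by simp
  qed
  also have "\<dots> = of_real (\<bar>k\<bar> ^ 3 * exp (- (X * r / sin r)\<^sup>2 / (4 * h))) * saddle_integral r (X\<^sup>2 / 4) k"
    unfolding saddle_integral_def integral_mult_right_zero scaleR_conv_of_real of_real_mult mult.assoc ..
  also have "\<bar>k\<bar> ^ 3 = h powr (3 / 2)"
    using h by (simp add: k_def powr_half_sqrt[symmetric] powr_power)
  finally show ?thesis unfolding k_def .
qed

text \<open>The curvature \<open>a\<close> supplies the derivative of \<open>Upsilon\<close>,
  \<open>b\<close> the sine that cancels against \<open>r / sin r\<close>, and \<open>c\<close> the
  value of \<open>mu\<close> that becomes \<open>t2\<close>.\<close>

lemma saddle_constant:
  assumes X: "X > 0" and r: "0 < r" "r < pi" and t2: "t2 = X\<^sup>2 * mu r / 4"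
    and q: "q = X\<^sup>2 / 4"
    and coeffs: "a = mu r / (2 * r) - 1 / Upsilon r" "b = (1 - r * cot r) / (sin r)\<^sup>2" "c = mu r / (2 * r)"
  shows "pi powr (3 / 2) / sqrt ((q * a) * (q * b) * (q * c)) * (r / sin r)
     = 8 * pi powr (3 / 2) * Upsilon r powr (3 / 2) * (- deriv Upsilon r) powr (- 1 / 2) * t2 powr (- 1 / 2) * X powr (- 2)"
proof -
  define U where "U = Upsilon r"
  define D where "D = - deriv Upsilon r"
  define m where "m = mu r"
  have s: "sin r > 0" using r by (rule sin_gt_zero)
  have m: "m > 0" using mu_pos_iff[of r] r by (simp add: m_def)
  have U: "U > 0" "D > 0" using Upsilon_pos[OF r] deriv_Upsilon_neg[OF r] by (simp_all add: U_def D_def)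
  have a: "a = r * D / (2 * U\<^sup>2)" unfolding coeffs deriv_Upsilon[OF r] U_def D_def ..
  have b: "b = r\<^sup>2 / (U * (sin r)\<^sup>2)"
    using r one_minus_r_cot_pos[OF r] s by (simp add: coeffs U_def Upsilon_def)
  have c: "c = m / (2 * r)" by (simp add: coeffs m_def)
  have inverse_sqrt: "1 / sqrt y = y powr (- 1 / 2)" if "y > 0" for y :: real
  proof -
    have "y powr (- 1 / 2) = y powr (- (1 / 2))" by simp
    also have "\<dots> = 1 / sqrt y" using that by (simp only: powr_minus powr_half_sqrt inverse_eq_divide less_imp_le)
    finally show ?thesis by simp
  qed
  have square: "(q * a) * (q * b) * (q * c) = (X ^ 3 * r / (16 * sin r * U))\<^sup>2 * (D * m / U)"
    unfolding q a b c using r s U X by (simp add: field_simps power2_eq_square power3_eq_cube)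
  have "X ^ 3 * r / (16 * sin r * U) \<ge> 0" using r s U X by simp
  then have root: "sqrt ((q * a) * (q * b) * (q * c)) = X ^ 3 * r / (16 * sin r * U) * (sqrt D * sqrt m / sqrt U)"
    unfolding square by (simp only: real_sqrt_mult real_sqrt_divide real_sqrt_abs abs_of_nonneg)
  have "p / (X ^ 3 * r / (16 * sin r * U) * (d * n / u)) * (r / sin r) = p * (16 * (U * u) / (X ^ 3 * d * n))"
    if "d > 0" "n > 0" "u > 0" for p d n u
    using that r s U X by (simp add: field_simps)
  then have "pi powr (3 / 2) / sqrt ((q * a) * (q * b) * (q * c)) * (r / sin r)
     = pi powr (3 / 2) * (16 * (U * sqrt U) / (X ^ 3 * sqrt D * sqrt m))"
    unfolding root using U m by simp
  also have "U * sqrt U = U powr (3 / 2)"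
  proof -
    have "U powr (3 / 2) = U powr (1 + 1 / 2)" by simp
    also have "\<dots> = U * sqrt U" using U by (subst powr_add) (simp add: powr_half_sqrt)
    finally show ?thesis by simp
  qed
  also have "16 * U powr (3 / 2) / (X ^ 3 * sqrt D * sqrt m)
     = 8 * U powr (3 / 2) * (1 / sqrt D) * (1 / sqrt t2) * (1 / X\<^sup>2)"
  proof -
    \<comment> \<open>Trading \<open>sqrt m\<close> for \<open>sqrt t2\<close> absorbs one factor
      \<open>X\<close> and a factor \<open>2\<close>, so \<open>16\<close> becomes \<open>8\<close>
      and the cube of \<open>X\<close> its square.\<close>
    have root_t2: "sqrt t2 = X * sqrt m / 2" using X by (simp add: t2 m_def real_sqrt_mult real_sqrt_divide)
    show ?thesis unfolding root_t2 by (simp add: power2_eq_square power3_eq_cube)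
  qed
  also have "1 / sqrt D = D powr (- 1 / 2)" using U(2) by (rule inverse_sqrt)
  also have "1 / sqrt t2 = t2 powr (- 1 / 2)" using X m by (intro inverse_sqrt) (simp add: t2 m_def)
  also have "1 / X\<^sup>2 = X powr (- 2)" using X by (simp add: powr_minus powr_numeral divide_inverse)
  finally show ?thesis by (simp add: U_def D_def mult.assoc)
qed

theorem corollary11p8:
  fixes C :: real and x t :: "real ^ 3" and t2 :: real
  assumes "C > 0"
    and "x = norm x *\<^sub>R vector [1, 0, 0]" and "x \<noteq> 0"
    and "t = vector [0, t2, 0]" and "t2 > 0"
  shows "\<exists>r. r \<in> {-pi<..<pi} \<and> mu r = 4 * t2 / (norm x)\<^sup>2 \<and>
           (\<forall>\<rho>\<in>{-pi<..<pi}. mu \<rho> = 4 * t2 / (norm x)\<^sup>2 \<longrightarrow> \<rho> = r) \<and>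
           (\<exists>err :: real \<Rightarrow> real. (err \<longlongrightarrow> 0) (at_right 0) \<and>
              (\<forall>h>0. heat_kernel C h x t =
                 complex_of_real
                   (C * (8 * pi powr (3 / 2)) * h powr (- 3) * Upsilon r powr (3 / 2) *
                    (- deriv Upsilon r) powr (- 1 / 2) * t2 powr (- 1 / 2) *
                    norm x powr (- 2) * exp (- (cc_dist (x, t))\<^sup>2 / (4 * h)) * (1 + err h))))"
proof -
  define X where "X = norm x"
  have X: "X > 0" using assms(3) by (simp add: X_def)
  have x: "x = X *\<^sub>R vector [1, 0, 0]" using assms(2) by (simp add: X_def)
  obtain r where r: "0 < r" "r < pi" "mu r = 4 * t2 / X\<^sup>2"
    and uniq: "\<And>\<rho>. \<lbrakk>- pi < \<rho>; \<rho> < pi; mu \<rho> = 4 * t2 / X\<^sup>2\<rbrakk> \<Longrightarrow> \<rho> = r"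
    using mu_ex1[of "4 * t2 / X\<^sup>2"] assms(5) X by auto
  have t2: "t2 = X\<^sup>2 * mu r / 4" using r(3) X by simp
  have dist: "cc_dist (x, t) = X * r / sin r"
    using cc_dist_eq[OF X r(1,2)] unfolding x assms(4) t2 by simp
  define K where "K = 8 * pi powr (3 / 2) * Upsilon r powr (3 / 2) * (- deriv Upsilon r) powr (- 1 / 2)
    * t2 powr (- 1 / 2) * X powr (- 2)"
  have K: "K > 0"
    using Upsilon_pos[OF r(1,2)] deriv_Upsilon_neg[OF r(1,2)] assms(5) X by (simp add: K_def)
  define J where "J = saddle_integral r (X\<^sup>2 / 4)"
  define E where "E h = exp (- (cc_dist (x, t))\<^sup>2 / (4 * h))" for h
  have m: "mu r > 0" using mu_pos_iff[of r] r by simp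
  have J: "(J \<longlongrightarrow> of_real K) (at_right 0)"
    unfolding J_def K_def saddle_constant[OF X r(1,2) t2 refl refl refl refl, symmetric]
  proof (rule saddle_integral_tendsto[OF r(1,2) _ refl refl refl])
    \<comment> \<open>Nondegeneracy of the saddle in the direction of \<open>x\<close> is the
      monotonicity of \<open>Upsilon\<close>.\<close>
    show "0 < mu r / (2 * r) - 1 / Upsilon r"
      unfolding deriv_Upsilon[OF r(1,2)]
      using Upsilon_pos[OF r(1,2)] deriv_Upsilon_neg[OF r(1,2)] r by (intro divide_pos_pos mult_pos_pos) auto
    show "0 < (1 - r * cot r) / (sin r)\<^sup>2"
      using one_minus_r_cot_pos[OF r(1,2)] sin_gt_zero[OF r(1,2)] by simp
    show "0 < mu r / (2 * r)" using m r(1) by simp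
    show "0 < X\<^sup>2 / 4" using X by simp
  qed
  have profile: "heat_profile ((1 / sqrt h) *\<^sub>R x) ((1 / h) *\<^sub>R t) = of_real (h powr (3 / 2) * E h) * J (sqrt h)"
    if "h > 0" for h
    using heat_profile_eq_saddle_integral[OF X that r(1,2) t2] unfolding J_def E_def dist unfolding assms(4) x .
  \<comment> \<open>The error is defined by the exact quotient, so the formula holds for every
    \<open>h > 0\<close> and the asymptotics lie in \<open>J\<close> tending to
    \<open>K\<close>.\<close>
  define err where "err h = Re (J (sqrt h)) / K - 1" for h
  have "((\<lambda>h. Re (J (sqrt h))) \<longlongrightarrow> Re (of_real K)) (at_right 0)"
  proof (rule tendsto_Re[OF filterlim_compose[OF J]])
    show "filterlim sqrt (at_right 0) (at_right (0::real))" by real_asymp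
  qed
  then have "(err \<longlongrightarrow> K / K - 1) (at_right 0)"
    unfolding err_def using K by (intro tendsto_intros) auto
  then have err: "(err \<longlongrightarrow> 0) (at_right 0)" using K by simp
  have "heat_kernel C h x t = of_real (C * (8 * pi powr (3 / 2)) * h powr (- 3) * Upsilon r powr (3 / 2) *
      (- deriv Upsilon r) powr (- 1 / 2) * t2 powr (- 1 / 2) * norm x powr (- 2) * E h * (1 + err h))" if h: "h > 0" for h
  proof -
    \<comment> \<open>Solving for \<open>J\<close> shows that it is real, so taking its real part in
      \<open>err\<close> loses nothing.\<close>
    have "J (sqrt h) = heat_profile ((1 / sqrt h) *\<^sub>R x) ((1 / h) *\<^sub>R t) / of_real (h powr (3 / 2) * E h)"
      unfolding profile[OF h] using h by (simp add: E_def)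
    then have "J (sqrt h) \<in> \<real>" using heat_profile_real by (simp only: Reals_divide Reals_of_real)
    then have real: "J (sqrt h) = of_real (K * (1 + err h))" using K by (simp add: err_def of_real_Re)
    have "h powr (- 9 / 2) * h powr (3 / 2) = h powr (- 3)" by (simp flip: powr_add)
    then have "C * h powr (- 9 / 2) * (h powr (3 / 2) * E h) * (K * (1 + err h)) = C * h powr (- 3) * E h * (K * (1 + err h))"
      by (metis mult.assoc)
    then show ?thesis
      unfolding heat_kernel_def profile[OF h] real of_real_mult[symmetric] K_def X_def by (simp only: mult_ac)
  qed
  then show ?thesis using r uniq err unfolding X_def E_def by (intro exI[of _ r]) auto
qed

end
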